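(* Let $N\geqslant2$, let $\Omega\subset\mathbb{R}^N$ be a smooth bounded domain, $s\in(0,1)$, and let $p\in C(\mathbb{R}^N\times\mathbb{R}^N)$ be symmetric ($p(x,y)=p(y,x)$) with $1<p^-:=\inf p\leqslant p^+:=\sup p<\frac Ns$ (infimum and supremum over $\mathbb{R}^N\times\mathbb{R}^N$). Let $\mathcal{A}:\mathbb{R}\to\mathbb{R}$ be continuous and odd, such that $\mathscr{A}(t):=\int_0^{|t|}\mathcal{A}(\tau)\,d\tau$ is strictly convex on $\mathbb{R}$; such that there are constants $c_{\mathcal{A}},C_{\mathcal{A}}>0$ with $\mathcal{A}(t)t\geqslant c_{\mathcal{A}}|t|^{p(x,y)}$ and $|\mathcal{A}(t)|\leqslant C_{\mathcal{A}}|t|^{p(x,y)-1}$ for all $t\in\mathbb{R}$ and all $(x,y)\in\mathbb{R}^N\times\mathbb{R}^N$; and such that $\mathcal{A}(t)t\leqslant p^+\mathscr{A}(t)$ for all $t\in\mathbb{R}$. Let $K:\mathbb{R}^N\times\mathbb{R}^N\to\mathbb{R}^+$ be measurable with constants $0<b_0\leqslant b_1$ such that $b_0\leqslant K(x,y)|x-y|^{N+sp(x,y)}\leqslant b_1$ for all $x\neq y$. Let $\mathfrak{m}_1,q\in C^+(\overline\Omega)$ with $\underline{\mathfrak{m}}_1^-\leqslant\underline{\mathfrak{m}}_1^+<p^-\leqslant p^+<\frac Ns<\underline q^-\leqslant\underline q^+$. Let $\mathfrak{a}:\overline\Omega\to\mathbb{R}$ with $\mathfrak{a}\in L^{q(\cdot)}(\Omega)$,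 and assume there exists a measurable set $\Omega_0\subset\Omega$ with nonempty interior and positive measure such that $\mathfrak{a}(x)>0$ for all $x\in\overline\Omega_0$. Then there exists $\lambda^\star>0$ such that any $\lambda\in(0,\lambda^\star)$ is an eigenvalue in $\mathscr{W}$ of the problem $$\mathscr{L}_{\mathcal{A}K}u=\lambda\mathfrak{a}(x)|u|^{\mathfrak{m}_1(x)-2}u\ \text{ in }\Omega,\qquad u=0\ \text{ in }\mathbb{R}^N\setminus\Omega.$$
   Context: $C^+(\overline\Omega)=\{h\in C(\overline\Omega):h(x)>1\ \forall x\in\overline\Omega\}$; for $h\in C^+(\overline\Omega)$, $\underline h^-=\inf_{\overline\Omega}h$ and $\underline h^+=\sup_{\overline\Omega}h$. $L^{h(\cdot)}(\Omega)$ is the variable exponent Lebesgue space of measurable $u:\Omega\to\mathbb{R}$ with $\int_\Omega|u(x)/\zeta|^{h(x)}dx<\infty$ for some $\zeta>0$, with Luxemburg norm $\inf\{\zeta>0:\int_\Omega|u/\zeta|^{h(x)}dx\leqslant1\}$; similarly on $\mathbb{R}^N$. Write $p(x):=p(x,x)$. $W^{s,p(\cdot,\cdot)}(\mathbb{R}^N)$ is the space of $u\in L^{p(\cdot)}(\mathbb{R}^N)$ such that $\int_{\mathbb{R}^N\times\mathbb{R}^N}\frac{|u(x)-u(y)|^{p(x,y)}}{\zeta^{p(x,y)}|x-y|^{N+sp(x,y)}}dx\,dy<\infty$ for some $\zeta>0$, and $\mathscr{W}=\{u\in W^{s,p(\cdot,\cdot)}(\mathbb{R}^N):u=0\text{ a.e.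 in }\mathbb{R}^N\setminus\Omega\}$. The operator is $\mathscr{L}_{\mathcal{A}K}u(x)=P.V.\int_{\mathbb{R}^N}\mathcal{A}(u(x)-u(y))K(x,y)\,dy$. A number $\lambda\in\mathbb{R}$ is an eigenvalue of the problem in $\mathscr{W}$ if there is $u\in\mathscr{W}\setminus\{0\}$ such that for every $v\in\mathscr{W}$ $$\int_{\mathbb{R}^N\times\mathbb{R}^N}\mathcal{A}(u(x)-u(y))(v(x)-v(y))K(x,y)\,dx\,dy=\lambda\int_\Omega\mathfrak{a}(x)|u|^{\mathfrak{m}_1(x)-2}u\,v\,dx.$$ *)

theory Defs
  imports "HOL-Analysis.Analysis"
begin

primrec continuously_differentiable :: "nat \<Rightarrow> ('a::euclidean_space \<Rightarrow> real) \<Rightarrow> bool" where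
  "continuously_differentiable 0 f \<longleftrightarrow> continuous_on UNIV f"
| "continuously_differentiable (Suc k) f \<longleftrightarrow>
     f differentiable_on UNIV \<and>
     (\<forall>v. continuously_differentiable k (\<lambda>x. frechet_derivative f (at x) v))"

definition smooth :: "('a::euclidean_space \<Rightarrow> real) \<Rightarrow> bool" where
  "smooth f \<longleftrightarrow> (\<forall>k. continuously_differentiable k f)"

text \<open>Near each boundary point, in suitably rotated coordinates, the domain is the region above the
  graph of a \<open>C\<^sup>\<infinity>\<close> function. The vector \<open>e\<close> is the vertical direction; only the
  values of \<open>g\<close> on the hyperplane orthogonal to \<open>e\<close> matter, and there \<open>g\<close> is a smooth function of
  the remaining \<open>N - 1\<close> coordinates.\<close>

definition smooth_bounded_domain :: "'a::euclidean_space set \<Rightarrow> bool" where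
  "smooth_bounded_domain \<Omega> \<longleftrightarrow>
     open \<Omega> \<and> connected \<Omega> \<and> \<Omega> \<noteq> {} \<and> bounded \<Omega> \<and>
     (\<forall>x0\<in>frontier \<Omega>. \<exists>r>0. \<exists>e g. norm e = 1 \<and> smooth g \<and>
        \<Omega> \<inter> ball x0 r = {x \<in> ball x0 r. x \<bullet> e > g (x - (x \<bullet> e) *\<^sub>R e)})"

definition strictly_convex_on :: "'a::real_vector set \<Rightarrow> ('a \<Rightarrow> real) \<Rightarrow> bool" where
  "strictly_convex_on S f \<longleftrightarrow> convex S \<and>
     (\<forall>x\<in>S. \<forall>y\<in>S. \<forall>t. x \<noteq> y \<and> 0 < t \<and> t < 1 \<longrightarrow>
        f ((1 - t) *\<^sub>R x + t *\<^sub>R y) < (1 - t) * f x + t * f y)"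

definition C_plus :: "'a::topological_space set \<Rightarrow> ('a \<Rightarrow> real) set" where
  "C_plus D = {h. continuous_on D h \<and> (\<forall>x\<in>D. h x > 1)}"

text \<open>Function spaces are represented by sets of functions, not by almost-everywhere classes.
  Measurability is Lebesgue measurability.\<close>

definition Lvar :: "(real^'n) set \<Rightarrow> (real^'n \<Rightarrow> real) \<Rightarrow> (real^'n \<Rightarrow> real) set" where
  "Lvar D h = {u. u \<in> borel_measurable (lebesgue_on D) \<and>
     (\<exists>\<zeta>>0. (\<integral>\<^sup>+ x. ennreal (\<bar>u x / \<zeta>\<bar> powr h x) \<partial>(lebesgue_on D)) < \<infinity>)}"

definition fractional_sobolev ::
  "real \<Rightarrow> (real^'n \<Rightarrow> real^'n \<Rightarrow> real) \<Rightarrow> (real^'n \<Rightarrow> real) set" where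
  "fractional_sobolev s p = {u \<in> Lvar UNIV (\<lambda>x. p x x).
     \<exists>\<zeta>>0. (\<integral>\<^sup>+ (x, y). ennreal (\<bar>u x - u y\<bar> powr p x y /
        (\<zeta> powr p x y * norm (x - y) powr (real CARD('n) + s * p x y))) \<partial>lebesgue) < \<infinity>}"

definition fractional_sobolev_zero ::
  "(real^'n) set \<Rightarrow> real \<Rightarrow> (real^'n \<Rightarrow> real^'n \<Rightarrow> real) \<Rightarrow> (real^'n \<Rightarrow> real) set" where
  "fractional_sobolev_zero \<Omega> s p =
     {u \<in> fractional_sobolev s p. AE x in lebesgue. x \<notin> \<Omega> \<longrightarrow> u x = 0}"

definition primitive_abs :: "(real \<Rightarrow> real) \<Rightarrow> real \<Rightarrow> real" where
  "primitive_abs A t = integral {0..\<bar>t\<bar>} A"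

text \<open>Weak eigenvalues of \<open>L u = lam a \<bar>u\<bar>\<^bsup>m - 2\<^esup> u\<close> in \<open>\<Omega>\<close>, \<open>u = 0\<close> outside \<open>\<Omega>\<close>, where
  \<open>L u x\<close> is the principal value integral of \<open>A (u x - u y) * K x y\<close> in \<open>y\<close>.
  Integrability is required explicitly because the Bochner integral of a
  non-integrable function is \<open>0\<close> by convention.\<close>

definition is_eigenvalue ::
  "(real^'n) set \<Rightarrow> real \<Rightarrow> (real^'n \<Rightarrow> real^'n \<Rightarrow> real) \<Rightarrow> (real \<Rightarrow> real) \<Rightarrow>
   (real^'n \<Rightarrow> real^'n \<Rightarrow> real) \<Rightarrow> (real^'n \<Rightarrow> real) \<Rightarrow> (real^'n \<Rightarrow> real) \<Rightarrow> real \<Rightarrow> bool" where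
  "is_eigenvalue \<Omega> s p A K a m lam \<longleftrightarrow>
     (\<exists>u \<in> fractional_sobolev_zero \<Omega> s p. \<not> (AE x in lebesgue. u x = 0) \<and>
       (\<forall>v \<in> fractional_sobolev_zero \<Omega> s p.
          integrable lebesgue (\<lambda>(x, y). A (u x - u y) * (v x - v y) * K x y) \<and>
          integrable (lebesgue_on \<Omega>) (\<lambda>x. a x * \<bar>u x\<bar> powr (m x - 2) * u x * v x) \<and>
          (\<integral>(x, y). A (u x - u y) * (v x - v y) * K x y \<partial>lebesgue) =
          lam * (\<integral>x. a x * \<bar>u x\<bar> powr (m x - 2) * u x * v x \<partial>(lebesgue_on \<Omega>))))"

end

theory Submission
  imports Defs "HOL-Complex_Analysis.Great_Picard"
begin

text \<open>
  The growth bounds on \<open>A\<close> are required for all \<open>t\<close> and all \<open>(x, y)\<close> with one and the same function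
  \<open>A\<close>; letting \<open>t\<close> tend to infinity shows that \<open>p\<close> is a constant \<open>P\<close>. The eigenfunction is a global
  minimiser of \<open>J u = \<integral>\<integral> \<Phi> (u x - u y) K - lam \<integral> a \<bar>u\<bar>\<^sup>m / m\<close>, where \<open>\<Phi>\<close> is the primitive of \<open>A\<close>.

  All integrability and compactness comes from one weighted estimate. Let \<open>avg\<^sub>k u\<close> be the average of
  \<open>u\<close> over the dyadic cells of side \<open>2\<^sup>-\<^sup>k\<close>. A weight \<open>w\<close> whose mass on such a cell is
  \<open>O(2\<^sup>-\<^sup>k\<^sup>(\<^sup>N\<^sup>-\<^sup>s\<^sup>))\<close> satisfies \<open>\<integral> w \<bar>u - avg\<^sub>k u\<bar>\<^sup>P \<le> C r\<^sup>k G u\<close> with \<open>r < 1\<close>, where \<open>G\<close> is the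
  Gagliardo energy, since the telescoping differences \<open>avg\<^sub>j\<^sub>+\<^sub>1 u - avg\<^sub>j u\<close> decay geometrically as
  soon as \<open>P > 1\<close>. The weight \<open>1 + \<bar>a\<bar>\<close> qualifies because \<open>a \<in> L\<^sup>N\<^sup>/\<^sup>s\<close>. Hence bounded sets of
  functions vanishing outside \<open>\<Omega>\<close> are relatively compact in \<open>L\<^sup>P(w dx)\<close>. Together with Fatou's lemma
  for the nonlocal term this gives a minimiser for small \<open>lam\<close>; since \<open>m < P\<close>, small multiples of a bump
  in \<open>\<Omega>0\<close> have negative energy, so the minimiser is not zero. No weak topology is needed.
\<close>

section \<open>Elementary inequalities and dyadic cells\<close>

text \<open>The potential has to be controlled by the energy although \<open>a\<close> may change
  sign and be unbounded. The exponents balance as follows. On cells of side h the averaged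
  oscillations integrate to O(h^(sP)) G; integrating their cell means against \<open>w\<close>
  multiplies this by mass over volume, h^(N-s) / h^N = h^(-s). What remains is h^(s(P-1)), a
  positive power exactly because P > 1. Half of that exponent becomes the \<open>rate\<close> of the
  final estimate; the other half pays for turning integral bounds into a pointwise summable series.
  The threshold \<open>lam_star\<close> comes from coercivity alone: |t|^m <= 1 + |t|^P bounds the
  potential by a constant plus \<open>embed_const\<close> times G, and \<open>lam\<close> must keep
  this multiple below half of the lower bound for the energy. The analysis runs on Borel functions
  that vanish at every point outside \<Omega>, with coefficients modified on null sets so that all
  bounds hold pointwise. Lebesgue measurability and a.e. statements return only when the minimiser
  is tested with arbitrary members of the space.\<close>

lemma powr_add_le:
  fixes x y p :: real
  assumes "0 \<le> x" "0 \<le> y" "0 \<le> p"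
  shows "(x + y) powr p \<le> 2 powr p * (x powr p + y powr p)"
proof -
  have "(x + y) powr p \<le> (2 * max x y) powr p"
    using assms by (intro powr_mono2) auto
  also have "\<dots> = 2 powr p * max x y powr p"
    using assms by (simp add: powr_mult)
  also have "\<dots> \<le> 2 powr p * (x powr p + y powr p)"
    by (intro mult_left_mono) (auto simp: max_def)
  finally show ?thesis .
qed

text \<open>Splitting at y = \<delta> x gives a Young inequality without conjugate exponents: below
  the threshold y is absorbed into the first term, above it x is at most y / \<delta> and goes into
  the second. The free \<delta> takes the place of Hoelder's inequality in the later
  estimates.\<close>

lemma powr_mult_le_Young:
  fixes x y p \<delta> :: real
  assumes "0 \<le> x" "0 \<le> y" "1 \<le> p" "0 < \<delta>"
  shows "x powr (p - 1) * y \<le> \<delta> * x powr p + \<delta> powr (1 - p) * y powr p"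
proof (cases "y \<le> \<delta> * x")
  case True
  have "x powr (p - 1) * y \<le> x powr (p - 1) * (\<delta> * x)"
    using True by (intro mult_left_mono) auto
  also have "\<dots> = \<delta> * x powr p"
    using assms powr_mult_base[of x "p - 1"] by (simp add: mult_ac)
  finally show ?thesis by (simp add: add_increasing2)
next
  case False
  then have "x \<le> y / \<delta>" using assms by (simp add: field_simps)
  then have "x powr (p - 1) * y \<le> (y / \<delta>) powr (p - 1) * y"
    using assms by (intro mult_right_mono powr_mono2) auto
  also have "\<dots> = \<delta> powr (1 - p) * (y * y powr (p - 1))"
    using assms by (simp add: powr_divide powr_diff field_simps)
  also have "\<dots> = \<delta> powr (1 - p) * y powr p"
    using assms by (simp add: powr_mult_base)
  finally show ?thesis using assms by (simp add: add_increasing)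
qed

lemma le_Young:
  fixes t p \<delta> :: real
  assumes "0 \<le> t" "1 \<le> p" "0 < \<delta>"
  shows "t \<le> \<delta> + \<delta> powr (1 - p) * t powr p"
  using powr_mult_le_Young[of 1 t p \<delta>] assms by simp

text \<open>Integrability on \<open>C\<close> is not assumed: the Bochner integral of a non-integrable function is \<open>0\<close>,
  which makes the left-hand side vanish.\<close>

lemma powr_average_le_nn_integral:
  fixes f :: "'a \<Rightarrow> real"
  assumes [measurable]: "f \<in> borel_measurable M" and p: "1 \<le> p"
    and C [measurable]: "C \<in> sets M" "emeasure M C = ennreal c" "0 < c"
  shows "ennreal (\<bar>(\<integral>x. indicator C x * f x \<partial>M) / c\<bar> powr p)
    \<le> ennreal (2 powr p / c) * (\<integral>\<^sup>+ x. indicator C x * ennreal (\<bar>f x\<bar> powr p) \<partial>M)"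
proof (cases "integrable M (\<lambda>x. indicator C x * f x) \<and> (\<integral>\<^sup>+ x. indicator C x * ennreal (\<bar>f x\<bar> powr p) \<partial>M) < \<infinity>")
  case False
  then consider "\<not> integrable M (\<lambda>x. indicator C x * f x)"
    | "(\<integral>\<^sup>+ x. indicator C x * ennreal (\<bar>f x\<bar> powr p) \<partial>M) = \<infinity>"
    using less_top by (metis infinity_ennreal_def)
  then show ?thesis
  proof cases
    case 1
    then show ?thesis by (simp add: not_integrable_integral_eq)
  next
    case 2
    then show ?thesis using \<open>0 < c\<close> by (simp add: ennreal_mult_top)
  qed
next
  case True
  then have int: "integrable M (\<lambda>x. indicator C x * f x)" by auto
  have eq: "indicator C x * ennreal (\<bar>f x\<bar> powr p) = ennreal (indicator C x * \<bar>f x\<bar> powr p)" for x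
    by (auto simp: indicator_def)
  have intp: "integrable M (\<lambda>x. indicator C x * \<bar>f x\<bar> powr p)"
    using True by (intro integrableI_nonneg) (auto simp: eq)
  define I where "I = (\<integral>x. indicator C x * \<bar>f x\<bar> powr p \<partial>M)"
  have I: "(\<integral>\<^sup>+ x. indicator C x * ennreal (\<bar>f x\<bar> powr p) \<partial>M) = ennreal I"
    unfolding eq I_def using intp by (intro nn_integral_eq_integral) auto
  have I0: "0 \<le> I" unfolding I_def by (intro integral_nonneg_AE) auto
  have intC: "integrable M (indicator C :: 'a \<Rightarrow> real)"
    using C by (intro integrable_real_indicator) auto
  have cM: "measure M C = c" using C by (simp add: measure_def)
  have young: "\<bar>(\<integral>x. indicator C x * f x \<partial>M)\<bar> \<le> \<delta> * c + \<delta> powr (1 - p) * I" if "0 < \<delta>" for \<delta>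
  proof -
    have "\<bar>(\<integral>x. indicator C x * f x \<partial>M)\<bar> \<le> (\<integral>x. \<bar>indicator C x * f x\<bar> \<partial>M)"
      by (rule integral_abs_bound)
    also have "\<dots> \<le> (\<integral>x. \<delta> * indicator C x + \<delta> powr (1 - p) * (indicator C x * \<bar>f x\<bar> powr p) \<partial>M)"
      using int intC intp le_Young[OF _ p that, of "\<bar>f _\<bar>"]
      by (intro integral_mono Bochner_Integration.integrable_add integrable_mult_right integrable_abs)
         (auto split: split_indicator)
    also have "\<dots> = \<delta> * c + \<delta> powr (1 - p) * I"
      using intC intp C cM unfolding I_def by (subst Bochner_Integration.integral_add) auto
    finally show ?thesis .
  qed
  have "\<bar>(\<integral>x. indicator C x * f x \<partial>M) / c\<bar> powr p \<le> 2 powr p / c * I"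
  proof (cases "I = 0")
    case True
    have "\<bar>(\<integral>x. indicator C x * f x \<partial>M)\<bar> \<le> 0 + e" if "0 < e" for e
      using young[of "e / c"] True that \<open>0 < c\<close> by simp
    then have "\<bar>(\<integral>x. indicator C x * f x \<partial>M)\<bar> \<le> 0"
      by (rule field_le_epsilon)
    then show ?thesis using True by simp
  next
    case False
    \<comment> \<open>This d makes the two terms of \<open>young\<close> equal, d * c each, whence
      the factor 2 that becomes 2 powr p. For I = 0 it would be 0, so that case lets the parameter
      tend to 0 instead.\<close>
    define d where "d = (I / c) powr (1 / p)"
    have d: "0 < d" "d powr p = I / c"
      using False I0 \<open>0 < c\<close> p by (auto simp: d_def powr_powr)
    have "d powr (1 - p) * I = d * c"
      using d False \<open>0 < c\<close> by (simp add: powr_diff)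
    then have "\<bar>(\<integral>x. indicator C x * f x \<partial>M) / c\<bar> \<le> 2 * d"
      using young[OF d(1)] \<open>0 < c\<close> by (simp add: field_simps)
    then have "\<bar>(\<integral>x. indicator C x * f x \<partial>M) / c\<bar> powr p \<le> (2 * d) powr p"
      using p by (intro powr_mono2) auto
    also have "\<dots> = 2 powr p / c * I" using d by (simp add: powr_mult)
    finally show ?thesis .
  qed
  then show ?thesis
    unfolding I using I0 \<open>0 < c\<close> by (simp add: ennreal_mult[symmetric] ennreal_leI)
qed

section \<open>Dyadic cells and averages over them\<close>

definition cell_index :: "nat \<Rightarrow> real^'n \<Rightarrow> int^'n" where
  "cell_index k x = (\<chi> i. \<lfloor>2 ^ k * x $ i\<rfloor>)"

text \<open>The half-open dyadic cube of side 2^(-k) containing x. Naming a cell by one of its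
  points makes membership symmetric, which is what the later exchange of integrals exploits, and
  makes the average over a cell a function of x.\<close>

definition cell :: "nat \<Rightarrow> real^'n \<Rightarrow> (real^'n) set" where
  "cell k x = {y. cell_index k y = cell_index k x}"

definition cell_avg :: "nat \<Rightarrow> (real^'n \<Rightarrow> real) \<Rightarrow> real^'n \<Rightarrow> real" where
  "cell_avg k u x = 2 ^ (k * CARD('n)) * (\<integral>y. indicator (cell k x) y * u y \<partial>lborel)"

lemma cell_index_eq_iff: "cell_index k x = cell_index k y \<longleftrightarrow> (\<forall>i. \<lfloor>2 ^ k * x $ i\<rfloor> = \<lfloor>2 ^ k * y $ i\<rfloor>)"
  by (simp add: cell_index_def vec_eq_iff)

lemma cell_commute: "x \<in> cell k y \<longleftrightarrow> y \<in> cell k x"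
  by (auto simp: cell_def)

lemma cell_eq: "x \<in> cell k y \<Longrightarrow> cell k x = cell k y"
  by (auto simp: cell_def)

lemma cell_Suc_subset: "cell (Suc k) x \<subseteq> cell k x"
proof
  fix y assume y: "y \<in> cell (Suc k) x"
  have *: "\<lfloor>2 ^ k * t\<rfloor> = \<lfloor>2 ^ Suc k * t\<rfloor> div 2" for t :: real
    using floor_divide_real_eq_div[of 2 "2 ^ Suc k * t"] by simp
  show "y \<in> cell k x"
    using y unfolding cell_def mem_Collect_eq cell_index_eq_iff by (metis *)
qed

lemma measurable_vec_nth_borel [measurable]: "(\<lambda>x::real^'n. x $ i) \<in> borel_measurable borel"
  by (intro borel_measurable_continuous_onI continuous_intros)

lemma measurable_cell_pair [measurable]:
  assumes [measurable]: "f \<in> borel_measurable M" "g \<in> borel_measurable M"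
  shows "Measurable.pred M (\<lambda>x. f x \<in> cell k (g x))"
  unfolding cell_def mem_Collect_eq cell_index_eq_iff by measurable

lemma sets_cell [measurable]: "cell k x \<in> sets borel"
proof -
  have "{y \<in> space borel. y \<in> cell k x} \<in> sets borel" by measurable
  then show ?thesis by simp
qed

text \<open>The diameter is estimated through the l1 norm, hence N and not its square root. This is
  the origin of the base of \<open>osc_const\<close>.\<close>

lemma norm_diff_cell:
  fixes x y :: "real^'n"
  assumes "y \<in> cell k x"
  shows "norm (x - y) \<le> real CARD('n) / 2 ^ k"
proof -
  have "\<bar>(x - y) $ i\<bar> \<le> 1 / 2 ^ k" for i
  proof -
    have "\<lfloor>2 ^ k * x $ i\<rfloor> = \<lfloor>2 ^ k * y $ i\<rfloor>"
      using assms by (auto simp: cell_def cell_index_eq_iff)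
    then have "\<bar>2 ^ k * x $ i - 2 ^ k * y $ i\<bar> \<le> 1" by linarith
    then have "2 ^ k * \<bar>x $ i - y $ i\<bar> \<le> 1"
      by (metis abs_mult abs_numeral power_abs right_diff_distrib)
    then show ?thesis by (simp add: field_simps)
  qed
  then have "(\<Sum>i\<in>UNIV. \<bar>(x - y) $ i\<bar>) \<le> (\<Sum>i\<in>(UNIV::'n set). 1 / 2 ^ k)"
    by (intro sum_mono) auto
  then show ?thesis using norm_le_l1_cart[of "x - y"] by simp
qed

text \<open>The half-open cube lies between the open and the closed box with corners l and h, and
  these have the same volume.\<close>

lemma emeasure_cell: "emeasure lborel (cell k (x::real^'n)) = ennreal (1 / 2 ^ (k * CARD('n)))"
proof -
  define l :: "real^'n" where "l = (\<chi> i. of_int \<lfloor>2 ^ k * x $ i\<rfloor> / 2 ^ k)"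
  define h :: "real^'n" where "h = (\<chi> i. (of_int \<lfloor>2 ^ k * x $ i\<rfloor> + 1) / 2 ^ k)"
  have lh: "l \<bullet> b \<le> h \<bullet> b" "h \<bullet> b - l \<bullet> b = 1 / 2 ^ k" if "b \<in> Basis" for b
  proof -
    obtain i where "b = axis i 1" using \<open>b \<in> Basis\<close> by (auto simp: Basis_vec_def)
    then show "l \<bullet> b \<le> h \<bullet> b" "h \<bullet> b - l \<bullet> b = 1 / 2 ^ k"
      by (auto simp: l_def h_def inner_axis divide_right_mono field_simps)
  qed
  have "(\<Prod>b\<in>Basis. (h - l) \<bullet> b) = (\<Prod>b\<in>(Basis::(real^'n) set). 1 / 2 ^ k)"
    using lh by (intro prod.cong) (auto simp: inner_diff_left)
  also have "\<dots> = 1 / 2 ^ (k * CARD('n))"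
    by (simp add: power_mult power_divide)
  finally have pr: "(\<Prod>b\<in>Basis. (h - l) \<bullet> b) = 1 / 2 ^ (k * CARD('n))" .
  have mem: "y \<in> cell k x \<longleftrightarrow> (\<forall>i. l $ i \<le> y $ i \<and> y $ i < h $ i)" for y
    unfolding cell_def mem_Collect_eq cell_index_eq_iff l_def h_def
    by (simp add: floor_eq_iff field_simps)
  have "box l h \<subseteq> cell k x" "cell k x \<subseteq> cbox l h"
    unfolding subset_iff mem mem_box_cart by (auto intro: less_imp_le)
  then have "emeasure lborel (box l h) \<le> emeasure lborel (cell k x)"
    "emeasure lborel (cell k x) \<le> emeasure lborel (cbox l h)"
    by (auto intro!: emeasure_mono)
  then show ?thesis
    using lh(1) pr by (simp add: emeasure_lborel_cbox_eq emeasure_lborel_box_eq)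
qed

lemma cell_avg_powr_le:
  fixes f :: "real^'n \<Rightarrow> real"
  assumes [measurable]: "f \<in> borel_measurable borel" and p: "1 \<le> p"
  shows "ennreal (\<bar>cell_avg k f x\<bar> powr p)
    \<le> ennreal (2 powr p * 2 ^ (k * CARD('n))) * (\<integral>\<^sup>+ y. indicator (cell k x) y * ennreal (\<bar>f y\<bar> powr p) \<partial>lborel)"
  using powr_average_le_nn_integral[of f lborel p "cell k x" "1 / 2 ^ (k * CARD('n))"] p
  by (simp add: emeasure_cell cell_avg_def mult_ac)

lemma cell_avg_cong: "y \<in> cell k x \<Longrightarrow> cell_avg k u y = cell_avg k u x"
  by (simp add: cell_avg_def cell_eq)

lemma cell_avg_diff_const:
  fixes f :: "real^'n \<Rightarrow> real"
  assumes "integrable lborel (\<lambda>y. indicator (cell k x) y * f y)"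
  shows "cell_avg k (\<lambda>y. f y - c) x = cell_avg k f x - c"
proof -
  have "integrable lborel (\<lambda>y. c * indicator (cell k x) y)"
    by (intro integrable_mult_right integrable_real_indicator) (auto simp: emeasure_cell)
  moreover have "measure lborel (cell k x) = 1 / 2 ^ (k * CARD('n))"
    by (simp add: measure_def emeasure_cell)
  moreover have "indicator (cell k x) y * (f y - c) = indicator (cell k x) y * f y - c * indicator (cell k x) y" for y
    by (simp add: algebra_simps)
  ultimately show ?thesis
    using assms by (simp add: cell_avg_def right_diff_distrib)
qed

lemma cell_avg_diff:
  assumes "integrable lborel (\<lambda>y. indicator (cell k x) y * f y)"
    "integrable lborel (\<lambda>y. indicator (cell k x) y * g y)"
  shows "cell_avg k (\<lambda>y. f y - g y) x = cell_avg k f x - cell_avg k g x"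
  using assms by (simp add: cell_avg_def right_diff_distrib)

lemma borel_measurable_cell_avg [measurable]:
  fixes f :: "real^'n \<Rightarrow> real"
  assumes [measurable]: "f \<in> borel_measurable borel"
  shows "cell_avg k f \<in> borel_measurable borel"
proof -
  have [measurable]: "(\<lambda>(x, y). indicator (cell k x) y * f y) \<in> borel_measurable (borel \<Otimes>\<^sub>M lborel)"
  proof -
    have "(\<lambda>z. (if snd z \<in> cell k (fst z) then 1 else 0) * f (snd z)) \<in> borel_measurable (borel \<Otimes>\<^sub>M lborel)"
      by measurable
    then show ?thesis by (simp add: indicator_def case_prod_beta)
  qed
  show ?thesis unfolding cell_avg_def[abs_def] by measurable
qed

section \<open>Cell averages and oscillation\<close>

text \<open>The P-th power of the Gagliardo seminorm, with values in \<open>ennreal\<close> so that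
  it is meaningful before finiteness is known. On the diagonal the integrand is 0 / 0 = 0.\<close>

definition gagliardo :: "real \<Rightarrow> real \<Rightarrow> (real^'n \<Rightarrow> real) \<Rightarrow> ennreal" where
  "gagliardo s P u = (\<integral>\<^sup>+ x. \<integral>\<^sup>+ y.
     ennreal (\<bar>u x - u y\<bar> powr P / norm (x - y) powr (real CARD('n) + s * P)) \<partial>lborel \<partial>lborel)"

definition cell_osc :: "real \<Rightarrow> nat \<Rightarrow> (real^'n \<Rightarrow> real) \<Rightarrow> real^'n \<Rightarrow> ennreal" where
  "cell_osc P k u x = ennreal (2 ^ (k * CARD('n))) *
     (\<integral>\<^sup>+ y. indicator (cell k x) y * ennreal (\<bar>u x - u y\<bar> powr P) \<partial>lborel)"

text \<open>Averaging \<open>cell_osc\<close> once more makes the result constant on cells of level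
  k. Integrated against a possibly singular weight, such a function sees only the masses of the
  weight on cells; \<open>cell_osc\<close> itself offers no such control.\<close>

definition cell_mean_osc :: "real \<Rightarrow> nat \<Rightarrow> (real^'n \<Rightarrow> real) \<Rightarrow> real^'n \<Rightarrow> ennreal" where
  "cell_mean_osc P k u x = ennreal (2 ^ (k * CARD('n))) *
     (\<integral>\<^sup>+ y. indicator (cell k x) y * cell_osc P k u y \<partial>lborel)"

lemma borel_measurable_cell_osc [measurable]:
  assumes [measurable]: "u \<in> borel_measurable borel"
  shows "cell_osc P k u \<in> borel_measurable borel"
  unfolding cell_osc_def[abs_def] by measurable

lemma borel_measurable_cell_mean_osc [measurable]:
  assumes [measurable]: "u \<in> borel_measurable borel"
  shows "cell_mean_osc P k u \<in> borel_measurable borel"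
  unfolding cell_mean_osc_def[abs_def] by measurable

text \<open>Two points of one cell are at distance at most N / 2^k, so there the singular kernel is
  at least (2^k / N)^(N + sP). The normalising factor 2^(kN) consumes the N in this exponent and the
  gain 2^(-ksP) is left.\<close>

lemma nn_integral_cell_osc_le:
  fixes u :: "real^'n \<Rightarrow> real"
  assumes [measurable]: "u \<in> borel_measurable borel" and "0 < s" "0 < P"
  shows "(\<integral>\<^sup>+ x. cell_osc P k u x \<partial>lborel)
    \<le> ennreal (real CARD('n) powr (real CARD('n) + s * P) * 2 powr (- (real k * s * P))) * gagliardo s P u"
proof -
  let ?N = "real CARD('n)"
  define b where "b = ?N + s * P"
  have b: "0 < b" using assms by (simp add: b_def add_pos_pos)
  have c: "2 ^ (k * CARD('n)) * (?N / 2 ^ k) powr b = ?N powr b * 2 powr (- (real k * s * P))"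
  proof -
    have "(?N / 2 ^ k) powr b = ?N powr b * 2 powr (- (real k * b))"
    proof -
      have "(2::real) ^ k = 2 powr real k" by (simp add: powr_realpow)
      then have "(2 ^ k) powr b = 2 powr (real k * b)" by (simp only: powr_powr)
      then show ?thesis by (simp only: powr_divide) (simp add: powr_minus divide_inverse)
    qed
    moreover have "(2::real) ^ (k * CARD('n)) = 2 powr (real k * ?N)"
      by (subst powr_realpow[symmetric]) auto
    moreover have "2 powr (real k * ?N) * 2 powr (- (real k * b)) = (2::real) powr (- (real k * s * P))"
      by (simp add: powr_add[symmetric] b_def algebra_simps)
    ultimately show ?thesis by (simp add: mult_ac)
  qed
  have pt: "indicator (cell k x) y * ennreal (\<bar>u x - u y\<bar> powr P)
      \<le> ennreal ((?N / 2 ^ k) powr b) * ennreal (\<bar>u x - u y\<bar> powr P / norm (x - y) powr b)" for x y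
  proof (cases "y \<in> cell k x \<and> x \<noteq> y")
    case True
    then have "norm (x - y) powr b \<le> (?N / 2 ^ k) powr b"
      using b by (intro powr_mono2 norm_diff_cell) auto
    then have "\<bar>u x - u y\<bar> powr P * norm (x - y) powr b \<le> \<bar>u x - u y\<bar> powr P * (?N / 2 ^ k) powr b"
      by (intro mult_left_mono) auto
    then have "\<bar>u x - u y\<bar> powr P \<le> (?N / 2 ^ k) powr b * (\<bar>u x - u y\<bar> powr P / norm (x - y) powr b)"
      using True by (simp add: field_simps)
    then show ?thesis using True by (simp add: ennreal_mult[symmetric] ennreal_leI)
  qed auto
  have "(\<integral>\<^sup>+ x. cell_osc P k u x \<partial>lborel) \<le> (\<integral>\<^sup>+ x. ennreal (2 ^ (k * CARD('n))) *
     (\<integral>\<^sup>+ y. ennreal ((?N / 2 ^ k) powr b) * ennreal (\<bar>u x - u y\<bar> powr P / norm (x - y) powr b) \<partial>lborel) \<partial>lborel)"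
    unfolding cell_osc_def by (intro nn_integral_mono mult_left_mono pt) auto
  also have "\<dots> = ennreal (2 ^ (k * CARD('n))) * ennreal ((?N / 2 ^ k) powr b) * gagliardo s P u"
    unfolding gagliardo_def b_def[symmetric] by (simp add: nn_integral_cmult mult.assoc)
  also have "ennreal (2 ^ (k * CARD('n))) * ennreal ((?N / 2 ^ k) powr b) =
      ennreal (?N powr b * 2 powr (- (real k * s * P)))"
    unfolding c[symmetric] by (simp add: ennreal_mult)
  finally show ?thesis by (simp add: b_def)
qed

text \<open>Subtracting the constant \<open>u x\<close> before averaging turns the deviation from
  the average into an average of differences, to which the bound for powers of averages
  applies.\<close>

lemma powr_diff_cell_avg_le:
  fixes u :: "real^'n \<Rightarrow> real"
  assumes [measurable]: "u \<in> borel_measurable borel" and "1 \<le> P"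
    and int: "integrable lborel (\<lambda>y. indicator (cell k x) y * u y)"
  shows "ennreal (\<bar>u x - cell_avg k u x\<bar> powr P) \<le> ennreal (2 powr P) * cell_osc P k u x"
proof -
  have "ennreal (\<bar>cell_avg k (\<lambda>y. u y - u x) x\<bar> powr P) \<le> ennreal (2 powr P * 2 ^ (k * CARD('n))) *
     (\<integral>\<^sup>+ y. indicator (cell k x) y * ennreal (\<bar>u y - u x\<bar> powr P) \<partial>lborel)"
    using assms by (intro cell_avg_powr_le) auto
  then show ?thesis
    using int by (simp add: cell_avg_diff_const cell_osc_def abs_minus_commute ennreal_mult mult.assoc)
qed

text \<open>The coarse average is constant on the parent cell, so the increment is the fine average
  of u minus that constant. One factor 2^P comes from averaging, a second from the deviation of u
  from its coarse average, and 2^N from replacing the child cell by its parent.\<close>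

lemma powr_cell_avg_Suc_diff_le:
  fixes u :: "real^'n \<Rightarrow> real"
  assumes [measurable]: "u \<in> borel_measurable borel" and P: "1 \<le> P"
    and int: "\<And>k x. integrable lborel (\<lambda>y. indicator (cell k x) y * u y)"
  shows "ennreal (\<bar>cell_avg (Suc k) u x - cell_avg k u x\<bar> powr P)
    \<le> ennreal (4 powr P * 2 ^ CARD('n)) * cell_mean_osc P k u x"
proof -
  have "ennreal (\<bar>cell_avg (Suc k) u x - cell_avg k u x\<bar> powr P) =
      ennreal (\<bar>cell_avg (Suc k) (\<lambda>y. u y - cell_avg k u x) x\<bar> powr P)"
    using int by (simp add: cell_avg_diff_const)
  also have "\<dots> \<le> ennreal (2 powr P * 2 ^ (Suc k * CARD('n))) *
     (\<integral>\<^sup>+ y. indicator (cell (Suc k) x) y * ennreal (\<bar>u y - cell_avg k u x\<bar> powr P) \<partial>lborel)"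
    using P by (intro cell_avg_powr_le) auto
  also have "\<dots> \<le> ennreal (2 powr P * 2 ^ (Suc k * CARD('n))) *
     (\<integral>\<^sup>+ y. ennreal (2 powr P) * (indicator (cell k x) y * cell_osc P k u y) \<partial>lborel)"
  proof (intro mult_left_mono nn_integral_mono)
    fix y
    show "indicator (cell (Suc k) x) y * ennreal (\<bar>u y - cell_avg k u x\<bar> powr P)
      \<le> ennreal (2 powr P) * (indicator (cell k x) y * cell_osc P k u y)"
    proof (cases "y \<in> cell (Suc k) x")
      case True
      then have y: "y \<in> cell k x" using cell_Suc_subset by auto
      show ?thesis
        using powr_diff_cell_avg_le[OF assms(1) P int, of y k] True y by (simp add: cell_avg_cong)
    qed simp
  qed simp
  also have "\<dots> = ennreal (2 powr P * 2 ^ (Suc k * CARD('n))) * ennreal (2 powr P) *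
     (\<integral>\<^sup>+ y. indicator (cell k x) y * cell_osc P k u y \<partial>lborel)"
    by (simp add: nn_integral_cmult mult.assoc)
  also have "ennreal (2 powr P * 2 ^ (Suc k * CARD('n))) * ennreal (2 powr P) =
    ennreal (4 powr P * 2 ^ CARD('n)) * ennreal (2 ^ (k * CARD('n)))"
  proof -
    have "(4::real) powr P = 2 powr P * 2 powr P"
      using powr_mult[of 2 2 P] by simp
    then show ?thesis by (simp add: ennreal_mult[symmetric] power_add mult_ac)
  qed
  finally show ?thesis by (simp add: cell_mean_osc_def mult.assoc)
qed

text \<open>By Tonelli and the symmetry of cell membership the weight can be integrated first, over
  the cell of the inner variable. Only its mass there enters, and an unweighted integral of the
  oscillation remains.\<close>

lemma nn_integral_weight_cell_mean_osc_le:
  fixes u :: "real^'n \<Rightarrow> real" and w :: "real^'n \<Rightarrow> ennreal"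
  assumes [measurable]: "u \<in> borel_measurable borel" "w \<in> borel_measurable borel"
    and w: "\<And>x. (\<integral>\<^sup>+ y. indicator (cell k x) y * w y \<partial>lborel) \<le> B"
  shows "(\<integral>\<^sup>+ x. w x * cell_mean_osc P k u x \<partial>lborel)
    \<le> ennreal (2 ^ (k * CARD('n))) * B * (\<integral>\<^sup>+ x. cell_osc P k u x \<partial>lborel)"
proof -
  have "(\<integral>\<^sup>+ x. w x * cell_mean_osc P k u x \<partial>lborel) = ennreal (2 ^ (k * CARD('n))) *
      (\<integral>\<^sup>+ x. \<integral>\<^sup>+ y. w x * (indicator (cell k x) y * cell_osc P k u y) \<partial>lborel \<partial>lborel)"
  proof -
    have "w x * cell_mean_osc P k u x = ennreal (2 ^ (k * CARD('n))) *
      (\<integral>\<^sup>+ y. w x * (indicator (cell k x) y * cell_osc P k u y) \<partial>lborel)" for x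
      unfolding cell_mean_osc_def by (subst nn_integral_cmult) (auto simp: mult_ac)
    then show ?thesis by (simp add: nn_integral_cmult)
  qed
  also have "(\<integral>\<^sup>+ x. \<integral>\<^sup>+ y. w x * (indicator (cell k x) y * cell_osc P k u y) \<partial>lborel \<partial>lborel) =
      (\<integral>\<^sup>+ y. \<integral>\<^sup>+ x. w x * (indicator (cell k x) y * cell_osc P k u y) \<partial>lborel \<partial>lborel)"
    by (intro lborel_pair.Fubini'[symmetric]) measurable
  also have "\<dots> = (\<integral>\<^sup>+ y. (\<integral>\<^sup>+ x. indicator (cell k y) x * w x \<partial>lborel) * cell_osc P k u y \<partial>lborel)"
  proof (intro nn_integral_cong)
    fix y
    have "(\<lambda>x. w x * (indicator (cell k x) y * cell_osc P k u y)) =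
        (\<lambda>x. indicator (cell k y) x * w x * cell_osc P k u y)"
      by (auto simp: indicator_def cell_commute[of y] mult_ac)
    then show "(\<integral>\<^sup>+ x. w x * (indicator (cell k x) y * cell_osc P k u y) \<partial>lborel) =
        (\<integral>\<^sup>+ x. indicator (cell k y) x * w x \<partial>lborel) * cell_osc P k u y"
      by (simp add: nn_integral_multc)
  qed
  also have "\<dots> \<le> (\<integral>\<^sup>+ y. B * cell_osc P k u y \<partial>lborel)"
    by (intro nn_integral_mono mult_right_mono w) auto
  also have "\<dots> = B * (\<integral>\<^sup>+ y. cell_osc P k u y \<partial>lborel)"
    by (simp add: nn_integral_cmult)
  finally show ?thesis by (simp add: mult_left_mono mult.assoc)
qed

section \<open>Telescoping and summation with geometric decay\<close>

lemma LIMSEQ_geometric_bound: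
  fixes a :: "nat \<Rightarrow> real"
  assumes lim: "a \<longlonglongrightarrow> L" and step: "\<And>j. \<bar>a (Suc j) - a j\<bar> \<le> B * r ^ j" and r: "0 < r" "r < 1"
  shows "\<bar>L - a k\<bar> \<le> B * r ^ k / (1 - r)"
proof -
  have B: "0 \<le> B" using step[of 0] by simp
  have sum: "\<bar>a (n + k) - a k\<bar> \<le> B * r ^ k * (\<Sum>i<n. r ^ i)" for n
  proof (induction n)
    case (Suc n)
    have "\<bar>a (Suc n + k) - a k\<bar> \<le> \<bar>a (Suc (n + k)) - a (n + k)\<bar> + \<bar>a (n + k) - a k\<bar>" by simp
    also have "\<dots> \<le> B * r ^ (n + k) + B * r ^ k * (\<Sum>i<n. r ^ i)"
      by (intro add_mono step Suc.IH)
    finally show ?case by (simp add: algebra_simps power_add)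
  qed simp
  have "(\<Sum>i<n. r ^ i) \<le> 1 / (1 - r)" for n
    using r sum_gp_strict[of r n] by (simp add: divide_right_mono)
  then have "B * r ^ k * (\<Sum>i<n. r ^ i) \<le> B * r ^ k * (1 / (1 - r))" for n
    using B r by (intro mult_left_mono) auto
  then have bd: "\<bar>a (n + k) - a k\<bar> \<le> B * r ^ k / (1 - r)" for n
    using sum[of n] order_trans by fastforce
  have "(\<lambda>n. \<bar>a (n + k) - a k\<bar>) \<longlonglongrightarrow> \<bar>L - a k\<bar>"
    by (intro tendsto_intros LIMSEQ_ignore_initial_segment lim)
  then show ?thesis
    by (rule LIMSEQ_le_const2) (use bd in auto)
qed

lemma ennreal_suminf_finite_LIMSEQ_zero:
  fixes f :: "nat \<Rightarrow> ennreal"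
  assumes "(\<Sum>n. f n) \<noteq> \<infinity>"
  shows "f \<longlonglongrightarrow> 0"
proof -
  have "f n \<noteq> \<infinity>" for n
    using ennreal_suminf_lessD[of f \<infinity> n] assms by (auto simp: less_top)
  then have f: "f n = ennreal (enn2real (f n))" for n by (simp add: less_top)
  then have "(\<Sum>n. ennreal (enn2real (f n))) \<noteq> top"
    using assms by simp
  then have "summable (\<lambda>n. enn2real (f n))"
    by (intro summable_suminf_not_top) auto
  then have "(\<lambda>n. ennreal (enn2real (f n))) \<longlonglongrightarrow> ennreal 0"
    by (intro tendsto_ennrealI summable_LIMSEQ_zero)
  then show ?thesis using f by simp
qed

lemma suminf_cmult_geometric_ennreal:
  assumes "0 \<le> c" "0 \<le> r" "r < 1"
  shows "(\<Sum>k. ennreal (c * r ^ k) * g) = ennreal (c / (1 - r)) * g"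
proof -
  have "(\<Sum>k. ennreal (c * r ^ k)) = ennreal (\<Sum>k. c * r ^ k)"
    using assms by (intro suminf_ennreal2) (auto intro!: summable_mult summable_geometric)
  also have "(\<Sum>k. c * r ^ k) = c / (1 - r)"
    using assms by (subst suminf_mult) (auto simp: suminf_geometric intro!: summable_geometric)
  finally show ?thesis by (simp add: ennreal_suminf_multc)
qed

text \<open>The cells have side \<open>2\<^sup>-\<^sup>k\<close>; the mass bound is the Morrey-type condition satisfied by \<open>L\<^sup>N\<^sup>/\<^sup>s\<close> densities.\<close>

locale cell_weight =
  fixes s P M :: real and w :: "real^'n \<Rightarrow> ennreal"
  assumes s: "0 < s" and P: "1 < P" and M: "0 < M"
    and w_meas [measurable]: "w \<in> borel_measurable borel"
    and w_cell: "\<And>k x. (\<integral>\<^sup>+ y. indicator (cell k x) y * w y \<partial>lborel)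
      \<le> ennreal (M * 2 powr (- (real k * (real CARD('n) - s))))"
begin

text \<open>The weighted mean oscillation at level k is of order 2^(kN) 2^(-k(N-s)) 2^(-ksP) =
  2^(-ks(P-1)), which is \<open>rate\<close> to the power 2k. Halving the exponent leaves one factor
  \<open>rate ^ k\<close> after the level-k term has been multiplied by
  \<open>(1 / rate) ^ k\<close>.\<close>

definition rate :: real where "rate = 2 powr (- (s * (P - 1) / 2))"

lemma rate: "0 < rate" "rate < 1"
  using s P powr_less_mono[of "- (s * (P - 1) / 2)" 0 2] by (auto simp: rate_def)

definition osc_const :: real where
  "osc_const = real CARD('n) powr (real CARD('n) + s * P)"

lemma osc_const: "0 < osc_const"
  by (simp add: osc_const_def)

lemma nn_integral_w_cell_mean_osc:
  fixes u :: "real^'n \<Rightarrow> real"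
  assumes [measurable]: "u \<in> borel_measurable borel"
  shows "(\<integral>\<^sup>+ x. w x * cell_mean_osc P k u x \<partial>lborel)
    \<le> ennreal (M * osc_const * (rate ^ k * rate ^ k)) * gagliardo s P u"
proof -
  let ?N = "real CARD('n)"
  have "(\<integral>\<^sup>+ x. w x * cell_mean_osc P k u x \<partial>lborel) \<le> ennreal (2 ^ (k * CARD('n))) *
      ennreal (M * 2 powr (- (real k * (?N - s)))) * (\<integral>\<^sup>+ x. cell_osc P k u x \<partial>lborel)"
    by (intro nn_integral_weight_cell_mean_osc_le w_cell) measurable
  also have "\<dots> \<le> ennreal (2 ^ (k * CARD('n))) * ennreal (M * 2 powr (- (real k * (?N - s)))) *
      (ennreal (osc_const * 2 powr (- (real k * s * P))) * gagliardo s P u)"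
    unfolding osc_const_def using s P by (intro mult_left_mono nn_integral_cell_osc_le) auto
  also have "\<dots> = ennreal (2 ^ (k * CARD('n)) * (M * 2 powr (- (real k * (?N - s)))) *
      (osc_const * 2 powr (- (real k * s * P)))) * gagliardo s P u"
    using M osc_const by (simp add: ennreal_mult mult_ac)
  also have "2 ^ (k * CARD('n)) * (M * 2 powr (- (real k * (?N - s)))) *
      (osc_const * 2 powr (- (real k * s * P))) = M * osc_const * (rate ^ k * rate ^ k)"
  proof -
    have "(2::real) ^ (k * CARD('n)) = 2 powr (real k * ?N)"
      by (subst powr_realpow[symmetric]) auto
    moreover have "rate ^ k = 2 powr (- (s * (P - 1) / 2) * real k)"
      by (simp only: rate_def powr_realpow[symmetric] powr_powr powr_gt_zero)
    moreover have "2 powr (real k * ?N) * 2 powr (- (real k * (?N - s))) * 2 powr (- (real k * s * P)) =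
        (2::real) powr (- (s * (P - 1) / 2) * real k) * 2 powr (- (s * (P - 1) / 2) * real k)"
      unfolding powr_add[symmetric] by (rule arg_cong[where f = "\<lambda>t. 2 powr t"]) (simp add: field_simps)
    ultimately show ?thesis by (simp add: mult_ac)
  qed
  finally show ?thesis .
qed

text \<open>Finite energy replaces the Lebesgue differentiation theorem: the integrals of the
  oscillations over all levels form a convergent geometric series, so at almost every point the
  oscillations are summable and hence tend to 0.\<close>

lemma AE_cell_avg_LIMSEQ:
  fixes u :: "real^'n \<Rightarrow> real"
  assumes [measurable]: "u \<in> borel_measurable borel"
    and int: "\<And>k x. integrable lborel (\<lambda>y. indicator (cell k x) y * u y)"
    and fin: "gagliardo s P u < \<infinity>"
  shows "AE x in lborel. (\<lambda>k. cell_avg k u x) \<longlonglongrightarrow> u x"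
proof -
  define q where "q = 2 powr (- (s * P))"
  have q: "0 < q" "q < 1" using s P powr_less_mono[of "- (s * P)" 0 2] by (auto simp: q_def)
  have qk: "2 powr (- (real k * s * P)) = q ^ k" for k
    by (simp add: q_def powr_realpow[symmetric] powr_powr mult_ac)
  have "(\<integral>\<^sup>+ x. (\<Sum>k. cell_osc P k u x) \<partial>lborel) = (\<Sum>k. \<integral>\<^sup>+ x. cell_osc P k u x \<partial>lborel)"
    by (intro nn_integral_suminf) measurable
  also have "\<dots> \<le> (\<Sum>k. ennreal (osc_const * q ^ k) * gagliardo s P u)"
    unfolding osc_const_def qk[symmetric] using s P
    by (intro suminf_le nn_integral_cell_osc_le) auto
  also have "\<dots> < \<infinity>"
    using q osc_const fin by (subst suminf_cmult_geometric_ennreal) (auto simp: ennreal_mult_less_top)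
  finally have "AE x in lborel. (\<Sum>k. cell_osc P k u x) \<noteq> \<infinity>"
    by (intro nn_integral_PInf_AE) auto
  then show ?thesis
  proof eventually_elim
    case (elim x)
    have "(\<lambda>k. ennreal (2 powr P) * cell_osc P k u x) \<longlonglongrightarrow> ennreal (2 powr P) * 0"
      by (intro ennreal_tendsto_cmult ennreal_suminf_finite_LIMSEQ_zero elim) auto
    then have lim: "(\<lambda>k. ennreal (2 powr P) * cell_osc P k u x) \<longlonglongrightarrow> ennreal 0"
      by simp
    have "(\<lambda>k. ennreal (\<bar>u x - cell_avg k u x\<bar> powr P)) \<longlonglongrightarrow> ennreal 0"
    proof (rule tendsto_sandwich[OF _ _ tendsto_const lim])
      show "\<forall>\<^sub>F k in sequentially. ennreal 0 \<le> ennreal (\<bar>u x - cell_avg k u x\<bar> powr P)"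
        by simp
      show "\<forall>\<^sub>F k in sequentially. ennreal (\<bar>u x - cell_avg k u x\<bar> powr P) \<le> ennreal (2 powr P) * cell_osc P k u x"
        using P int by (intro always_eventually allI powr_diff_cell_avg_le) auto
    qed
    then have "(\<lambda>k. \<bar>u x - cell_avg k u x\<bar> powr P) \<longlonglongrightarrow> 0"
      by (subst (asm) tendsto_ennreal_iff) auto
    then have "(\<lambda>k. (\<bar>u x - cell_avg k u x\<bar> powr P) powr (1 / P)) \<longlonglongrightarrow> 0"
      using P by (intro tendsto_zero_powrI[where f = "\<lambda>k. \<bar>u x - cell_avg k u x\<bar> powr P" and b = "1 / P"] tendsto_const) auto
    moreover have "(\<bar>t\<bar> powr P) powr (1 / P) = \<bar>t\<bar>" for t
      using P by (simp add: powr_powr)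
    ultimately have "(\<lambda>k. \<bar>u x - cell_avg k u x\<bar>) \<longlonglongrightarrow> 0"
      by (simp only:)
    then have "(\<lambda>k. u x - (u x - cell_avg k u x)) \<longlonglongrightarrow> u x - 0"
      by (intro tendsto_intros) (rule tendsto_rabs_zero_cancel)
    then show ?case by simp
  qed
qed

text \<open>The factor 4^P 2^N comes from one increment between consecutive levels, the power of 1 -
  rate^(1/P) from summing increments after taking P-th roots, and the last factor from integrating
  the series S of mean oscillations against the weight.\<close>

definition approx_const :: real where
  "approx_const = 4 powr P * 2 ^ CARD('n) / (1 - rate powr (1 / P)) powr P * (M * osc_const / (1 - rate))"

lemma rate_powr: "0 < rate powr (1 / P)" "rate powr (1 / P) < 1"
  using rate P powr_less_mono2[of "1 / P" rate 1] by auto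

lemma approx_const: "0 < approx_const"
  unfolding approx_const_def using rate rate_powr M osc_const by (intro mult_pos_pos divide_pos_pos) auto

text \<open>A single function S controls all increments at once: pointwise, the j-th increment to
  the power P is at most a constant times rate^j S. Taking roots, summing the geometric tail from
  level k on and raising to the power P again gives rate^k S, and S has finite integral against
  w.\<close>

lemma nn_integral_weight_cell_avg:
  fixes u :: "real^'n \<Rightarrow> real"
  assumes [measurable]: "u \<in> borel_measurable borel"
    and int: "\<And>k x. integrable lborel (\<lambda>y. indicator (cell k x) y * u y)"
  shows "(\<integral>\<^sup>+ x. w x * ennreal (\<bar>u x - cell_avg k u x\<bar> powr P) \<partial>lborel)
    \<le> ennreal (approx_const * rate ^ k) * gagliardo s P u"
proof (cases "gagliardo s P u = \<infinity>")
  case True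
  then show ?thesis using approx_const rate by (simp add: ennreal_mult_top)
next
  case False
  define c where "c = 4 powr P * 2 ^ CARD('n)"
  define q where "q = rate powr (1 / P)"
  have q: "0 < q" "q < 1" using rate_powr by (auto simp: q_def)
  have c: "0 < c" by (simp add: c_def)
  \<comment> \<open>The weights rate^(-j) can be afforded because the integrals of the mean
    oscillations decay like rate^(2j). They are what makes each individual term decay like rate^j
    times S.\<close>
  define S where "S x = (\<Sum>j. ennreal ((1 / rate) ^ j) * cell_mean_osc P j u x)" for x
  have [measurable]: "S \<in> borel_measurable borel" unfolding S_def[abs_def] by measurable
  have "(\<integral>\<^sup>+ x. w x * S x \<partial>lborel) = (\<integral>\<^sup>+ x. (\<Sum>j. w x * (ennreal ((1 / rate) ^ j) * cell_mean_osc P j u x)) \<partial>lborel)"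
    by (simp add: S_def)
  also have "\<dots> = (\<Sum>j. \<integral>\<^sup>+ x. w x * (ennreal ((1 / rate) ^ j) * cell_mean_osc P j u x) \<partial>lborel)"
    by (intro nn_integral_suminf) measurable
  also have "\<dots> = (\<Sum>j. ennreal ((1 / rate) ^ j) * (\<integral>\<^sup>+ x. w x * cell_mean_osc P j u x \<partial>lborel))"
    by (subst nn_integral_cmult[symmetric]) (auto simp: mult_ac)
  also have "\<dots> \<le> (\<Sum>j. ennreal (M * osc_const * rate ^ j) * gagliardo s P u)"
  proof (intro suminf_le)
    fix j
    have "ennreal ((1 / rate) ^ j) * (\<integral>\<^sup>+ x. w x * cell_mean_osc P j u x \<partial>lborel) \<le>
      ennreal ((1 / rate) ^ j) * (ennreal (M * osc_const * (rate ^ j * rate ^ j)) * gagliardo s P u)"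
      by (intro mult_left_mono nn_integral_w_cell_mean_osc) auto
    also have "\<dots> = ennreal ((1 / rate) ^ j * (M * osc_const * (rate ^ j * rate ^ j))) * gagliardo s P u"
      using rate M osc_const by (simp add: ennreal_mult mult.assoc)
    also have "(1 / rate) ^ j * (M * osc_const * (rate ^ j * rate ^ j)) = M * osc_const * rate ^ j"
      using rate by (simp add: power_divide)
    finally show "ennreal ((1 / rate) ^ j) * (\<integral>\<^sup>+ x. w x * cell_mean_osc P j u x \<partial>lborel)
      \<le> ennreal (M * osc_const * rate ^ j) * gagliardo s P u" .
  qed auto
  also have "\<dots> = ennreal (M * osc_const / (1 - rate)) * gagliardo s P u"
    using rate M osc_const by (intro suminf_cmult_geometric_ennreal) auto
  finally have S: "(\<integral>\<^sup>+ x. w x * S x \<partial>lborel) \<le> ennreal (M * osc_const / (1 - rate)) * gagliardo s P u" .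
  have "AE x in lborel. (\<lambda>k. cell_avg k u x) \<longlonglongrightarrow> u x"
    using False int by (intro AE_cell_avg_LIMSEQ) (auto simp: less_top)
  then have "AE x in lborel. ennreal (\<bar>u x - cell_avg k u x\<bar> powr P) \<le> ennreal (c / (1 - q) powr P * rate ^ k) * S x"
  proof eventually_elim
    case (elim x)
    show ?case
    proof (cases "S x = \<infinity>")
      case True
      then show ?thesis using c q rate by (simp add: ennreal_mult_top)
    next
      case False
      define \<sigma> where "\<sigma> = enn2real (S x)"
      have \<sigma>: "S x = ennreal \<sigma>" "0 \<le> \<sigma>" using False by (auto simp: \<sigma>_def less_top)
      have step: "\<bar>cell_avg (Suc j) u x - cell_avg j u x\<bar> \<le> (c * \<sigma>) powr (1 / P) * q ^ j" for j
      proof -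
        have "ennreal ((1 / rate) ^ j) * cell_mean_osc P j u x \<le> S x"
          unfolding S_def using sum_le_suminf[OF summableI, of "{j}" "\<lambda>j. ennreal ((1 / rate) ^ j) * cell_mean_osc P j u x"] by simp
        then have "ennreal (rate ^ j) * (ennreal ((1 / rate) ^ j) * cell_mean_osc P j u x) \<le> ennreal (rate ^ j) * S x"
          by (rule mult_left_mono) simp
        moreover have "ennreal (rate ^ j) * ennreal ((1 / rate) ^ j) = 1"
          using rate by (simp add: ennreal_mult[symmetric] power_divide)
        ultimately have D: "cell_mean_osc P j u x \<le> ennreal (rate ^ j) * S x"
          by (simp add: mult.assoc[symmetric])
        have "ennreal (\<bar>cell_avg (Suc j) u x - cell_avg j u x\<bar> powr P) \<le> ennreal c * cell_mean_osc P j u x"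
          unfolding c_def using P int by (intro powr_cell_avg_Suc_diff_le) auto
        also have "\<dots> \<le> ennreal c * (ennreal (rate ^ j) * S x)"
          by (intro mult_left_mono D) auto
        also have "\<dots> = ennreal (c * \<sigma> * rate ^ j)"
          using c rate \<sigma> by (simp add: ennreal_mult[symmetric] mult_ac)
        finally have "\<bar>cell_avg (Suc j) u x - cell_avg j u x\<bar> powr P \<le> c * \<sigma> * rate ^ j"
          using c rate \<sigma> by (simp add: ennreal_le_iff)
        then have "(\<bar>cell_avg (Suc j) u x - cell_avg j u x\<bar> powr P) powr (1 / P) \<le> (c * \<sigma> * rate ^ j) powr (1 / P)"
          using P by (intro powr_mono2) auto
        moreover have "(rate ^ j) powr (1 / P) = q ^ j"
          using rate by (simp add: q_def powr_realpow[symmetric] powr_powr mult_ac)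
        ultimately show ?thesis using P c rate \<sigma> by (simp add: powr_powr powr_mult)
      qed
      have "\<bar>u x - cell_avg k u x\<bar> \<le> (c * \<sigma>) powr (1 / P) * q ^ k / (1 - q)"
        using elim step q by (rule LIMSEQ_geometric_bound)
      then have "\<bar>u x - cell_avg k u x\<bar> powr P \<le> ((c * \<sigma>) powr (1 / P) * q ^ k / (1 - q)) powr P"
        using P by (intro powr_mono2) auto
      also have "\<dots> = (c * \<sigma>) * (q ^ k) powr P / (1 - q) powr P"
        using P c q \<sigma> by (simp add: powr_divide powr_mult powr_powr)
      also have "(q ^ k) powr P = rate ^ k"
        using rate P q by (simp add: q_def powr_realpow[symmetric] powr_powr)
      finally have "\<bar>u x - cell_avg k u x\<bar> powr P \<le> c / (1 - q) powr P * rate ^ k * \<sigma>"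
        by (simp add: mult_ac)
      then show ?thesis
        unfolding \<sigma>(1) using c q rate \<sigma> by (simp add: ennreal_mult[symmetric] ennreal_leI)
    qed
  qed
  then have "(\<integral>\<^sup>+ x. w x * ennreal (\<bar>u x - cell_avg k u x\<bar> powr P) \<partial>lborel) \<le>
      (\<integral>\<^sup>+ x. ennreal (c / (1 - q) powr P * rate ^ k) * (w x * S x) \<partial>lborel)"
    by (intro nn_integral_mono_AE, eventually_elim)
       (metis (no_types, lifting) mult.left_commute mult_left_mono zero_le)
  also have "\<dots> = ennreal (c / (1 - q) powr P * rate ^ k) * (\<integral>\<^sup>+ x. w x * S x \<partial>lborel)"
    by (intro nn_integral_cmult) measurable
  also have "\<dots> \<le> ennreal (c / (1 - q) powr P * rate ^ k) * (ennreal (M * osc_const / (1 - rate)) * gagliardo s P u)"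
    by (intro mult_left_mono S) auto
  also have "\<dots> = ennreal (approx_const * rate ^ k) * gagliardo s P u"
    using c q rate M osc_const
    by (simp add: ennreal_mult[symmetric] mult.assoc[symmetric] approx_const_def c_def q_def)
       (simp add: mult_ac)
  finally show ?thesis .
qed

end

section \<open>Weighted embedding and compactness\<close>

lemma gagliardo_lincomb_le:
  fixes u v :: "real^'n \<Rightarrow> real"
  assumes [measurable]: "u \<in> borel_measurable borel" "v \<in> borel_measurable borel" and P: "0 \<le> P"
  shows "gagliardo s P (\<lambda>x. a * u x + b * v x)
    \<le> ennreal (2 powr P) * (ennreal (\<bar>a\<bar> powr P) * gagliardo s P u + ennreal (\<bar>b\<bar> powr P) * gagliardo s P v)"
proof -
  let ?k = "\<lambda>x y::real^'n. norm (x - y) powr (real CARD('n) + s * P)"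
  have "ennreal (\<bar>(a * u x + b * v x) - (a * u y + b * v y)\<bar> powr P / ?k x y)
      \<le> ennreal (2 powr P) * (ennreal (\<bar>a\<bar> powr P) * ennreal (\<bar>u x - u y\<bar> powr P / ?k x y)
        + ennreal (\<bar>b\<bar> powr P) * ennreal (\<bar>v x - v y\<bar> powr P / ?k x y))" for x y
  proof -
    have "\<bar>(a * u x + b * v x) - (a * u y + b * v y)\<bar> \<le> \<bar>a * (u x - u y)\<bar> + \<bar>b * (v x - v y)\<bar>"
      using abs_triangle_ineq[of "a * (u x - u y)" "b * (v x - v y)"] by (simp add: algebra_simps)
    then have "\<bar>(a * u x + b * v x) - (a * u y + b * v y)\<bar> powr P \<le> (\<bar>a * (u x - u y)\<bar> + \<bar>b * (v x - v y)\<bar>) powr P"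
      using P by (intro powr_mono2) auto
    also have "\<dots> \<le> 2 powr P * (\<bar>a * (u x - u y)\<bar> powr P + \<bar>b * (v x - v y)\<bar> powr P)"
      using P by (intro powr_add_le) auto
    also have "\<dots> = 2 powr P * (\<bar>a\<bar> powr P * \<bar>u x - u y\<bar> powr P + \<bar>b\<bar> powr P * \<bar>v x - v y\<bar> powr P)"
      by (simp add: abs_mult powr_mult)
    finally have "\<bar>(a * u x + b * v x) - (a * u y + b * v y)\<bar> powr P / ?k x y \<le>
       2 powr P * (\<bar>a\<bar> powr P * \<bar>u x - u y\<bar> powr P + \<bar>b\<bar> powr P * \<bar>v x - v y\<bar> powr P) / ?k x y"
      by (intro divide_right_mono) auto
    also have "\<dots> = 2 powr P * (\<bar>a\<bar> powr P * (\<bar>u x - u y\<bar> powr P / ?k x y)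
        + \<bar>b\<bar> powr P * (\<bar>v x - v y\<bar> powr P / ?k x y))"
      by (simp add: add_divide_distrib distrib_left)
    finally show ?thesis
      by (simp add: ennreal_mult[symmetric] ennreal_plus[symmetric] ennreal_leI del: ennreal_plus)
  qed
  then have "gagliardo s P (\<lambda>x. a * u x + b * v x) \<le> (\<integral>\<^sup>+ x. \<integral>\<^sup>+ y.
      ennreal (2 powr P) * (ennreal (\<bar>a\<bar> powr P) * ennreal (\<bar>u x - u y\<bar> powr P / ?k x y)
        + ennreal (\<bar>b\<bar> powr P) * ennreal (\<bar>v x - v y\<bar> powr P / ?k x y)) \<partial>lborel \<partial>lborel)"
    unfolding gagliardo_def by (intro nn_integral_mono) auto
  also have "\<dots> = ennreal (2 powr P) * (ennreal (\<bar>a\<bar> powr P) * gagliardo s P u + ennreal (\<bar>b\<bar> powr P) * gagliardo s P v)"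
    unfolding gagliardo_def by (simp add: nn_integral_cmult nn_integral_add)
  finally show ?thesis .
qed

text \<open>On a finite measure space the Young inequality with a free parameter d turns an L^P
  Cauchy condition into an L^1 one: the constant term costs d times the total mass, and the rest is
  the L^P distance times d^(1-P).\<close>

lemma Lp_Cauchy_AE_subseq:
  fixes v :: "nat \<Rightarrow> 'a \<Rightarrow> real"
  assumes fin: "emeasure M (space M) < \<infinity>" and P: "1 \<le> P"
    and [measurable]: "\<And>n. v n \<in> borel_measurable M"
    and Lp: "\<And>n. (\<integral>\<^sup>+ x. ennreal (\<bar>v n x\<bar> powr P) \<partial>M) < \<infinity>"
    and Cauchy: "\<And>e. 0 < e \<Longrightarrow> \<exists>N. \<forall>i\<ge>N. \<forall>j\<ge>N. (\<integral>\<^sup>+ x. ennreal (\<bar>v i x - v j x\<bar> powr P) \<partial>M) \<le> ennreal e"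
  obtains r where "strict_mono r" "AE x in M. Cauchy (\<lambda>i. v (r i) x)"
proof (rule cauchy_L1_AE_cauchy_subseq)
  define m where "m = measure M (space M)"
  have m: "emeasure M (space M) = ennreal m" "0 \<le> m"
    using fin by (auto simp: m_def emeasure_eq_ennreal_measure)
  have bound: "(\<integral>\<^sup>+ x. ennreal \<bar>g x\<bar> \<partial>M) \<le>
      ennreal (d * m) + ennreal (d powr (1 - P)) * (\<integral>\<^sup>+ x. ennreal (\<bar>g x\<bar> powr P) \<partial>M)"
    if [measurable]: "g \<in> borel_measurable M" and d: "0 < d" for g :: "'a \<Rightarrow> real" and d
  proof -
    have "(\<integral>\<^sup>+ x. ennreal \<bar>g x\<bar> \<partial>M) \<le> (\<integral>\<^sup>+ x. ennreal d + ennreal (d powr (1 - P)) * ennreal (\<bar>g x\<bar> powr P) \<partial>M)"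
    proof (rule nn_integral_mono)
      fix x show "ennreal \<bar>g x\<bar> \<le> ennreal d + ennreal (d powr (1 - P)) * ennreal (\<bar>g x\<bar> powr P)"
        using le_Young[of "\<bar>g x\<bar>" P d] P d
        by (simp add: ennreal_mult[symmetric] ennreal_plus[symmetric] ennreal_leI del: ennreal_plus)
    qed
    also have "\<dots> = ennreal (d * m) + ennreal (d powr (1 - P)) * (\<integral>\<^sup>+ x. ennreal (\<bar>g x\<bar> powr P) \<partial>M)"
      using d m by (simp add: nn_integral_add nn_integral_cmult ennreal_mult)
    finally show ?thesis .
  qed
  show int: "integrable M (v n)" for n
  proof (rule integrableI_bounded)
    show "(\<integral>\<^sup>+ x. ennreal (norm (v n x)) \<partial>M) < \<infinity>"
      using bound[of "v n" 1] Lp[of n] by (auto simp: less_top[symmetric] top_unique)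
  qed measurable
  fix e :: real assume e: "0 < e"
  \<comment> \<open>d makes the mass term at most e / 4, with m + 1 covering m = 0; e' makes the
    other term equal to e / 4. The sum e / 2 leaves room for the strict inequality.\<close>
  define d where "d = e / (4 * (m + 1))"
  have d: "0 < d" "d * m \<le> e / 4" using e m by (auto simp: d_def field_simps)
  define e' where "e' = e / (4 * d powr (1 - P))"
  have e': "0 < e'" "d powr (1 - P) * e' = e / 4" using d e by (auto simp: e'_def)
  obtain N where N: "\<And>i j. i \<ge> N \<Longrightarrow> j \<ge> N \<Longrightarrow> (\<integral>\<^sup>+ x. ennreal (\<bar>v i x - v j x\<bar> powr P) \<partial>M) \<le> ennreal e'"
    using Cauchy[OF e'(1)] by auto
  show "\<exists>N. \<forall>i\<ge>N. \<forall>j\<ge>N. (LINT x|M. norm (v i x - v j x)) < e"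
  proof (intro exI[of _ N] allI impI)
    fix i j assume ij: "N \<le> i" "N \<le> j"
    have "ennreal (LINT x|M. norm (v i x - v j x)) = (\<integral>\<^sup>+ x. ennreal \<bar>v i x - v j x\<bar> \<partial>M)"
      using int by (subst nn_integral_eq_integral) auto
    also have "\<dots> \<le> ennreal (d * m) + ennreal (d powr (1 - P)) * (\<integral>\<^sup>+ x. ennreal (\<bar>v i x - v j x\<bar> powr P) \<partial>M)"
      using d by (intro bound) auto
    also have "\<dots> \<le> ennreal (e / 4) + ennreal (d powr (1 - P)) * ennreal e'"
      using d N[OF ij] by (intro add_mono mult_left_mono ennreal_leI) auto
    also have "\<dots> = ennreal (e / 2)"
      using e e' d by (simp add: ennreal_mult[symmetric] ennreal_plus[symmetric] del: ennreal_plus)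
    finally show "(LINT x|M. norm (v i x - v j x)) < e"
      using e by (simp add: ennreal_le_iff)
  qed
qed (rule that)

text \<open>Fatou's lemma in the second index: the Cauchy bound for v n - v (r i) survives i to
  infinity. It then holds for every large n, so the whole sequence converges although the pointwise
  limit is known only along r.\<close>

lemma Lp_Cauchy_limit:
  fixes v :: "nat \<Rightarrow> 'a \<Rightarrow> real"
  assumes P: "0 < P" and [measurable]: "\<And>n. v n \<in> borel_measurable M" "l \<in> borel_measurable M"
    and Cauchy: "\<And>e. 0 < e \<Longrightarrow> \<exists>N. \<forall>i\<ge>N. \<forall>j\<ge>N. (\<integral>\<^sup>+ x. ennreal (\<bar>v i x - v j x\<bar> powr P) \<partial>M) \<le> ennreal e"
    and r: "strict_mono r" and lim: "AE x in M. (\<lambda>i. v (r i) x) \<longlonglongrightarrow> l x"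
  shows "(\<lambda>n. \<integral>\<^sup>+ x. ennreal (\<bar>v n x - l x\<bar> powr P) \<partial>M) \<longlonglongrightarrow> 0"
proof (rule tendsto_zero_ennreal)
  fix e :: real assume e: "0 < e"
  obtain N where N: "\<And>i j. i \<ge> N \<Longrightarrow> j \<ge> N \<Longrightarrow> (\<integral>\<^sup>+ x. ennreal (\<bar>v i x - v j x\<bar> powr P) \<partial>M) \<le> ennreal (e / 2)"
    using Cauchy[of "e / 2"] e by auto
  have "(\<integral>\<^sup>+ x. ennreal (\<bar>v n x - l x\<bar> powr P) \<partial>M) < ennreal e" if n: "N \<le> n" for n
  proof -
    have "(\<integral>\<^sup>+ x. ennreal (\<bar>v n x - l x\<bar> powr P) \<partial>M) \<le>
        (\<integral>\<^sup>+ x. liminf (\<lambda>i. ennreal (\<bar>v n x - v (r i) x\<bar> powr P)) \<partial>M)"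
    proof (rule nn_integral_mono_AE)
      show "AE x in M. ennreal (\<bar>v n x - l x\<bar> powr P) \<le> liminf (\<lambda>i. ennreal (\<bar>v n x - v (r i) x\<bar> powr P))"
        using lim
      proof eventually_elim
        case (elim x)
        have "(\<lambda>i. ennreal (\<bar>v n x - v (r i) x\<bar> powr P)) \<longlonglongrightarrow> ennreal (\<bar>v n x - l x\<bar> powr P)"
          using P by (intro tendsto_ennrealI tendsto_powr' tendsto_intros elim) auto
        from lim_imp_Liminf[OF sequentially_bot this] show ?case by (rule eq_refl[OF sym])
      qed
    qed
    also have "\<dots> \<le> liminf (\<lambda>i. \<integral>\<^sup>+ x. ennreal (\<bar>v n x - v (r i) x\<bar> powr P) \<partial>M)"
      by (intro nn_integral_liminf) measurable
    also have "\<dots> \<le> liminf (\<lambda>i. ennreal (e / 2))"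
    proof (rule Liminf_mono)
      show "\<forall>\<^sub>F i in sequentially. (\<integral>\<^sup>+ x. ennreal (\<bar>v n x - v (r i) x\<bar> powr P) \<partial>M) \<le> ennreal (e / 2)"
        using eventually_ge_at_top[of N]
      proof eventually_elim
        case (elim i)
        then show ?case using N[OF n] seq_suble[OF r, of i] by auto
      qed
    qed
    also have "\<dots> = ennreal (e / 2)" by (simp add: Liminf_const)
    finally show ?thesis using e by (simp add: le_less_trans ennreal_lessI)
  qed
  then show "\<forall>\<^sub>F n in sequentially. (\<integral>\<^sup>+ x. ennreal (\<bar>v n x - l x\<bar> powr P) \<partial>M) < ennreal e"
    by (auto simp: eventually_sequentially)
qed

text \<open>The lower bound 1 on \<Omega> turns a.e. statements for the measure w dx into Lebesgue
  a.e. statements inside \<Omega>. The finite total mass makes constants integrable for that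
  measure.\<close>

locale weighted_domain = cell_weight s P M w for s P M :: real and w :: "real^'n \<Rightarrow> ennreal" +
  fixes \<Omega> :: "(real^'n) set"
  assumes \<Omega>_sets [measurable]: "\<Omega> \<in> sets borel" and \<Omega>_bounded: "bounded \<Omega>"
    and w_ge: "\<And>x. x \<in> \<Omega> \<Longrightarrow> 1 \<le> w x"
    and w_finite: "(\<integral>\<^sup>+ x. w x \<partial>lborel) < \<infinity>"
begin

text \<open>Concrete Borel functions stand for the classes of the fractional space. Membership in
  L^P is not demanded, since it follows from the Poincare inequality.\<close>

definition adm :: "(real^'n \<Rightarrow> real) \<Rightarrow> bool" where
  "adm u \<longleftrightarrow> u \<in> borel_measurable borel \<and> (\<forall>x. x \<notin> \<Omega> \<longrightarrow> u x = 0) \<and> gagliardo s P u < \<infinity>"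

abbreviation \<mu> :: "(real^'n) measure" where "\<mu> \<equiv> density lborel w"

lemma emeasure_\<mu>: "emeasure \<mu> (space \<mu>) < \<infinity>"
  using w_finite by (simp add: emeasure_density)

lemma adm_lincomb:
  assumes "adm u" "adm v"
  shows "adm (\<lambda>x. a * u x + b * v x)"
proof -
  have [measurable]: "u \<in> borel_measurable borel" "v \<in> borel_measurable borel"
    using assms by (auto simp: adm_def)
  have "gagliardo s P (\<lambda>x. a * u x + b * v x)
    \<le> ennreal (2 powr P) * (ennreal (\<bar>a\<bar> powr P) * gagliardo s P u + ennreal (\<bar>b\<bar> powr P) * gagliardo s P v)"
    using P by (intro gagliardo_lincomb_le) auto
  also have "\<dots> < \<infinity>"
    using assms by (auto simp: adm_def ennreal_mult_less_top)
  finally show ?thesis using assms by (auto simp: adm_def)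
qed

text \<open>A unit ball is placed outside \<Omega>, where u vanishes, at bounded distance. For x in
  \<Omega> the part of the energy integral with y in this ball is already at least a constant
  multiple of |u x|^P.\<close>

lemma poincare:
  obtains C where "0 < C" "\<And>u. u \<in> borel_measurable borel \<Longrightarrow> (\<And>x. x \<notin> \<Omega> \<Longrightarrow> u x = 0) \<Longrightarrow>
    (\<integral>\<^sup>+ x. ennreal (\<bar>u x\<bar> powr P) \<partial>lborel) \<le> ennreal C * gagliardo s P u"
proof -
  obtain R where R: "0 < R" "\<And>x. x \<in> \<Omega> \<Longrightarrow> norm x \<le> R"
    using \<Omega>_bounded bounded_pos by blast
  obtain e :: "real^'n" where e: "e \<in> Basis" using nonempty_Basis by blast
  \<comment> \<open>With |z| = R + 2 the unit ball around z has norms between R + 1 and R + 3. It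
    therefore misses \<Omega>, and its distance from points of \<Omega> never exceeds 2 R +
    3.\<close>
  define z where "z = (R + 2) *\<^sub>R e"
  have z: "norm z = R + 2" using R e by (simp add: z_def)
  define b where "b = real CARD('n) + s * P"
  have b: "0 < b" using s P by (simp add: b_def add_pos_pos)
  define m where "m = measure lborel (ball z 1)"
  have m: "0 < m" "emeasure lborel (ball z 1) = ennreal m"
    unfolding m_def using content_ball_pos[of 1 z] emeasure_lborel_ball_finite[of z 1]
    by (simp, intro emeasure_eq_ennreal_measure) auto
  define D where "D = (2 * R + 3) powr b"
  have D: "0 < D" using R by (simp add: D_def)
  show thesis
  proof (rule that[of "D / m"])
    show "0 < D / m" using D m by simp
    fix u :: "real^'n \<Rightarrow> real"
    assume [measurable]: "u \<in> borel_measurable borel" and u0: "\<And>x. x \<notin> \<Omega> \<Longrightarrow> u x = 0"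
    have pt: "ennreal (m / D) * ennreal (\<bar>u x\<bar> powr P) \<le>
        (\<integral>\<^sup>+ y. ennreal (\<bar>u x - u y\<bar> powr P / norm (x - y) powr b) \<partial>lborel)" for x
    proof (cases "x \<in> \<Omega>")
      case True
      have "ennreal (m / D) * ennreal (\<bar>u x\<bar> powr P) = (\<integral>\<^sup>+ y. ennreal (\<bar>u x\<bar> powr P / D) * indicator (ball z 1) y \<partial>lborel)"
        using m D by (subst nn_integral_cmult_indicator) (auto simp: ennreal_mult[symmetric] mult_ac)
      also have "\<dots> \<le> (\<integral>\<^sup>+ y. ennreal (\<bar>u x - u y\<bar> powr P / norm (x - y) powr b) \<partial>lborel)"
      proof (rule nn_integral_mono)
        fix y
        show "ennreal (\<bar>u x\<bar> powr P / D) * indicator (ball z 1) y \<le> ennreal (\<bar>u x - u y\<bar> powr P / norm (x - y) powr b)"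
        proof (cases "y \<in> ball z 1")
          case y: True
          have "norm (z - y) < 1" using y by (simp add: dist_norm)
          then have ny: "R + 1 < norm y" "norm y \<le> R + 3"
            using z norm_triangle_ineq2[of z y] norm_triangle_ineq2[of y z] by (auto simp: norm_minus_commute)
          then have "y \<notin> \<Omega>" using R by force
          then have "u y = 0" by (rule u0)
          have "0 < norm (x - y)" "norm (x - y) \<le> 2 * R + 3"
            using ny R(2)[OF True] norm_triangle_ineq4[of x y] by auto
          then have "norm (x - y) powr b \<le> D" "0 < norm (x - y) powr b"
            unfolding D_def using b by (auto intro!: powr_mono2)
          then have "\<bar>u x\<bar> powr P / D \<le> \<bar>u x - u y\<bar> powr P / norm (x - y) powr b"
            unfolding \<open>u y = 0\<close> using D by (simp add: frac_le)
          then show ?thesis using y by (simp add: ennreal_leI)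
        qed simp
      qed
      finally show ?thesis .
    qed (use P u0 in auto)
    have "ennreal (m / D) * (\<integral>\<^sup>+ x. ennreal (\<bar>u x\<bar> powr P) \<partial>lborel) =
        (\<integral>\<^sup>+ x. ennreal (m / D) * ennreal (\<bar>u x\<bar> powr P) \<partial>lborel)"
      by (intro nn_integral_cmult[symmetric]) measurable
    also have "\<dots> \<le> gagliardo s P u"
      unfolding gagliardo_def b_def[symmetric] by (intro nn_integral_mono pt)
    finally have "ennreal (D / m) * (ennreal (m / D) * (\<integral>\<^sup>+ x. ennreal (\<bar>u x\<bar> powr P) \<partial>lborel)) \<le>
        ennreal (D / m) * gagliardo s P u"
      by (intro mult_left_mono) auto
    moreover have "ennreal (D / m) * ennreal (m / D) = 1"
      using m D by (simp add: ennreal_mult[symmetric])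
    ultimately show "(\<integral>\<^sup>+ x. ennreal (\<bar>u x\<bar> powr P) \<partial>lborel) \<le> ennreal (D / m) * gagliardo s P u"
      by (simp add: mult.assoc[symmetric])
  qed
qed

text \<open>Fixing one admissible constant lets it enter \<open>embed_const\<close> and through it
  the threshold \<open>lam_star\<close>, both of which must not depend on u.\<close>

definition poincare_const :: real where
  "poincare_const = (SOME C. 0 < C \<and> (\<forall>u. u \<in> borel_measurable borel \<longrightarrow> (\<forall>x. x \<notin> \<Omega> \<longrightarrow> u x = 0) \<longrightarrow>
    (\<integral>\<^sup>+ x. ennreal (\<bar>u x\<bar> powr P) \<partial>lborel) \<le> ennreal C * gagliardo s P u))"

lemma poincare_const: "0 < poincare_const"
  and adm_poincare: "adm u \<Longrightarrow> (\<integral>\<^sup>+ x. ennreal (\<bar>u x\<bar> powr P) \<partial>lborel) \<le> ennreal poincare_const * gagliardo s P u"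
proof -
  have "\<exists>C. 0 < C \<and> (\<forall>u. u \<in> borel_measurable borel \<longrightarrow> (\<forall>x. x \<notin> \<Omega> \<longrightarrow> u x = 0) \<longrightarrow>
    (\<integral>\<^sup>+ x. ennreal (\<bar>u x\<bar> powr P) \<partial>lborel) \<le> ennreal C * gagliardo s P u)"
    by (rule poincare) blast
  then have "0 < poincare_const \<and> (\<forall>u. u \<in> borel_measurable borel \<longrightarrow> (\<forall>x. x \<notin> \<Omega> \<longrightarrow> u x = 0) \<longrightarrow>
    (\<integral>\<^sup>+ x. ennreal (\<bar>u x\<bar> powr P) \<partial>lborel) \<le> ennreal poincare_const * gagliardo s P u)"
    unfolding poincare_const_def by (rule someI_ex)
  then show "0 < poincare_const"
    "adm u \<Longrightarrow> (\<integral>\<^sup>+ x. ennreal (\<bar>u x\<bar> powr P) \<partial>lborel) \<le> ennreal poincare_const * gagliardo s P u"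
    by (auto simp: adm_def)
qed

lemma adm_Lp: "adm u \<Longrightarrow> (\<integral>\<^sup>+ x. ennreal (\<bar>u x\<bar> powr P) \<partial>lborel) < \<infinity>"
  using adm_poincare[of u] by (auto simp: adm_def ennreal_mult_less_top intro: le_less_trans)

lemma adm_cell_integrable:
  assumes "adm u"
  shows "integrable lborel (\<lambda>y. indicator (cell k x) y * u y)"
proof (rule integrableI_bounded)
  have [measurable]: "u \<in> borel_measurable borel" using assms by (auto simp: adm_def)
  show "(\<lambda>y. indicator (cell k x) y * u y) \<in> borel_measurable lborel" by measurable
  have "(\<integral>\<^sup>+ y. ennreal (norm (indicator (cell k x) y * u y)) \<partial>lborel) \<le>
      (\<integral>\<^sup>+ y. indicator (cell k x) y + ennreal (\<bar>u y\<bar> powr P) \<partial>lborel)"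
  proof (rule nn_integral_mono)
    fix y show "ennreal (norm (indicator (cell k x) y * u y)) \<le> indicator (cell k x) y + ennreal (\<bar>u y\<bar> powr P)"
      using le_Young[of "\<bar>u y\<bar>" P 1] P
      by (cases "y \<in> cell k x") (auto simp: ennreal_plus[symmetric] ennreal_1[symmetric] ennreal_leI simp del: ennreal_plus ennreal_1)
  qed
  also have "\<dots> = emeasure lborel (cell k x) + (\<integral>\<^sup>+ y. ennreal (\<bar>u y\<bar> powr P) \<partial>lborel)"
    by (simp add: nn_integral_add)
  also have "\<dots> < \<infinity>"
    using adm_Lp[OF assms] by (simp add: emeasure_cell)
  finally show "(\<integral>\<^sup>+ y. ennreal (norm (indicator (cell k x) y * u y)) \<partial>lborel) < \<infinity>" .
qed

lemma adm_approx:
  assumes "adm u"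
  shows "(\<integral>\<^sup>+ x. ennreal (\<bar>u x - cell_avg k u x\<bar> powr P) \<partial>\<mu>) \<le> ennreal (approx_const * rate ^ k) * gagliardo s P u"
proof -
  have [measurable]: "u \<in> borel_measurable borel" using assms by (auto simp: adm_def)
  show ?thesis
    using nn_integral_weight_cell_avg[of u k] adm_cell_integrable[OF assms] by (simp add: nn_integral_density)
qed

lemma adm_cell_avg_le:
  assumes "adm u"
  shows "ennreal (\<bar>cell_avg k u x\<bar> powr P) \<le> ennreal (2 powr P * 2 ^ (k * CARD('n)) * poincare_const) * gagliardo s P u"
proof -
  have [measurable]: "u \<in> borel_measurable borel" using assms by (auto simp: adm_def)
  have "ennreal (\<bar>cell_avg k u x\<bar> powr P) \<le> ennreal (2 powr P * 2 ^ (k * CARD('n))) *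
      (\<integral>\<^sup>+ y. indicator (cell k x) y * ennreal (\<bar>u y\<bar> powr P) \<partial>lborel)"
    using P by (intro cell_avg_powr_le) auto
  also have "\<dots> \<le> ennreal (2 powr P * 2 ^ (k * CARD('n))) * (\<integral>\<^sup>+ y. ennreal (\<bar>u y\<bar> powr P) \<partial>lborel)"
    by (intro mult_left_mono nn_integral_mono) (auto simp: indicator_def)
  also have "\<dots> \<le> ennreal (2 powr P * 2 ^ (k * CARD('n))) * (ennreal poincare_const * gagliardo s P u)"
    by (intro mult_left_mono adm_poincare assms) auto
  finally show ?thesis using poincare_const by (simp add: ennreal_mult mult.assoc)
qed

lemma powr_diff_le_split:
  "ennreal (\<bar>a\<bar> powr P) \<le> ennreal (2 powr P) * (ennreal (\<bar>a - b\<bar> powr P) + ennreal (\<bar>b\<bar> powr P))"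
proof -
  have "\<bar>a\<bar> powr P \<le> (\<bar>a - b\<bar> + \<bar>b\<bar>) powr P"
    using P by (intro powr_mono2) auto
  also have "\<dots> \<le> 2 powr P * (\<bar>a - b\<bar> powr P + \<bar>b\<bar> powr P)"
    using P by (intro powr_add_le) auto
  finally show ?thesis
    by (simp add: ennreal_mult[symmetric] ennreal_plus[symmetric] ennreal_leI del: ennreal_plus)
qed

definition embed_const :: real where
  "embed_const = 2 powr P * (approx_const + 2 powr P * poincare_const * measure \<mu> (space \<mu>))"

lemma embed_const: "0 < embed_const"
  unfolding embed_const_def using approx_const poincare_const by (intro mult_pos_pos add_pos_nonneg) auto

text \<open>u is compared with its averages over unit cells (level 0). The difference is covered by
  the weighted approximation estimate; the averages are bounded uniformly in x by the Poincare
  inequality and are integrated over the finite measure \<mu>.\<close>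

lemma adm_embed:
  assumes "adm u"
  shows "(\<integral>\<^sup>+ x. ennreal (\<bar>u x\<bar> powr P) \<partial>\<mu>) \<le> ennreal embed_const * gagliardo s P u"
proof -
  have [measurable]: "u \<in> borel_measurable borel" using assms by (auto simp: adm_def)
  let ?c = "ennreal (2 powr P * poincare_const) * gagliardo s P u"
  have "(\<integral>\<^sup>+ x. ennreal (\<bar>u x\<bar> powr P) \<partial>\<mu>) \<le>
      (\<integral>\<^sup>+ x. ennreal (2 powr P) * (ennreal (\<bar>u x - cell_avg 0 u x\<bar> powr P) + ?c) \<partial>\<mu>)"
  proof (rule nn_integral_mono)
    fix x
    have "ennreal (\<bar>u x\<bar> powr P) \<le> ennreal (2 powr P) * (ennreal (\<bar>u x - cell_avg 0 u x\<bar> powr P) + ennreal (\<bar>cell_avg 0 u x\<bar> powr P))"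
      by (rule powr_diff_le_split)
    also have "\<dots> \<le> ennreal (2 powr P) * (ennreal (\<bar>u x - cell_avg 0 u x\<bar> powr P) + ?c)"
      using adm_cell_avg_le[OF assms, of 0 x] by (intro mult_left_mono add_left_mono) auto
    finally show "ennreal (\<bar>u x\<bar> powr P) \<le> ennreal (2 powr P) * (ennreal (\<bar>u x - cell_avg 0 u x\<bar> powr P) + ?c)" .
  qed
  also have "\<dots> = ennreal (2 powr P) * ((\<integral>\<^sup>+ x. ennreal (\<bar>u x - cell_avg 0 u x\<bar> powr P) \<partial>\<mu>) + ?c * emeasure \<mu> (space \<mu>))"
  proof -
    have "(\<lambda>x. ennreal (\<bar>u x - cell_avg 0 u x\<bar> powr P)) \<in> borel_measurable \<mu>" by measurable
    then show ?thesis by (simp only: nn_integral_cmult nn_integral_add nn_integral_const borel_measurable_add borel_measurable_const)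
  qed
  also have "\<dots> \<le> ennreal (2 powr P) * (ennreal approx_const * gagliardo s P u + ?c * emeasure \<mu> (space \<mu>))"
    using adm_approx[OF assms, of 0] by (intro mult_left_mono add_right_mono) auto
  also have "emeasure \<mu> (space \<mu>) = ennreal (measure \<mu> (space \<mu>))"
    using emeasure_\<mu> by (intro emeasure_eq_ennreal_measure) auto
  also have "ennreal (2 powr P) * (ennreal approx_const * gagliardo s P u + ?c * ennreal (measure \<mu> (space \<mu>))) =
    ennreal embed_const * gagliardo s P u"
  proof -
    have "ennreal embed_const = ennreal (2 powr P) * (ennreal approx_const +
        ennreal (2 powr P * poincare_const) * ennreal (measure \<mu> (space \<mu>)))"
      using approx_const poincare_const unfolding embed_const_def
      by (simp add: ennreal_mult[symmetric] ennreal_plus[symmetric] del: ennreal_plus)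
    then show ?thesis by (simp add: distrib_left distrib_right mult_ac)
  qed
  finally show ?thesis .
qed

text \<open>An average of level k takes one value per cell and there are countably many cells over
  all levels. A diagonal extraction over one representative point per cell therefore yields
  convergence at every point and every level.\<close>

lemma cell_avg_subseq:
  fixes u :: "nat \<Rightarrow> real^'n \<Rightarrow> real"
  assumes bound: "\<And>k n x. \<bar>cell_avg k (u n) x\<bar> \<le> b k"
  obtains \<phi> where "strict_mono (\<phi> :: nat \<Rightarrow> nat)" "\<And>k x. convergent (\<lambda>n. cell_avg k (u (\<phi> n)) x)"
proof -
  define pt :: "nat \<Rightarrow> int^'n \<Rightarrow> real^'n" where "pt k z = (SOME x. cell_index k x = z)" for k z
  have b: "0 \<le> b k" for k using bound[of k 0 0] by simp
  \<comment> \<open>The extraction is applied with one common bound, whereas b k depends on the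
    level. Dividing by b k + 1, which is positive, normalises all levels to the bound 1.\<close>
  have 1: "norm (cell_avg (fst q) (u n) (snd q) / (b (fst q) + 1)) \<le> 1" for n and q :: "nat \<times> (real^'n)"
    using bound[of "fst q" n "snd q"] b[of "fst q"] by (simp add: divide_le_eq_1)
  define S where "S = (\<lambda>(k, z). (k, pt k z)) ` UNIV"
  have "countable S" by (simp add: S_def)
  then obtain \<phi> where \<phi>: "strict_mono (\<phi> :: nat \<Rightarrow> nat)"
    "\<And>q. q \<in> S \<Longrightarrow> \<exists>l. (\<lambda>n. cell_avg (fst q) (u (\<phi> n)) (snd q) / (b (fst q) + 1)) \<longlonglongrightarrow> l"
    using function_convergent_subsequence[of S "\<lambda>n q. cell_avg (fst q) (u n) (snd q) / (b (fst q) + 1)" 1] 1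
    by metis
  have "convergent (\<lambda>n. cell_avg k (u (\<phi> n)) x)" for k x
  proof -
    let ?p = "pt k (cell_index k x)"
    have "cell_index k ?p = cell_index k x"
      unfolding pt_def by (rule someI) simp
    then have "?p \<in> cell k x" by (simp add: cell_def)
    then have eq: "cell_avg k (u n) ?p = cell_avg k (u n) x" for n by (rule cell_avg_cong)
    have "(k, ?p) \<in> S" by (force simp: S_def)
    then obtain l where "(\<lambda>n. cell_avg k (u (\<phi> n)) x / (b k + 1)) \<longlonglongrightarrow> l"
      using \<phi>(2)[of "(k, ?p)"] eq by auto
    then have "(\<lambda>n. cell_avg k (u (\<phi> n)) x / (b k + 1) * (b k + 1)) \<longlonglongrightarrow> l * (b k + 1)"
      by (intro tendsto_intros)
    then show ?thesis using b[of k] by (auto simp: convergent_def add_nonneg_eq_0_iff)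
  qed
  then show thesis using \<phi>(1) that by blast
qed

text \<open>At a fixed level the averages converge everywhere and are bounded by a constant, which
  is integrable because \<mu> is finite; dominated convergence applies.\<close>

lemma cell_avg_Cauchy:
  fixes v :: "nat \<Rightarrow> real^'n \<Rightarrow> real"
  assumes [measurable]: "\<And>n. v n \<in> borel_measurable borel"
    and bound: "\<And>n x. \<bar>cell_avg k (v n) x\<bar> \<le> b"
    and conv: "\<And>x. convergent (\<lambda>n. cell_avg k (v n) x)" and e: "0 < e"
  shows "\<exists>N. \<forall>i\<ge>N. \<forall>j\<ge>N. (\<integral>\<^sup>+ x. ennreal (\<bar>cell_avg k (v i) x - cell_avg k (v j) x\<bar> powr P) \<partial>\<mu>) \<le> ennreal e"
proof -
  define l where "l x = lim (\<lambda>n. cell_avg k (v n) x)" for x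
  have l: "(\<lambda>n. cell_avg k (v n) x) \<longlonglongrightarrow> l x" for x
    using conv[of x] by (simp add: l_def convergent_LIMSEQ_iff)
  have [measurable]: "l \<in> borel_measurable borel"
    unfolding l_def[abs_def] by measurable
  have lb: "\<bar>l x\<bar> \<le> b" for x
    using LIMSEQ_le_const2[OF tendsto_rabs[OF l[of x]]] bound by auto
  have "(\<lambda>n. \<integral>\<^sup>+ x. ennreal (\<bar>cell_avg k (v n) x - l x\<bar> powr P) \<partial>\<mu>) \<longlonglongrightarrow> (\<integral>\<^sup>+ x. 0 \<partial>\<mu>)"
  proof (rule nn_integral_dominated_convergence)
    show "AE x in \<mu>. ennreal (\<bar>cell_avg k (v n) x - l x\<bar> powr P) \<le> ennreal ((2 * b) powr P)" for n
    proof (rule AE_I2)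
      fix x
      show "ennreal (\<bar>cell_avg k (v n) x - l x\<bar> powr P) \<le> ennreal ((2 * b) powr P)"
        using bound[of n x] lb[of x] P by (intro ennreal_leI powr_mono2) auto
    qed
    show "AE x in \<mu>. (\<lambda>n. ennreal (\<bar>cell_avg k (v n) x - l x\<bar> powr P)) \<longlonglongrightarrow> 0"
    proof (rule AE_I2)
      fix x
      have "(\<lambda>n. \<bar>cell_avg k (v n) x - l x\<bar>) \<longlonglongrightarrow> 0"
        using LIM_zero[OF l[of x]] by (rule tendsto_rabs_zero)
      then have "(\<lambda>n. \<bar>cell_avg k (v n) x - l x\<bar> powr P) \<longlonglongrightarrow> 0"
        using P by (intro tendsto_zero_powrI[where b = P] tendsto_const) auto
      then show "(\<lambda>n. ennreal (\<bar>cell_avg k (v n) x - l x\<bar> powr P)) \<longlonglongrightarrow> 0"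
        by (subst ennreal_tendsto_0_iff) auto
    qed
    show "(\<integral>\<^sup>+ x. ennreal ((2 * b) powr P) \<partial>\<mu>) < \<infinity>"
      unfolding nn_integral_const using emeasure_\<mu> by (simp only: infinity_ennreal_def ennreal_mult_less_top ennreal_less_top simp_thms)
  qed measurable
  then have lim: "(\<lambda>n. \<integral>\<^sup>+ x. ennreal (\<bar>cell_avg k (v n) x - l x\<bar> powr P) \<partial>\<mu>) \<longlonglongrightarrow> 0"
    by (simp only: nn_integral_const mult_zero_left)
  define d where "d = e / (2 * 2 powr P)"
  have d: "0 < d" "2 powr P * (d + d) = e" using e by (auto simp: d_def)
  obtain N where N: "\<And>n. N \<le> n \<Longrightarrow> (\<integral>\<^sup>+ x. ennreal (\<bar>cell_avg k (v n) x - l x\<bar> powr P) \<partial>\<mu>) < ennreal d"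
    using order_tendstoD(2)[OF lim, of "ennreal d"] d by (auto simp: eventually_sequentially)
  have "(\<integral>\<^sup>+ x. ennreal (\<bar>cell_avg k (v i) x - cell_avg k (v j) x\<bar> powr P) \<partial>\<mu>) \<le> ennreal e"
    if ij: "N \<le> i" "N \<le> j" for i j
  proof -
    have "(\<integral>\<^sup>+ x. ennreal (\<bar>cell_avg k (v i) x - cell_avg k (v j) x\<bar> powr P) \<partial>\<mu>) \<le>
      (\<integral>\<^sup>+ x. ennreal (2 powr P) * (ennreal (\<bar>cell_avg k (v j) x - l x\<bar> powr P) + ennreal (\<bar>cell_avg k (v i) x - l x\<bar> powr P)) \<partial>\<mu>)"
    proof (rule nn_integral_mono)
      fix x
      show "ennreal (\<bar>cell_avg k (v i) x - cell_avg k (v j) x\<bar> powr P) \<le>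
        ennreal (2 powr P) * (ennreal (\<bar>cell_avg k (v j) x - l x\<bar> powr P) + ennreal (\<bar>cell_avg k (v i) x - l x\<bar> powr P))"
        using powr_diff_le_split[of "cell_avg k (v i) x - cell_avg k (v j) x" "cell_avg k (v i) x - l x"]
        by (simp add: abs_minus_commute)
    qed
    also have "\<dots> = ennreal (2 powr P) * ((\<integral>\<^sup>+ x. ennreal (\<bar>cell_avg k (v j) x - l x\<bar> powr P) \<partial>\<mu>) +
        (\<integral>\<^sup>+ x. ennreal (\<bar>cell_avg k (v i) x - l x\<bar> powr P) \<partial>\<mu>))"
      by (subst nn_integral_cmult, measurable, subst nn_integral_add, measurable)
    also have "\<dots> \<le> ennreal (2 powr P) * (ennreal d + ennreal d)"
      using N[OF ij(1)] N[OF ij(2)] by (intro mult_left_mono add_mono less_imp_le) auto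
    also have "\<dots> = ennreal e"
      using d by (simp add: ennreal_mult[symmetric] ennreal_plus[symmetric] del: ennreal_plus)
    finally show ?thesis .
  qed
  then show ?thesis by blast
qed

text \<open>The approximation estimate is applied to differences v i - v j, whose energies are
  uniformly bounded. Hence at a sufficiently fine level it suffices to compare averages. Finite
  energy of the limit is not claimed here; it follows from
  \<open>energy_LIMSEQ_Fatou\<close>.\<close>

lemma adm_compact:
  fixes u :: "nat \<Rightarrow> real^'n \<Rightarrow> real"
  assumes u: "\<And>n. adm (u n)" and G: "\<And>n. gagliardo s P (u n) \<le> ennreal B" and B: "0 \<le> B"
  obtains \<phi> v where "strict_mono (\<phi> :: nat \<Rightarrow> nat)" "v \<in> borel_measurable borel" "\<And>x. x \<notin> \<Omega> \<Longrightarrow> v x = 0"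
    "AE x in lborel. (\<lambda>n. u (\<phi> n) x) \<longlonglongrightarrow> v x"
    "(\<lambda>n. \<integral>\<^sup>+ x. ennreal (\<bar>u (\<phi> n) x - v x\<bar> powr P) \<partial>\<mu>) \<longlonglongrightarrow> 0"
proof -
  have [measurable]: "u n \<in> borel_measurable borel" for n using u by (auto simp: adm_def)
  define b where "b k = (2 powr P * 2 ^ (k * CARD('n)) * poincare_const * B) powr (1 / P)" for k
  have bound: "\<bar>cell_avg k (u n) x\<bar> \<le> b k" for k n x
  proof -
    have "ennreal (\<bar>cell_avg k (u n) x\<bar> powr P) \<le> ennreal (2 powr P * 2 ^ (k * CARD('n)) * poincare_const) * ennreal B"
      by (rule order_trans[OF adm_cell_avg_le[OF u] mult_left_mono[OF G]]) simp
    then have "\<bar>cell_avg k (u n) x\<bar> powr P \<le> 2 powr P * 2 ^ (k * CARD('n)) * poincare_const * B"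
      using B poincare_const by (simp add: ennreal_mult[symmetric])
    then have "(\<bar>cell_avg k (u n) x\<bar> powr P) powr (1 / P) \<le> b k"
      unfolding b_def using P by (intro powr_mono2) auto
    then show ?thesis using P by (simp add: powr_powr)
  qed
  obtain \<phi> where \<phi>: "strict_mono \<phi>" "\<And>k x. convergent (\<lambda>n. cell_avg k (u (\<phi> n)) x)"
    using cell_avg_subseq[of u b] bound by blast
  define v where "v n = u (\<phi> n)" for n
  have v: "adm (v n)" "gagliardo s P (v n) \<le> ennreal B" for n
    by (auto simp: v_def u G)
  have [measurable]: "v n \<in> borel_measurable borel" for n using v by (auto simp: adm_def)
  have diff: "adm (\<lambda>x. v i x - v j x)" "gagliardo s P (\<lambda>x. v i x - v j x) \<le> ennreal (2 powr P * (B + B))" for i j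
  proof -
    show "adm (\<lambda>x. v i x - v j x)"
      using adm_lincomb[OF v(1) v(1), of 1 i "- 1" j] by simp
    have "gagliardo s P (\<lambda>x. v i x - v j x) \<le> ennreal (2 powr P) * (gagliardo s P (v i) + gagliardo s P (v j))"
      using gagliardo_lincomb_le[of "v i" "v j" P s 1 "- 1"] P by simp
    also have "\<dots> \<le> ennreal (2 powr P) * (ennreal B + ennreal B)"
      by (intro mult_left_mono add_mono v) auto
    finally show "gagliardo s P (\<lambda>x. v i x - v j x) \<le> ennreal (2 powr P * (B + B))"
      using B by (simp add: ennreal_mult[symmetric] ennreal_plus[symmetric] del: ennreal_plus)
  qed
  have Cau: "\<exists>N. \<forall>i\<ge>N. \<forall>j\<ge>N. (\<integral>\<^sup>+ x. ennreal (\<bar>v i x - v j x\<bar> powr P) \<partial>\<mu>) \<le> ennreal e" if e: "0 < e" for e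
  proof -
    define d where "d = e / (2 * 2 powr P)"
    have d: "0 < d" "2 powr P * (d + d) = e" using e by (auto simp: d_def)
    have "(\<lambda>k. approx_const * rate ^ k * (2 powr P * (B + B))) \<longlonglongrightarrow> approx_const * 0 * (2 powr P * (B + B))"
      using rate by (intro tendsto_intros LIMSEQ_power_zero) auto
    \<comment> \<open>The level k depends only on the energy bound and on d, and is fixed before the
      indices i and j; the Cauchy property is then needed for the averages of this one
      level.\<close>
    then obtain k where k: "approx_const * rate ^ k * (2 powr P * (B + B)) < d"
      using order_tendstoD(2)[of _ 0 sequentially d] d by (fastforce simp: eventually_sequentially)
    have "\<exists>N. \<forall>i\<ge>N. \<forall>j\<ge>N. (\<integral>\<^sup>+ x. ennreal (\<bar>cell_avg k (v i) x - cell_avg k (v j) x\<bar> powr P) \<partial>\<mu>) \<le> ennreal d"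
    proof (rule cell_avg_Cauchy)
      show "\<bar>cell_avg k (v n) x\<bar> \<le> b k" for n x unfolding v_def by (rule bound)
      show "convergent (\<lambda>n. cell_avg k (v n) x)" for x unfolding v_def by (rule \<phi>(2))
    qed (use d in auto)
    then obtain N where N: "\<And>i j. N \<le> i \<Longrightarrow> N \<le> j \<Longrightarrow>
        (\<integral>\<^sup>+ x. ennreal (\<bar>cell_avg k (v i) x - cell_avg k (v j) x\<bar> powr P) \<partial>\<mu>) \<le> ennreal d"
      by blast
    have "(\<integral>\<^sup>+ x. ennreal (\<bar>v i x - v j x\<bar> powr P) \<partial>\<mu>) \<le> ennreal e" if ij: "N \<le> i" "N \<le> j" for i j
    proof -
      let ?d = "\<lambda>x. v i x - v j x"
      have avg: "cell_avg k ?d x = cell_avg k (v i) x - cell_avg k (v j) x" for x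
        by (intro cell_avg_diff adm_cell_integrable v)
      have "(\<integral>\<^sup>+ x. ennreal (\<bar>?d x\<bar> powr P) \<partial>\<mu>) \<le>
        (\<integral>\<^sup>+ x. ennreal (2 powr P) * (ennreal (\<bar>?d x - cell_avg k ?d x\<bar> powr P) + ennreal (\<bar>cell_avg k ?d x\<bar> powr P)) \<partial>\<mu>)"
        by (intro nn_integral_mono powr_diff_le_split)
      also have "\<dots> = ennreal (2 powr P) * ((\<integral>\<^sup>+ x. ennreal (\<bar>?d x - cell_avg k ?d x\<bar> powr P) \<partial>\<mu>) +
          (\<integral>\<^sup>+ x. ennreal (\<bar>cell_avg k ?d x\<bar> powr P) \<partial>\<mu>))"
        by (subst nn_integral_cmult, measurable, subst nn_integral_add, measurable)
      also have "\<dots> \<le> ennreal (2 powr P) * (ennreal d + ennreal d)"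
      proof (intro mult_left_mono add_mono)
        have "(\<integral>\<^sup>+ x. ennreal (\<bar>?d x - cell_avg k ?d x\<bar> powr P) \<partial>\<mu>) \<le> ennreal (approx_const * rate ^ k) * ennreal (2 powr P * (B + B))"
          by (rule order_trans[OF adm_approx[OF diff(1)] mult_left_mono[OF diff(2)]]) simp
        also have "\<dots> \<le> ennreal d"
          using k B approx_const rate by (subst ennreal_mult[symmetric]) (auto intro!: ennreal_leI)
        finally show "(\<integral>\<^sup>+ x. ennreal (\<bar>?d x - cell_avg k ?d x\<bar> powr P) \<partial>\<mu>) \<le> ennreal d" .
        show "(\<integral>\<^sup>+ x. ennreal (\<bar>cell_avg k ?d x\<bar> powr P) \<partial>\<mu>) \<le> ennreal d"
          unfolding avg using N ij by auto
      qed simp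
      also have "\<dots> = ennreal e"
        using d by (simp add: ennreal_mult[symmetric] ennreal_plus[symmetric] del: ennreal_plus)
      finally show ?thesis .
    qed
    then show ?thesis by blast
  qed
  have Lp: "(\<integral>\<^sup>+ x. ennreal (\<bar>v n x\<bar> powr P) \<partial>\<mu>) < \<infinity>" for n
    using adm_embed[OF v(1), of n] v(1)[of n] by (auto simp: adm_def ennreal_mult_less_top intro: le_less_trans)
  have vm: "v n \<in> borel_measurable \<mu>" for n by measurable
  obtain r where r: "strict_mono r" "AE x in \<mu>. Cauchy (\<lambda>i. v (r i) x)"
    using Lp_Cauchy_AE_subseq[OF emeasure_\<mu> less_imp_le[OF P] vm Lp Cau] by blast
  \<comment> \<open>Setting the limit to 0 off \<Omega> makes it vanish there at every point. Inside
    \<Omega> the weight is at least 1, so convergence \<mu>-a.e. is convergence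
    Lebesgue-a.e.\<close>
  define l where "l x = (if x \<in> \<Omega> then lim (\<lambda>i. v (r i) x) else 0)" for x
  have lm [measurable]: "l \<in> borel_measurable borel"
    unfolding l_def[abs_def] by measurable
  have "AE x in lborel. 0 < w x \<longrightarrow> Cauchy (\<lambda>i. v (r i) x)"
    using r(2) by (subst (asm) AE_density) auto
  then have ae: "AE x in lborel. (\<lambda>i. v (r i) x) \<longlonglongrightarrow> l x"
  proof eventually_elim
    case (elim x)
    show ?case
    proof (cases "x \<in> \<Omega>")
      case True
      then have "0 < w x" using w_ge[of x] by (auto intro: less_le_trans[OF zero_less_one])
      then have "convergent (\<lambda>i. v (r i) x)" using elim by (simp add: Cauchy_convergent_iff)
      then show ?thesis using True by (simp add: l_def convergent_LIMSEQ_iff)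
    next
      case False
      then have "v (r i) x = 0" for i using v(1)[of "r i"] by (auto simp: adm_def)
      then show ?thesis using False by (simp add: l_def)
    qed
  qed
  then have ae\<mu>: "AE x in \<mu>. (\<lambda>i. v (r i) x) \<longlonglongrightarrow> l x"
    by (subst AE_density) auto
  have "(\<lambda>n. \<integral>\<^sup>+ x. ennreal (\<bar>v n x - l x\<bar> powr P) \<partial>\<mu>) \<longlonglongrightarrow> 0"
    using P lm by (intro Lp_Cauchy_limit[OF _ vm _ Cau r(1) ae\<mu>]) auto
  then have "(\<lambda>n. \<integral>\<^sup>+ x. ennreal (\<bar>v (r n) x - l x\<bar> powr P) \<partial>\<mu>) \<longlonglongrightarrow> 0"
    using LIMSEQ_subseq_LIMSEQ[OF _ r(1)] by (auto simp: o_def)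
  moreover have "strict_mono (\<phi> \<circ> r)" using \<phi>(1) r(1) by (rule strict_mono_o)
  ultimately show thesis
    using that[of "\<phi> \<circ> r" l] ae lm by (auto simp: v_def l_def)
qed

end

section \<open>Differentiation under the integral\<close>

text \<open>The exceptional pairs lie in the two strips over a null set, each of product measure 0 *
  \<infinity> = 0. This carries a.e. statements about u to statements about u x - u y.\<close>

lemma AE_lborel_fst_snd:
  fixes Q :: "'a::euclidean_space \<Rightarrow> bool"
  assumes "AE x in lborel. Q x"
  shows "AE z in (lborel :: ('a \<times> 'a) measure). Q (fst z) \<and> Q (snd z)"
proof -
  from assms obtain N where N: "{x. \<not> Q x} \<subseteq> N" "emeasure lborel N = 0" "N \<in> sets lborel"
    by (elim AE_E) auto
  have "N \<times> UNIV \<in> null_sets (lborel \<Otimes>\<^sub>M lborel)" "UNIV \<times> N \<in> null_sets (lborel \<Otimes>\<^sub>M lborel)"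
    using N by (auto simp: null_sets_def lborel.emeasure_pair_measure_Times)
  then have "N \<times> UNIV \<union> UNIV \<times> N \<in> null_sets (lborel :: ('a \<times> 'a) measure)"
    unfolding lborel_prod by (rule null_sets.Un)
  then show ?thesis
    by (rule AE_I') (use N in auto)
qed

lemma measurable_fst_borel [measurable]: "(fst :: 'a::euclidean_space \<times> 'a \<Rightarrow> 'a) \<in> borel \<rightarrow>\<^sub>M borel"
  by (intro borel_measurable_continuous_onI continuous_intros)

lemma measurable_snd_borel [measurable]: "(snd :: 'a::euclidean_space \<times> 'a \<Rightarrow> 'a) \<in> borel \<rightarrow>\<^sub>M borel"
  by (intro borel_measurable_continuous_onI continuous_intros)

lemma gagliardo_pair:
  fixes u :: "real^'n \<Rightarrow> real"
  assumes [measurable]: "u \<in> borel_measurable borel"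
  shows "gagliardo s P u = (\<integral>\<^sup>+ z. ennreal (\<bar>u (fst z) - u (snd z)\<bar> powr P /
    norm (fst z - snd z) powr (real CARD('n) + s * P)) \<partial>lborel)"
  unfolding gagliardo_def lborel_prod[symmetric]
  by (subst lborel.nn_integral_fst[symmetric]) auto

lemma difference_quotient_bound:
  fixes F F' :: "real \<Rightarrow> real"
  assumes deriv: "\<And>t. 0 \<le> t \<Longrightarrow> t \<le> 1 \<Longrightarrow> (F has_real_derivative F' t) (at t)"
    and bound: "\<And>t. 0 \<le> t \<Longrightarrow> t \<le> 1 \<Longrightarrow> \<bar>F' t\<bar> \<le> D" and t: "0 < t" "t \<le> 1"
  shows "\<bar>F t - F 0\<bar> \<le> t * D"
proof -
  obtain z where "0 < z" "z < t" "F t - F 0 = (t - 0) * F' z"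
    using MVT2[of 0 t F F'] t deriv by auto
  then show ?thesis using bound[of z] t by (simp add: abs_mult)
qed

text \<open>The mean value theorem on [0, 1] makes the bound D of the derivative dominate all
  difference quotients. The steps 1 / (n + 1) form a sequence, as dominated convergence requires,
  and suffice for the first-order condition at a minimum.\<close>

lemma LIMSEQ_integral_difference_quotient:
  fixes F F' :: "'a \<Rightarrow> real \<Rightarrow> real"
  assumes deriv: "\<And>z t. 0 \<le> t \<Longrightarrow> t \<le> 1 \<Longrightarrow> (F z has_real_derivative F' z t) (at t)"
    and bound: "\<And>z t. 0 \<le> t \<Longrightarrow> t \<le> 1 \<Longrightarrow> \<bar>F' z t\<bar> \<le> D z"
    and D: "integrable M D"
    and F: "\<And>t. integrable M (\<lambda>z. F z t)"
    and F' [measurable]: "(\<lambda>z. F' z 0) \<in> borel_measurable M"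
  shows "integrable M (\<lambda>z. F' z 0)"
    and "(\<lambda>n. ((\<integral>z. F z (1 / real (Suc n)) \<partial>M) - (\<integral>z. F z 0 \<partial>M)) / (1 / real (Suc n))) \<longlonglongrightarrow> (\<integral>z. F' z 0 \<partial>M)"
proof -
  show "integrable M (\<lambda>z. F' z 0)"
  proof (rule Bochner_Integration.integrable_bound[OF D F'], rule AE_I2)
    show "norm (F' z 0) \<le> norm (D z)" for z
      using bound[of 0 z] by simp
  qed
  have [measurable]: "(\<lambda>z. F z t) \<in> borel_measurable M" for t using F[of t] by auto
  let ?t = "\<lambda>n. 1 / real (Suc n)"
  have quot: "norm (x / t) \<le> d" if "\<bar>x\<bar> \<le> t * d" "0 < t" for x t d :: real
    using that by (simp add: abs_divide pos_divide_le_eq mult.commute)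
  have "(\<lambda>n. \<integral>z. (F z (?t n) - F z 0) / ?t n \<partial>M) \<longlonglongrightarrow> (\<integral>z. F' z 0 \<partial>M)"
  proof (rule integral_dominated_convergence[OF _ _ D])
    show "AE z in M. (\<lambda>n. (F z (?t n) - F z 0) / ?t n) \<longlonglongrightarrow> F' z 0"
    proof (rule AE_I2)
      fix z
      have "(\<lambda>h. (F z (0 + h) - F z 0) / h) \<midarrow>0\<rightarrow> F' z 0"
        using deriv[of 0 z] by (simp add: DERIV_def)
      moreover have "?t \<longlonglongrightarrow> 0"
        using LIMSEQ_inverse_real_of_nat by (simp add: inverse_eq_divide)
      then have "filterlim ?t (at 0) sequentially"
        by (auto simp: filterlim_at)
      ultimately show "(\<lambda>n. (F z (?t n) - F z 0) / ?t n) \<longlonglongrightarrow> F' z 0"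
        using filterlim_compose by fastforce
    qed
    show "AE z in M. norm ((F z (?t n) - F z 0) / ?t n) \<le> D z" for n
    proof (rule AE_I2)
      fix z
      have "\<bar>F z (?t n) - F z 0\<bar> \<le> ?t n * D z"
        using deriv bound by (intro difference_quotient_bound[where F' = "F' z"]) auto
      then show "norm ((F z (?t n) - F z 0) / ?t n) \<le> D z"
        by (rule quot) simp
    qed
  qed measurable
  then show "(\<lambda>n. ((\<integral>z. F z (?t n) \<partial>M) - (\<integral>z. F z 0 \<partial>M)) / ?t n) \<longlonglongrightarrow> (\<integral>z. F' z 0 \<partial>M)"
    using F by simp
qed

text \<open>Away from 0 this is the ordinary power rule on a half line. At 0 the formula gives 0,
  since one factor is t itself, and the quotient |h|^(m-1) / m tends to 0 because m > 1; exponents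
  below 2 are thus covered.\<close>

lemma has_real_derivative_abs_powr:
  fixes m t :: real
  assumes m: "1 < m"
  shows "((\<lambda>t. \<bar>t\<bar> powr m / m) has_real_derivative \<bar>t\<bar> powr (m - 2) * t) (at t)"
proof (cases t "0 :: real" rule: linorder_cases)
  case greater
  have "((\<lambda>t. t powr m / m) has_real_derivative m * t powr (m - 1) / m) (at t)"
    using greater by (auto intro!: derivative_eq_intros)
  moreover have "m * t powr (m - 1) / m = \<bar>t\<bar> powr (m - 2) * t"
    using greater m powr_mult_base[of t "m - 2"] by (simp add: mult_ac)
  moreover have "\<forall>\<^sub>F x in nhds t. \<bar>x\<bar> powr m / m = x powr m / m"
    by (rule eventually_mono[OF eventually_nhds_in_open[of "{0<..}" t]]) (use greater in auto)
  ultimately show ?thesis by (subst DERIV_cong_ev[OF refl _ refl]) auto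
next
  case less
  have "((\<lambda>t. (- t) powr m / m) has_real_derivative - (m * (- t) powr (m - 1)) / m) (at t)"
    using less by (auto intro!: derivative_eq_intros)
  moreover have "- (m * (- t) powr (m - 1)) / m = \<bar>t\<bar> powr (m - 2) * t"
    using less m powr_mult_base[of "- t" "m - 2"] by (simp add: mult_ac)
  moreover have "\<forall>\<^sub>F x in nhds t. \<bar>x\<bar> powr m / m = (- x) powr m / m"
    by (rule eventually_mono[OF eventually_nhds_in_open[of "{..<0}" t]]) (use less in auto)
  ultimately show ?thesis by (subst DERIV_cong_ev[OF refl _ refl]) auto
next
  case equal
  have "((\<lambda>h::real. \<bar>h\<bar> powr (m - 1) / m) \<longlongrightarrow> 0 / m) (at 0)"
    using m by (intro tendsto_divide tendsto_const tendsto_zero_powrI[where b = "m - 1"] tendsto_rabs_zero tendsto_ident_at) auto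
  then have lim: "((\<lambda>h::real. \<bar>h\<bar> powr (m - 1) / m) \<longlongrightarrow> 0) (at 0)" by simp
  have "((\<lambda>h::real. (\<bar>h\<bar> powr m / m) / h) \<longlongrightarrow> 0) (at 0)"
  proof (rule Lim_null_comparison[OF _ lim])
    have "norm (\<bar>h\<bar> powr m / m / h) \<le> \<bar>h\<bar> powr (m - 1) / m" for h :: real
      using m powr_mult_base[of "\<bar>h\<bar>" "m - 1"] by (cases "h = 0") (auto simp: abs_mult field_simps)
    then show "\<forall>\<^sub>F h in at 0. norm (\<bar>h\<bar> powr m / m / h) \<le> \<bar>h\<bar> powr (m - 1) / m"
      by (intro always_eventually allI)
  qed
  then show ?thesis using equal by (simp add: DERIV_def)
qed

lemma powr_le_one_plus_powr:
  fixes t m P :: real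
  assumes "0 \<le> t" "m \<le> P" "0 \<le> m"
  shows "t powr m \<le> 1 + t powr P"
proof (cases "t \<le> 1")
  case True
  then have "t powr m \<le> 1" using assms powr_mono2[of m t 1] by simp
  then show ?thesis by (simp add: add_increasing2)
next
  case False
  then have "t powr m \<le> t powr P" using assms by (intro powr_mono) auto
  then show ?thesis by simp
qed

lemma abs_powr_mult_self:
  fixes m t :: real
  shows "\<bar>\<bar>t\<bar> powr (m - 2) * t\<bar> = \<bar>t\<bar> powr (m - 1)"
  using powr_mult_base[of "\<bar>t\<bar>" "m - 2"] by (simp add: abs_mult mult.commute)

text \<open>Since 1 + r is at least 1, the exponent m - 1 may be raised to P - 1. This trades the
  variable exponent for the fixed one.\<close>

lemma abs_powr_mult_self_le:
  fixes m t P r :: real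
  assumes "1 < m" "m \<le> P" "\<bar>t\<bar> \<le> r"
  shows "\<bar>\<bar>t\<bar> powr (m - 2) * t\<bar> \<le> (1 + r) powr (P - 1)"
proof -
  have "\<bar>t\<bar> powr (m - 1) \<le> (1 + r) powr (m - 1)"
    using assms by (intro powr_mono2) auto
  also have "\<dots> \<le> (1 + r) powr (P - 1)"
    using assms by (intro powr_mono) auto
  finally show ?thesis by (simp add: abs_powr_mult_self)
qed

lemma abs_powr_diff_le:
  fixes m P x y :: real
  assumes m: "1 < m" "m \<le> P"
  shows "\<bar>\<bar>x\<bar> powr m / m - \<bar>y\<bar> powr m / m\<bar> \<le> (1 + (\<bar>x\<bar> + \<bar>y\<bar>)) powr (P - 1) * \<bar>x - y\<bar>"
proof -
  have *: "\<bar>\<bar>b\<bar> powr m / m - \<bar>a\<bar> powr m / m\<bar> \<le> (1 + (\<bar>a\<bar> + \<bar>b\<bar>)) powr (P - 1) * \<bar>b - a\<bar>" if ab: "a < b" for a b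
  proof -
    obtain z where z: "a < z" "z < b" "\<bar>b\<bar> powr m / m - \<bar>a\<bar> powr m / m = (b - a) * (\<bar>z\<bar> powr (m - 2) * z)"
      using MVT2[OF ab, of "\<lambda>t. \<bar>t\<bar> powr m / m" "\<lambda>z. \<bar>z\<bar> powr (m - 2) * z"]
        has_real_derivative_abs_powr[OF m(1)] by blast
    have "\<bar>\<bar>z\<bar> powr (m - 2) * z\<bar> \<le> (1 + (\<bar>a\<bar> + \<bar>b\<bar>)) powr (P - 1)"
      using z by (intro abs_powr_mult_self_le m) auto
    then show ?thesis
      unfolding z(3) abs_mult[of "b - a"] by (subst mult.commute) (intro mult_right_mono, auto)
  qed
  show ?thesis
  proof (cases x y rule: linorder_cases)
    case less
    then show ?thesis using *[of x y] by (simp add: abs_minus_commute)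
  next
    case greater
    then show ?thesis using *[of y x] by (simp add: add.commute)
  qed simp
qed

section \<open>The functional and its minimiser\<close>

text \<open>All bounds hold at every point. C1 bounds both A and its primitive, and |a| <= w reduces
  every estimate of the potential to the measure w dx. The number m1 separates the exponents m x
  uniformly from P.\<close>

locale variational = weighted_domain s P M w \<Omega>
  for s P M :: real and w :: "real^'n \<Rightarrow> ennreal" and \<Omega> +
  fixes A \<Phi> :: "real \<Rightarrow> real" and c0 C1 b0 b1 m1 :: real
    and K :: "(real^'n) \<times> (real^'n) \<Rightarrow> real" and a m :: "real^'n \<Rightarrow> real"
  assumes \<Phi>_deriv: "\<And>t. (\<Phi> has_real_derivative A t) (at t)"
    and A_meas [measurable]: "A \<in> borel_measurable borel"
    and A_bound: "\<And>t. \<bar>A t\<bar> \<le> C1 * \<bar>t\<bar> powr (P - 1)"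
    and \<Phi>_lower: "\<And>t. c0 * \<bar>t\<bar> powr P \<le> \<Phi> t" and \<Phi>_upper: "\<And>t. \<Phi> t \<le> C1 * \<bar>t\<bar> powr P"
    and consts_pos: "0 < c0" "0 < C1" "0 < b0" "0 < b1"
    and K_meas [measurable]: "K \<in> borel_measurable borel"
    and K_lower: "\<And>z. b0 / norm (fst z - snd z) powr (real CARD('n) + s * P) \<le> K z"
    and K_upper: "\<And>z. K z \<le> b1 / norm (fst z - snd z) powr (real CARD('n) + s * P)"
    and a_meas [measurable]: "a \<in> borel_measurable borel"
    and a_le: "\<And>x. ennreal \<bar>a x\<bar> \<le> w x"
    and m_meas [measurable]: "m \<in> borel_measurable borel"
    and m_bounds: "\<And>x. 1 < m x" "\<And>x. m x \<le> m1" "m1 < P"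
begin

abbreviation \<kappa> :: "(real^'n) \<times> (real^'n) \<Rightarrow> real" where
  "\<kappa> z \<equiv> 1 / norm (fst z - snd z) powr (real CARD('n) + s * P)"

text \<open>The real-valued energy G. Infinity would be sent to 0, so the value is meaningful only
  for admissible functions.\<close>

definition gag :: "(real^'n \<Rightarrow> real) \<Rightarrow> real" where "gag u = enn2real (gagliardo s P u)"

definition energy :: "(real^'n \<Rightarrow> real) \<Rightarrow> real" where
  "energy u = (\<integral>z. \<Phi> (u (fst z) - u (snd z)) * K z \<partial>lborel)"

definition pot :: "(real^'n \<Rightarrow> real) \<Rightarrow> real" where
  "pot u = (\<integral>x. a x * (\<bar>u x\<bar> powr m x / m x) \<partial>lborel)"

lemma gag_nonneg: "0 \<le> gag u"
  by (simp add: gag_def)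

lemma adm_measurable: "adm u \<Longrightarrow> u \<in> borel_measurable borel"
  by (simp add: adm_def)

lemma gagliardo_eq_gag: "adm u \<Longrightarrow> gagliardo s P u = ennreal (gag u)"
  by (simp add: gag_def adm_def less_top)

lemma \<Phi>_meas [measurable]: "\<Phi> \<in> borel_measurable borel"
  using \<Phi>_deriv by (intro borel_measurable_continuous_onI continuous_at_imp_continuous_on) (blast intro: DERIV_isCont)

lemma m_le_P: "m x \<le> P"
  using m_bounds(2)[of x] m_bounds(3) by simp

lemma \<Phi>_nonneg: "0 \<le> \<Phi> t"
  using \<Phi>_lower[of t] consts_pos by (smt (verit) mult_nonneg_nonneg powr_ge_zero)

lemma K_nonneg: "0 \<le> K z"
  using K_lower[of z] consts_pos by (smt (verit) divide_nonneg_nonneg powr_ge_zero)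

lemma powr_kernel_integrable:
  assumes u: "adm u"
  shows "integrable lborel (\<lambda>z. \<bar>u (fst z) - u (snd z)\<bar> powr P * \<kappa> z)"
    and "(\<integral>z. \<bar>u (fst z) - u (snd z)\<bar> powr P * \<kappa> z \<partial>lborel) = gag u"
proof -
  note [measurable] = adm_measurable[OF u]
  have g: "(\<integral>\<^sup>+ z. ennreal (\<bar>u (fst z) - u (snd z)\<bar> powr P * \<kappa> z) \<partial>lborel) = ennreal (gag u)"
    using gagliardo_pair[of u s P] gagliardo_eq_gag[OF u] by simp
  show "integrable lborel (\<lambda>z. \<bar>u (fst z) - u (snd z)\<bar> powr P * \<kappa> z)"
    by (rule integrableI_nonneg) (use g in auto)
  show "(\<integral>z. \<bar>u (fst z) - u (snd z)\<bar> powr P * \<kappa> z \<partial>lborel) = gag u"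
    by (subst integral_eq_nn_integral) (use g gag_nonneg in auto)
qed

lemma energy_integrand_bounds:
  shows "c0 * b0 * (\<bar>t\<bar> powr P * \<kappa> z) \<le> \<Phi> t * K z" "\<Phi> t * K z \<le> C1 * b1 * (\<bar>t\<bar> powr P * \<kappa> z)"
proof -
  have "c0 * \<bar>t\<bar> powr P * (b0 * \<kappa> z) \<le> \<Phi> t * K z"
    using \<Phi>_lower[of t] K_lower[of z] consts_pos by (intro mult_mono \<Phi>_nonneg) auto
  then show "c0 * b0 * (\<bar>t\<bar> powr P * \<kappa> z) \<le> \<Phi> t * K z" by (simp add: mult_ac)
  have "\<Phi> t * K z \<le> C1 * \<bar>t\<bar> powr P * (b1 * \<kappa> z)"
    using \<Phi>_upper[of t] K_upper[of z] consts_pos by (intro mult_mono K_nonneg) auto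
  then show "\<Phi> t * K z \<le> C1 * b1 * (\<bar>t\<bar> powr P * \<kappa> z)" by (simp add: mult_ac)
qed

lemma energy_integrable:
  assumes u: "adm u"
  shows "integrable lborel (\<lambda>z. \<Phi> (u (fst z) - u (snd z)) * K z)"
proof (rule Bochner_Integration.integrable_bound)
  note [measurable] = adm_measurable[OF u]
  show "(\<lambda>z. \<Phi> (u (fst z) - u (snd z)) * K z) \<in> borel_measurable lborel" by measurable
  show "integrable lborel (\<lambda>z. C1 * b1 * (\<bar>u (fst z) - u (snd z)\<bar> powr P * \<kappa> z))"
    by (intro integrable_mult_right powr_kernel_integrable assms)
  show "AE z in lborel. norm (\<Phi> (u (fst z) - u (snd z)) * K z) \<le> norm (C1 * b1 * (\<bar>u (fst z) - u (snd z)\<bar> powr P * \<kappa> z))"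
  proof (rule AE_I2)
    fix z
    show "norm (\<Phi> (u (fst z) - u (snd z)) * K z) \<le> norm (C1 * b1 * (\<bar>u (fst z) - u (snd z)\<bar> powr P * \<kappa> z))"
      using energy_integrand_bounds(2)[of "u (fst z) - u (snd z)" z] \<Phi>_nonneg K_nonneg consts_pos
      by (simp add: abs_mult)
  qed
qed

lemma energy_bounds:
  assumes u: "adm u"
  shows "c0 * b0 * gag u \<le> energy u" "energy u \<le> C1 * b1 * gag u"
proof -
  have "(\<integral>z. c0 * b0 * (\<bar>u (fst z) - u (snd z)\<bar> powr P * \<kappa> z) \<partial>lborel) \<le> energy u"
    unfolding energy_def
    by (intro integral_mono integrable_mult_right powr_kernel_integrable energy_integrable energy_integrand_bounds assms)
  then show "c0 * b0 * gag u \<le> energy u"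
    by (simp only: integral_mult_right_zero powr_kernel_integrable(2)[OF assms])
  have "energy u \<le> (\<integral>z. C1 * b1 * (\<bar>u (fst z) - u (snd z)\<bar> powr P * \<kappa> z) \<partial>lborel)"
    unfolding energy_def
    by (intro integral_mono integrable_mult_right powr_kernel_integrable energy_integrable energy_integrand_bounds assms)
  then show "energy u \<le> C1 * b1 * gag u"
    by (simp only: integral_mult_right_zero powr_kernel_integrable(2)[OF assms])
qed

definition W :: real where "W = measure \<mu> (space \<mu>)"

lemma W: "(\<integral>\<^sup>+ x. w x \<partial>lborel) = ennreal W" "0 \<le> W"
proof -
  have "emeasure \<mu> (space \<mu>) = ennreal W"
    unfolding W_def using emeasure_\<mu> by (intro emeasure_eq_ennreal_measure) auto
  then show "(\<integral>\<^sup>+ x. w x \<partial>lborel) = ennreal W" by (simp add: emeasure_density)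
qed (simp add: W_def)

lemma a_integrable:
  shows "integrable lborel (\<lambda>x. \<bar>a x\<bar>)" "(\<integral>x. \<bar>a x\<bar> \<partial>lborel) \<le> W"
proof -
  have le: "(\<integral>\<^sup>+ x. ennreal \<bar>a x\<bar> \<partial>lborel) \<le> ennreal W"
    unfolding W(1)[symmetric] by (intro nn_integral_mono a_le)
  show i: "integrable lborel (\<lambda>x. \<bar>a x\<bar>)"
    by (rule integrableI_nonneg) (use le in \<open>auto intro: le_less_trans\<close>)
  then show "(\<integral>x. \<bar>a x\<bar> \<partial>lborel) \<le> W"
    using le W(2) by (subst (asm) nn_integral_eq_integral) auto
qed

text \<open>Only a bound in L^P(\<mu>) is assumed, not admissibility, so that the estimate also
  serves limits whose energy is not yet known to be finite.\<close>

lemma a_powr_integrable: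
  assumes [measurable]: "u \<in> borel_measurable borel"
    and c: "(\<integral>\<^sup>+ x. ennreal (\<bar>u x\<bar> powr P) \<partial>\<mu>) \<le> ennreal c" "0 \<le> c"
  shows "integrable lborel (\<lambda>x. \<bar>a x\<bar> * \<bar>u x\<bar> powr P)" "(\<integral>x. \<bar>a x\<bar> * \<bar>u x\<bar> powr P \<partial>lborel) \<le> c"
proof -
  have "(\<integral>\<^sup>+ x. ennreal (\<bar>a x\<bar> * \<bar>u x\<bar> powr P) \<partial>lborel) \<le> (\<integral>\<^sup>+ x. w x * ennreal (\<bar>u x\<bar> powr P) \<partial>lborel)"
    using a_le by (intro nn_integral_mono) (auto simp: ennreal_mult intro!: mult_right_mono)
  also have "\<dots> \<le> ennreal c" using c by (simp add: nn_integral_density)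
  finally have le: "(\<integral>\<^sup>+ x. ennreal (\<bar>a x\<bar> * \<bar>u x\<bar> powr P) \<partial>lborel) \<le> ennreal c" .
  show i: "integrable lborel (\<lambda>x. \<bar>a x\<bar> * \<bar>u x\<bar> powr P)"
    by (rule integrableI_nonneg) (use le in \<open>auto intro: le_less_trans\<close>)
  then show "(\<integral>x. \<bar>a x\<bar> * \<bar>u x\<bar> powr P \<partial>lborel) \<le> c"
    using le c by (subst (asm) nn_integral_eq_integral) auto
qed

lemma adm_Lp_\<mu>: "adm u \<Longrightarrow> (\<integral>\<^sup>+ x. ennreal (\<bar>u x\<bar> powr P) \<partial>\<mu>) \<le> ennreal (embed_const * gag u)"
  using adm_embed[of u] gagliardo_eq_gag[of u] embed_const gag_nonneg[of u] by (simp add: ennreal_mult)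

lemma pot_integrable:
  assumes [measurable]: "u \<in> borel_measurable borel"
    and c: "(\<integral>\<^sup>+ x. ennreal (\<bar>u x\<bar> powr P) \<partial>\<mu>) \<le> ennreal c" "0 \<le> c"
  shows "integrable lborel (\<lambda>x. a x * (\<bar>u x\<bar> powr m x / m x))" "\<bar>pot u\<bar> \<le> W + c"
proof -
  have le: "\<bar>a x * (\<bar>u x\<bar> powr m x / m x)\<bar> \<le> \<bar>a x\<bar> + \<bar>a x\<bar> * \<bar>u x\<bar> powr P" for x
  proof -
    have "\<bar>u x\<bar> powr m x / m x \<le> \<bar>u x\<bar> powr m x"
      using m_bounds(1)[of x] mult_left_mono[of 1 "m x" "\<bar>u x\<bar> powr m x"] by (simp add: divide_le_eq)
    also have "\<dots> \<le> 1 + \<bar>u x\<bar> powr P"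
      using m_bounds(1)[of x] m_le_P[of x] by (intro powr_le_one_plus_powr) auto
    finally have "\<bar>a x\<bar> * (\<bar>u x\<bar> powr m x / m x) \<le> \<bar>a x\<bar> * (1 + \<bar>u x\<bar> powr P)"
      by (intro mult_left_mono) auto
    then show ?thesis using m_bounds(1)[of x] by (simp add: abs_mult distrib_left)
  qed
  have i: "integrable lborel (\<lambda>x. \<bar>a x\<bar> + \<bar>a x\<bar> * \<bar>u x\<bar> powr P)"
    by (intro Bochner_Integration.integrable_add a_integrable a_powr_integrable[OF _ c]) measurable
  show j: "integrable lborel (\<lambda>x. a x * (\<bar>u x\<bar> powr m x / m x))"
    by (rule Bochner_Integration.integrable_bound[OF i]) (use le in \<open>auto intro!: AE_I2 intro: order_trans[OF _ abs_ge_self]\<close>)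
  have "\<bar>pot u\<bar> \<le> (\<integral>x. \<bar>a x * (\<bar>u x\<bar> powr m x / m x)\<bar> \<partial>lborel)"
    unfolding pot_def by (rule integral_abs_bound)
  also have "\<dots> \<le> (\<integral>x. \<bar>a x\<bar> + \<bar>a x\<bar> * \<bar>u x\<bar> powr P \<partial>lborel)"
    by (intro integral_mono integrable_abs i j le)
  also have "\<dots> = (\<integral>x. \<bar>a x\<bar> \<partial>lborel) + (\<integral>x. \<bar>a x\<bar> * \<bar>u x\<bar> powr P \<partial>lborel)"
    by (intro Bochner_Integration.integral_add a_integrable a_powr_integrable[OF _ c]) measurable
  also have "\<dots> \<le> W + c"
    by (intro add_mono a_integrable a_powr_integrable[OF _ c]) measurable
  finally show "\<bar>pot u\<bar> \<le> W + c" .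
qed

lemma one_plus_powr_le:
  assumes "0 \<le> x" "0 \<le> y"
  shows "(1 + (x + y)) powr P \<le> 2 powr P * (1 + 2 powr P * (x powr P + y powr P))"
proof -
  have "(1 + (x + y)) powr P \<le> 2 powr P * (1 powr P + (x + y) powr P)"
    using assms P by (intro powr_add_le) auto
  also have "\<dots> \<le> 2 powr P * (1 + 2 powr P * (x powr P + y powr P))"
    using powr_add_le[of x y P] assms P by simp
  finally show ?thesis .
qed

text \<open>The mean value theorem bounds the difference of the powers by (1 + |u| + |v|)^(P-1) |u -
  v|. Young's inequality separates this into a small multiple of a bounded quantity and a large
  multiple of the vanishing L^P distance.\<close>

lemma pot_LIMSEQ:
  assumes [measurable]: "\<And>n. u n \<in> borel_measurable borel" "v \<in> borel_measurable borel"
    and c: "\<And>n. (\<integral>\<^sup>+ x. ennreal (\<bar>u n x\<bar> powr P) \<partial>\<mu>) \<le> ennreal c" "0 \<le> c"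
    and lim: "(\<lambda>n. \<integral>\<^sup>+ x. ennreal (\<bar>u n x - v x\<bar> powr P) \<partial>\<mu>) \<longlonglongrightarrow> 0"
  shows "(\<lambda>n. pot (u n)) \<longlonglongrightarrow> pot v"
    and "\<exists>c'. 0 \<le> c' \<and> (\<integral>\<^sup>+ x. ennreal (\<bar>v x\<bar> powr P) \<partial>\<mu>) \<le> ennreal c'"
proof -
  define c' where "c' = 2 powr P * (1 + c)"
  have c'0: "0 \<le> c'" using c by (simp add: c'_def)
  have v: "(\<integral>\<^sup>+ x. ennreal (\<bar>v x\<bar> powr P) \<partial>\<mu>) \<le> ennreal c'"
  proof -
    obtain n where n: "(\<integral>\<^sup>+ x. ennreal (\<bar>u n x - v x\<bar> powr P) \<partial>\<mu>) < ennreal 1"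
      using order_tendstoD(2)[OF lim, of "ennreal 1"] by (auto simp: eventually_sequentially)
    have "(\<integral>\<^sup>+ x. ennreal (\<bar>v x\<bar> powr P) \<partial>\<mu>) \<le>
        (\<integral>\<^sup>+ x. ennreal (2 powr P) * (ennreal (\<bar>v x - u n x\<bar> powr P) + ennreal (\<bar>u n x\<bar> powr P)) \<partial>\<mu>)"
      by (intro nn_integral_mono powr_diff_le_split)
    also have "\<dots> = ennreal (2 powr P) * ((\<integral>\<^sup>+ x. ennreal (\<bar>v x - u n x\<bar> powr P) \<partial>\<mu>) + (\<integral>\<^sup>+ x. ennreal (\<bar>u n x\<bar> powr P) \<partial>\<mu>))"
      by (subst nn_integral_cmult, measurable, subst nn_integral_add, measurable)
    also have "\<dots> \<le> ennreal (2 powr P) * (ennreal 1 + ennreal c)"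
      using n c by (intro mult_left_mono add_mono) (auto simp: abs_minus_commute)
    also have "\<dots> = ennreal c'"
      using c unfolding c'_def by (simp only: ennreal_mult[symmetric] ennreal_plus[symmetric] powr_ge_zero zero_le_one add_nonneg_nonneg)
    finally show ?thesis .
  qed
  then show "\<exists>c'. 0 \<le> c' \<and> (\<integral>\<^sup>+ x. ennreal (\<bar>v x\<bar> powr P) \<partial>\<mu>) \<le> ennreal c'" using c'0 by blast
  define e where "e n = enn2real (\<integral>\<^sup>+ x. ennreal (\<bar>u n x - v x\<bar> powr P) \<partial>\<mu>)" for n
  have e0: "0 \<le> e n" for n by (simp add: e_def)
  have elim: "e \<longlonglongrightarrow> 0"
    using tendsto_enn2real[of _ 0] lim unfolding e_def[abs_def] by simp
  \<comment> \<open>\<open>enn2real\<close> sends infinity to 0, so \<open>e n\<close> dominates the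
    distance only where the latter is finite, which holds for all large n.\<close>
  have efin: "\<forall>\<^sub>F n in sequentially. (\<integral>\<^sup>+ x. ennreal (\<bar>u n x - v x\<bar> powr P) \<partial>\<mu>) \<le> ennreal (e n)"
    using order_tendstoD(2)[OF lim, of "ennreal 1"]
  proof (rule eventually_mono)
    fix n assume "(\<integral>\<^sup>+ x. ennreal (\<bar>u n x - v x\<bar> powr P) \<partial>\<mu>) < ennreal 1"
    then have "(\<integral>\<^sup>+ x. ennreal (\<bar>u n x - v x\<bar> powr P) \<partial>\<mu>) < top" by (rule less_trans) simp
    then show "(\<integral>\<^sup>+ x. ennreal (\<bar>u n x - v x\<bar> powr P) \<partial>\<mu>) \<le> ennreal (e n)"
      by (simp add: e_def)
  qed simp
  \<comment> \<open>Q bounds the integral of |a| (1 + |u n| + |v|)^P uniformly in n: W for the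
    constant, c and c' for the two powers.\<close>
  define Q where "Q = 2 powr P * (W + 2 powr P * (c + c'))"
  have Q: "0 \<le> Q" using W c c'0 by (simp add: Q_def)
  have main: "\<bar>pot (u n) - pot v\<bar> \<le> d * Q + d powr (1 - P) * e n"
    if d: "0 < d" and en: "(\<integral>\<^sup>+ x. ennreal (\<bar>u n x - v x\<bar> powr P) \<partial>\<mu>) \<le> ennreal (e n)" for d n
  proof -
    let ?A = "\<lambda>x. \<bar>a x\<bar>" and ?U = "\<lambda>x. \<bar>a x\<bar> * \<bar>u n x\<bar> powr P" and ?V = "\<lambda>x. \<bar>a x\<bar> * \<bar>v x\<bar> powr P"
      and ?D = "\<lambda>x. \<bar>a x\<bar> * \<bar>u n x - v x\<bar> powr P"
    note iA = a_integrable
    note iU = a_powr_integrable[OF assms(1) c, of n]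
    note iV = a_powr_integrable[OF assms(2) v c'0]
    have iD: "integrable lborel ?D" "(\<integral>x. ?D x \<partial>lborel) \<le> e n"
      using a_powr_integrable[OF _ en e0] by simp_all
    have pu: "integrable lborel (\<lambda>x. a x * (\<bar>u n x\<bar> powr m x / m x))"
      by (rule pot_integrable(1)[OF _ c]) measurable
    have pv: "integrable lborel (\<lambda>x. a x * (\<bar>v x\<bar> powr m x / m x))"
      by (rule pot_integrable(1)[OF _ v c'0]) measurable
    have pt: "\<bar>a x * (\<bar>u n x\<bar> powr m x / m x) - a x * (\<bar>v x\<bar> powr m x / m x)\<bar> \<le>
        d * 2 powr P * (?A x + 2 powr P * (?U x + ?V x)) + d powr (1 - P) * ?D x" for x
    proof -
      have "\<bar>\<bar>u n x\<bar> powr m x / m x - \<bar>v x\<bar> powr m x / m x\<bar> \<le> (1 + (\<bar>u n x\<bar> + \<bar>v x\<bar>)) powr (P - 1) * \<bar>u n x - v x\<bar>"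
        by (intro abs_powr_diff_le m_bounds m_le_P)
      also have "\<dots> \<le> d * (1 + (\<bar>u n x\<bar> + \<bar>v x\<bar>)) powr P + d powr (1 - P) * \<bar>u n x - v x\<bar> powr P"
        using d P by (intro powr_mult_le_Young) auto
      also have "\<dots> \<le> d * (2 powr P * (1 + 2 powr P * (\<bar>u n x\<bar> powr P + \<bar>v x\<bar> powr P))) + d powr (1 - P) * \<bar>u n x - v x\<bar> powr P"
        using d by (intro add_right_mono mult_left_mono one_plus_powr_le) auto
      finally have "\<bar>a x\<bar> * \<bar>\<bar>u n x\<bar> powr m x / m x - \<bar>v x\<bar> powr m x / m x\<bar> \<le>
        \<bar>a x\<bar> * (d * (2 powr P * (1 + 2 powr P * (\<bar>u n x\<bar> powr P + \<bar>v x\<bar> powr P))) + d powr (1 - P) * \<bar>u n x - v x\<bar> powr P)"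
        by (intro mult_left_mono) auto
      then show ?thesis
        by (simp add: abs_mult[symmetric] right_diff_distrib algebra_simps)
    qed
    have "\<bar>pot (u n) - pot v\<bar> = \<bar>\<integral>x. a x * (\<bar>u n x\<bar> powr m x / m x) - a x * (\<bar>v x\<bar> powr m x / m x) \<partial>lborel\<bar>"
      unfolding pot_def using pu pv by simp
    also have "\<dots> \<le> (\<integral>x. \<bar>a x * (\<bar>u n x\<bar> powr m x / m x) - a x * (\<bar>v x\<bar> powr m x / m x)\<bar> \<partial>lborel)"
      by (rule integral_abs_bound)
    also have "\<dots> \<le> (\<integral>x. d * 2 powr P * (?A x + 2 powr P * (?U x + ?V x)) + d powr (1 - P) * ?D x \<partial>lborel)"
      by (intro integral_mono integrable_abs Bochner_Integration.integrable_diff pu pv pt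
          Bochner_Integration.integrable_add integrable_mult_right iA iU iV iD)
    also have "\<dots> = d * 2 powr P * ((\<integral>x. ?A x \<partial>lborel) + 2 powr P * ((\<integral>x. ?U x \<partial>lborel) + (\<integral>x. ?V x \<partial>lborel))) +
        d powr (1 - P) * (\<integral>x. ?D x \<partial>lborel)"
      using iA(1) iU(1) iV(1) iD(1)
      by (simp only: Bochner_Integration.integral_add Bochner_Integration.integrable_add integrable_mult_right integral_mult_right_zero)
    also have "\<dots> \<le> d * 2 powr P * (W + 2 powr P * (c + c')) + d powr (1 - P) * e n"
      using d by (intro add_mono mult_left_mono iA iU iV iD) auto
    finally show ?thesis by (simp add: Q_def mult.assoc)
  qed
  show "(\<lambda>n. pot (u n)) \<longlonglongrightarrow> pot v"
  proof (rule tendstoI)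
    fix r :: real assume r: "0 < r"
    \<comment> \<open>With Q + 1 in the denominator d Q stays below 3 r / 4 even for Q = 0; the last
      quarter of r is left for the term with \<open>e n\<close>.\<close>
    define d where "d = r / (2 * (Q + 1))"
    have d: "0 < d" "d * Q < r / 2 + r / 4" using Q r mult_nonneg_nonneg[of Q r] by (auto simp: d_def field_simps intro: add_pos_nonneg)
    have "(\<lambda>n. d powr (1 - P) * e n) \<longlonglongrightarrow> d powr (1 - P) * 0"
      by (intro tendsto_intros elim)
    then have "\<forall>\<^sub>F n in sequentially. d powr (1 - P) * e n < r / 4"
      using r by (intro order_tendstoD(2)) auto
    with efin show "\<forall>\<^sub>F n in sequentially. dist (pot (u n)) (pot v) < r"
    proof eventually_elim
      case (elim n)
      then show ?case using main[OF d(1) elim(1)] d(2) by (simp add: dist_real_def)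
    qed
  qed
qed

section \<open>Coercivity and the direct method\<close>

definition J :: "real \<Rightarrow> (real^'n \<Rightarrow> real) \<Rightarrow> real" where
  "J lam u = energy u - lam * pot u"

text \<open>Below this value \<open>lam * embed_const\<close> is at most c0 * b0 / 2, so the
  potential consumes at most half of the lower energy bound and the other half keeps minimising
  sequences bounded.\<close>

definition lam_star :: real where
  "lam_star = c0 * b0 / (2 * embed_const)"

lemma lam_star: "0 < lam_star"
  using consts_pos embed_const by (simp add: lam_star_def)

lemma adm_pot_integrable:
  assumes "adm u"
  shows "integrable lborel (\<lambda>x. a x * (\<bar>u x\<bar> powr m x / m x))" "\<bar>pot u\<bar> \<le> W + embed_const * gag u"
  using pot_integrable[OF adm_measurable[OF assms] adm_Lp_\<mu>[OF assms]] embed_const gag_nonneg[of u] by auto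

lemma J_coercive:
  assumes u: "adm u" and lam: "0 < lam" "lam < lam_star"
  shows "c0 * b0 / 2 * gag u - lam * W \<le> J lam u"
proof -
  have "lam * embed_const \<le> c0 * b0 / 2"
    using lam embed_const by (simp add: lam_star_def field_simps)
  then have "lam * embed_const * gag u \<le> c0 * b0 / 2 * gag u"
    by (intro mult_right_mono gag_nonneg)
  moreover have "lam * pot u \<le> lam * (W + embed_const * gag u)"
    using adm_pot_integrable(2)[OF u] lam by (intro mult_left_mono) auto
  ultimately show ?thesis
    using energy_bounds(1)[OF u] by (simp add: J_def algebra_simps)
qed

text \<open>Fatou's lemma is applied to the \<open>ennreal\<close> integrals, since the Bochner
  integral \<open>energy v\<close> carries information only once integrability is known. The lower
  bound for the integrand then gives finite Gagliardo energy of v, and only afterwards is the bound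
  read as one for \<open>energy v\<close>.\<close>

lemma energy_LIMSEQ_Fatou:
  assumes u: "\<And>n. adm (u n)" and lim: "(\<lambda>n. energy (u n)) \<longlonglongrightarrow> e"
    and v: "v \<in> borel_measurable borel" "\<And>x. x \<notin> \<Omega> \<Longrightarrow> v x = 0"
    and ae: "AE x in lborel. (\<lambda>n. u n x) \<longlonglongrightarrow> v x"
  shows "adm v" "energy v \<le> e"
proof -
  note [measurable] = adm_measurable[OF u] v(1)
  let ?F = "\<lambda>u z. \<Phi> (u (fst z) - u (snd z)) * K z"
  have F0: "0 \<le> ?F u z" for u z by (intro mult_nonneg_nonneg \<Phi>_nonneg K_nonneg)
  have nn: "(\<integral>\<^sup>+ z. ennreal (?F u z) \<partial>lborel) = ennreal (energy u)" if "adm u" for u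
    unfolding energy_def using energy_integrable[OF that] F0 by (intro nn_integral_eq_integral) auto
  have e0: "0 \<le> e"
  proof (rule LIMSEQ_le_const[OF lim], intro exI allI impI)
    show "0 \<le> energy (u n)" for n unfolding energy_def by (intro Bochner_Integration.integral_nonneg F0)
  qed
  have "(\<integral>\<^sup>+ z. ennreal (?F v z) \<partial>lborel) \<le> (\<integral>\<^sup>+ z. liminf (\<lambda>n. ennreal (?F (u n) z)) \<partial>lborel)"
  proof (rule nn_integral_mono_AE)
    show "AE z in lborel. ennreal (?F v z) \<le> liminf (\<lambda>n. ennreal (?F (u n) z))"
      using AE_lborel_fst_snd[OF ae]
    proof eventually_elim
      case (elim z)
      have "(\<lambda>n. u n (fst z) - u n (snd z)) \<longlonglongrightarrow> v (fst z) - v (snd z)"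
        using elim by (intro tendsto_diff) auto
      then have "(\<lambda>n. \<Phi> (u n (fst z) - u n (snd z))) \<longlonglongrightarrow> \<Phi> (v (fst z) - v (snd z))"
        by (rule isCont_tendsto_compose[OF DERIV_isCont[OF \<Phi>_deriv]])
      then have "(\<lambda>n. ennreal (?F (u n) z)) \<longlonglongrightarrow> ennreal (?F v z)"
        by (intro tendsto_ennrealI tendsto_mult tendsto_const)
      from lim_imp_Liminf[OF sequentially_bot this] show ?case by (rule eq_refl[OF sym])
    qed
  qed
  also have "\<dots> \<le> liminf (\<lambda>n. \<integral>\<^sup>+ z. ennreal (?F (u n) z) \<partial>lborel)"
    by (intro nn_integral_liminf) measurable
  also have "\<dots> = liminf (\<lambda>n. ennreal (energy (u n)))"
    by (simp only: nn u)
  also have "\<dots> = ennreal e"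
    by (intro lim_imp_Liminf tendsto_ennrealI lim) simp
  finally have le: "(\<integral>\<^sup>+ z. ennreal (?F v z) \<partial>lborel) \<le> ennreal e" .
  have "ennreal (c0 * b0) * gagliardo s P v = (\<integral>\<^sup>+ z. ennreal (c0 * b0 * (\<bar>v (fst z) - v (snd z)\<bar> powr P * \<kappa> z)) \<partial>lborel)"
    using consts_pos by (simp add: gagliardo_pair nn_integral_cmult[symmetric] ennreal_mult[symmetric])
  also have "\<dots> \<le> (\<integral>\<^sup>+ z. ennreal (?F v z) \<partial>lborel)"
    by (intro nn_integral_mono ennreal_leI energy_integrand_bounds)
  finally have "ennreal (c0 * b0) * gagliardo s P v < top"
    using le by (meson ennreal_less_top le_less_trans)
  then have "gagliardo s P v < \<infinity>"
    using consts_pos by (auto simp: ennreal_mult_less_top)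
  then show "adm v" using v by (simp add: adm_def)
  then show "energy v \<le> e" using le nn[of v] e0 by simp
qed

lemma J_minimiser:
  assumes lam: "0 < lam" "lam < lam_star"
  obtains v where "adm v" "\<And>u. adm u \<Longrightarrow> J lam v \<le> J lam u"
proof -
  define I where "I = Inf (J lam ` {u. adm u})"
  have "adm (\<lambda>x. 0)" by (simp add: adm_def gagliardo_def)
  then have ne: "J lam ` {u. adm u} \<noteq> {}" by auto
  have lower: "- (lam * W) \<le> J lam u" if "adm u" for u
  proof -
    have "0 \<le> c0 * b0 / 2 * gag u" using consts_pos gag_nonneg by simp
    then show ?thesis using J_coercive[OF that lam] by simp
  qed
  have bdd: "bdd_below (J lam ` {u. adm u})"
    by (rule bdd_belowI2[of _ "- (lam * W)"]) (use lower in auto)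
  have I_le: "I \<le> J lam u" if "adm u" for u
    unfolding I_def using bdd that by (intro cInf_lower) auto
  have "\<exists>u. adm u \<and> J lam u < I + 1 / real (Suc n)" for n
    using cInf_lessD[OF ne, of "I + 1 / real (Suc n)"] unfolding I_def by auto
  then obtain u where u: "\<And>n. adm (u n)" "\<And>n. J lam (u n) < I + 1 / real (Suc n)"
    by metis
  have limJ: "(\<lambda>n. J lam (u n)) \<longlonglongrightarrow> I"
  proof (rule tendsto_sandwich[of "\<lambda>n. I" _ _ "\<lambda>n. I + 1 / real (Suc n)"])
    show "(\<lambda>n. I + 1 / real (Suc n)) \<longlonglongrightarrow> I"
      using tendsto_add[OF tendsto_const LIMSEQ_inverse_real_of_nat, of I] by (simp add: inverse_eq_divide)
  qed (use I_le u in \<open>auto intro!: always_eventually less_imp_le\<close>)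
  \<comment> \<open>B is the coercivity estimate solved for \<open>gag\<close> at the level I + 1,
    which no member of the minimising sequence exceeds.\<close>
  define B where "B = (I + 1 + lam * W) / (c0 * b0 / 2)"
  have gB: "gag (u n) \<le> B" for n
  proof -
    have "J lam (u n) \<le> I + 1"
    proof -
      have "1 / real (Suc n) \<le> 1" by simp
      then show ?thesis using u(2)[of n] by linarith
    qed
    then have "gag (u n) * (c0 * b0 / 2) \<le> I + 1 + lam * W"
      using J_coercive[OF u(1) lam, of n] by (simp add: mult.commute)
    then show ?thesis unfolding B_def using consts_pos by (subst pos_le_divide_eq) auto
  qed
  have B0: "0 \<le> B" using gB[of 0] gag_nonneg[of "u 0"] by simp
  have GB: "gagliardo s P (u n) \<le> ennreal B" for n
    using gB[of n] gagliardo_eq_gag[OF u(1), of n] by (simp add: ennreal_leI)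
  obtain \<phi> v where \<phi>: "strict_mono (\<phi> :: nat \<Rightarrow> nat)" and v: "v \<in> borel_measurable borel" "\<And>x. x \<notin> \<Omega> \<Longrightarrow> v x = 0"
    and ae: "AE x in lborel. (\<lambda>n. u (\<phi> n) x) \<longlonglongrightarrow> v x"
    and lp: "(\<lambda>n. \<integral>\<^sup>+ x. ennreal (\<bar>u (\<phi> n) x - v x\<bar> powr P) \<partial>\<mu>) \<longlonglongrightarrow> 0"
    by (rule adm_compact[OF u(1) GB B0], rule that) simp_all
  have Lp: "(\<integral>\<^sup>+ x. ennreal (\<bar>u (\<phi> n) x\<bar> powr P) \<partial>\<mu>) \<le> ennreal (embed_const * B)" for n
    by (rule order_trans[OF adm_Lp_\<mu>[OF u(1)]], intro ennreal_leI mult_left_mono gB) (use embed_const in simp)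
  have "0 \<le> embed_const * B" using embed_const B0 by simp
  then have limpot: "(\<lambda>n. pot (u (\<phi> n))) \<longlonglongrightarrow> pot v"
    using pot_LIMSEQ(1)[OF adm_measurable[OF u(1)] v(1) Lp _ lp] by simp
  have "(\<lambda>n. J lam (u (\<phi> n))) \<longlonglongrightarrow> I"
    using LIMSEQ_subseq_LIMSEQ[OF limJ \<phi>] by (simp add: o_def)
  \<comment> \<open>Convergence of J and of the potential forces the energies to converge to I + lam
    * pot v, which supplies the limit e of the Fatou step.\<close>
  then have "(\<lambda>n. J lam (u (\<phi> n)) + lam * pot (u (\<phi> n))) \<longlonglongrightarrow> I + lam * pot v"
    by (intro tendsto_intros limpot)
  then have lime: "(\<lambda>n. energy (u (\<phi> n))) \<longlonglongrightarrow> I + lam * pot v"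
    by (simp add: J_def)
  have "adm v" "energy v \<le> I + lam * pot v"
    using energy_LIMSEQ_Fatou[OF u(1) lime v ae] by auto
  then have "J lam v \<le> I" by (simp add: J_def)
  then show thesis using that[of v] \<open>adm v\<close> I_le by (meson order_trans)
qed

section \<open>First variations and the Euler-Lagrange equation\<close>

lemma energy_variation:
  assumes v: "adm v" and h: "adm h"
  shows "integrable lborel (\<lambda>z. A (v (fst z) - v (snd z)) * (h (fst z) - h (snd z)) * K z)"
    and "(\<lambda>n. (energy (\<lambda>x. v x + 1 / real (Suc n) * h x) - energy v) / (1 / real (Suc n)))
      \<longlonglongrightarrow> (\<integral>z. A (v (fst z) - v (snd z)) * (h (fst z) - h (snd z)) * K z \<partial>lborel)"
proof -
  note [measurable] = adm_measurable[OF v] adm_measurable[OF h]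
  define \<alpha> where "\<alpha> z = v (fst z) - v (snd z)" for z
  define \<beta> where "\<beta> z = h (fst z) - h (snd z)" for z
  define F where "F z t = \<Phi> (\<alpha> z + t * \<beta> z) * K z" for z t
  define F' where "F' z t = A (\<alpha> z + t * \<beta> z) * \<beta> z * K z" for z t
  \<comment> \<open>For 0 <= t <= 1 the argument of A is at most |\<alpha>| + |\<beta>| in modulus.
    Bounding the factor |\<beta>| by the same sum gives its full P-th power, which splits into two
    integrable kernel terms.\<close>
  define D where "D z = C1 * b1 * 2 powr P * (\<bar>\<alpha> z\<bar> powr P * \<kappa> z + \<bar>\<beta> z\<bar> powr P * \<kappa> z)" for z
  have [measurable]: "\<alpha> \<in> borel_measurable lborel" "\<beta> \<in> borel_measurable lborel"
    unfolding \<alpha>_def[abs_def] \<beta>_def[abs_def] by measurable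
  have deriv: "(F z has_real_derivative F' z t) (at t)" for z t
  proof -
    have "((\<lambda>t. \<alpha> z + t * \<beta> z) has_real_derivative \<beta> z) (at t)"
      by (auto intro!: derivative_eq_intros)
    from DERIV_cmult_right[OF DERIV_chain2[OF \<Phi>_deriv this], of "K z"]
    show ?thesis unfolding F_def[abs_def] F'_def .
  qed
  have bound: "\<bar>F' z t\<bar> \<le> D z" if t: "0 \<le> t" "t \<le> 1" for z t
  proof -
    let ?r = "\<bar>\<alpha> z\<bar> + \<bar>\<beta> z\<bar>"
    have tb: "\<bar>t * \<beta> z\<bar> \<le> \<bar>\<beta> z\<bar>"
      using t by (simp add: abs_mult mult_left_le_one_le)
    have "\<bar>A (\<alpha> z + t * \<beta> z)\<bar> \<le> C1 * \<bar>\<alpha> z + t * \<beta> z\<bar> powr (P - 1)" by (rule A_bound)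
    also have "\<dots> \<le> C1 * ?r powr (P - 1)"
      using consts_pos P tb by (intro mult_left_mono powr_mono2) auto
    finally have "\<bar>F' z t\<bar> \<le> C1 * ?r powr (P - 1) * ?r * (b1 * \<kappa> z)"
      unfolding F'_def abs_mult using K_upper[of z] K_nonneg[of z] consts_pos
      by (intro mult_mono) auto
    also have "\<dots> = C1 * b1 * ?r powr P * \<kappa> z"
      using powr_mult_base[of ?r "P - 1"] by (simp add: mult_ac)
    also have "\<dots> \<le> C1 * b1 * (2 powr P * (\<bar>\<alpha> z\<bar> powr P + \<bar>\<beta> z\<bar> powr P)) * \<kappa> z"
      using consts_pos P by (intro mult_right_mono mult_left_mono powr_add_le) auto
    also have "\<dots> = D z" by (simp add: D_def algebra_simps add_divide_distrib)
    finally show ?thesis .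
  qed
  have D: "integrable lborel D"
    unfolding D_def[abs_def] \<alpha>_def \<beta>_def
    by (intro integrable_mult_right Bochner_Integration.integrable_add powr_kernel_integrable v h)
  have Feq: "F z t = \<Phi> ((v (fst z) + t * h (fst z)) - (v (snd z) + t * h (snd z))) * K z" for z t
    by (simp add: F_def \<alpha>_def \<beta>_def algebra_simps)
  have vth: "adm (\<lambda>x. v x + t * h x)" for t
    using adm_lincomb[OF v h, of 1 t] by simp
  have F: "integrable lborel (\<lambda>z. F z t)" for t
    unfolding Feq by (rule energy_integrable[OF vth])
  have F'_meas: "(\<lambda>z. F' z 0) \<in> borel_measurable lborel"
    unfolding F'_def by measurable
  have Fen: "(\<integral>z. F z t \<partial>lborel) = energy (\<lambda>x. v x + t * h x)" for t
    unfolding energy_def Feq ..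
  have F'0: "F' z 0 = A (v (fst z) - v (snd z)) * (h (fst z) - h (snd z)) * K z" for z
    by (simp add: F'_def \<alpha>_def \<beta>_def)
  note * = LIMSEQ_integral_difference_quotient[where F = F, OF deriv bound D F F'_meas]
  show "integrable lborel (\<lambda>z. A (v (fst z) - v (snd z)) * (h (fst z) - h (snd z)) * K z)"
    using *(1) unfolding F'0 by simp
  show "(\<lambda>n. (energy (\<lambda>x. v x + 1 / real (Suc n) * h x) - energy v) / (1 / real (Suc n)))
      \<longlonglongrightarrow> (\<integral>z. A (v (fst z) - v (snd z)) * (h (fst z) - h (snd z)) * K z \<partial>lborel)"
    using *(2) unfolding F'0 Fen by simp
qed

lemma pot_variation:
  assumes v: "adm v" and h: "adm h"
  shows "integrable lborel (\<lambda>x. a x * \<bar>v x\<bar> powr (m x - 2) * v x * h x)"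
    and "(\<lambda>n. (pot (\<lambda>x. v x + 1 / real (Suc n) * h x) - pot v) / (1 / real (Suc n)))
      \<longlonglongrightarrow> (\<integral>x. a x * \<bar>v x\<bar> powr (m x - 2) * v x * h x \<partial>lborel)"
proof -
  note [measurable] = adm_measurable[OF v] adm_measurable[OF h]
  define F where "F x t = a x * (\<bar>v x + t * h x\<bar> powr m x / m x)" for x t
  define F' where "F' x t = a x * (\<bar>v x + t * h x\<bar> powr (m x - 2) * (v x + t * h x) * h x)" for x t
  define D where "D x = 2 powr P * (\<bar>a x\<bar> + 2 powr P * (\<bar>a x\<bar> * \<bar>v x\<bar> powr P + \<bar>a x\<bar> * \<bar>h x\<bar> powr P))" for x
  have deriv: "(F x has_real_derivative F' x t) (at t)" for x t
  proof -
    have "((\<lambda>t. v x + t * h x) has_real_derivative h x) (at t)"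
      by (auto intro!: derivative_eq_intros)
    from DERIV_cmult[OF DERIV_chain2[OF has_real_derivative_abs_powr[OF m_bounds(1)] this], of "a x" x]
    show ?thesis unfolding F_def[abs_def] F'_def .
  qed
  have bound: "\<bar>F' x t\<bar> \<le> D x" if t: "0 \<le> t" "t \<le> 1" for x t
  proof -
    let ?r = "\<bar>v x\<bar> + \<bar>h x\<bar>"
    have tb: "\<bar>t * h x\<bar> \<le> \<bar>h x\<bar>"
      using t by (simp add: abs_mult mult_left_le_one_le)
    have "\<bar>\<bar>v x + t * h x\<bar> powr (m x - 2) * (v x + t * h x)\<bar> \<le> (1 + ?r) powr (P - 1)"
      using tb by (intro abs_powr_mult_self_le m_bounds m_le_P) auto
    then have "\<bar>F' x t\<bar> \<le> \<bar>a x\<bar> * ((1 + ?r) powr (P - 1) * (1 + ?r))"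
      unfolding F'_def abs_mult[of "a x"] abs_mult[of _ "h x"]
      by (intro mult_left_mono mult_mono) auto
    also have "(1 + ?r) powr (P - 1) * (1 + ?r) = (1 + ?r) powr P"
      using powr_mult_base[of "1 + ?r" "P - 1"] by (simp add: mult.commute)
    also have "\<bar>a x\<bar> * (1 + ?r) powr P \<le> \<bar>a x\<bar> * (2 powr P * (1 + 2 powr P * (\<bar>v x\<bar> powr P + \<bar>h x\<bar> powr P)))"
      by (intro mult_left_mono one_plus_powr_le) auto
    also have "\<dots> = D x" by (simp add: D_def algebra_simps)
    finally show ?thesis .
  qed
  have Lp: "integrable lborel (\<lambda>x. \<bar>a x\<bar> * \<bar>u x\<bar> powr P)" if "adm u" for u
    using a_powr_integrable(1)[OF adm_measurable[OF that] adm_Lp_\<mu>[OF that]] embed_const gag_nonneg[of u] by auto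
  have D: "integrable lborel D"
    unfolding D_def[abs_def]
    by (intro integrable_mult_right Bochner_Integration.integrable_add a_integrable Lp v h)
  have vth: "adm (\<lambda>x. v x + t * h x)" for t
    using adm_lincomb[OF v h, of 1 t] by simp
  have F: "integrable lborel (\<lambda>x. F x t)" for t
    unfolding F_def by (rule adm_pot_integrable(1)[OF vth])
  have F'_meas: "(\<lambda>x. F' x 0) \<in> borel_measurable lborel"
    unfolding F'_def by measurable
  have Fen: "(\<integral>x. F x t \<partial>lborel) = pot (\<lambda>x. v x + t * h x)" for t
    unfolding pot_def F_def ..
  have F'0: "F' x 0 = a x * \<bar>v x\<bar> powr (m x - 2) * v x * h x" for x
    by (simp add: F'_def mult.assoc)
  note * = LIMSEQ_integral_difference_quotient[where F = F, OF deriv bound D F F'_meas]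
  show "integrable lborel (\<lambda>x. a x * \<bar>v x\<bar> powr (m x - 2) * v x * h x)"
    using *(1) unfolding F'0 by simp
  show "(\<lambda>n. (pot (\<lambda>x. v x + 1 / real (Suc n) * h x) - pot v) / (1 / real (Suc n)))
      \<longlonglongrightarrow> (\<integral>x. a x * \<bar>v x\<bar> powr (m x - 2) * v x * h x \<partial>lborel)"
    using *(2) unfolding F'0 Fen by simp
qed

text \<open>Minimality gives nonnegative quotients for positive steps, hence L h >= 0 for every
  admissible h. Since L is odd in h, testing with -h forces equality.\<close>

lemma euler_lagrange:
  assumes v: "adm v" and min: "\<And>u. adm u \<Longrightarrow> J lam v \<le> J lam u" and h: "adm h"
  shows "(\<integral>z. A (v (fst z) - v (snd z)) * (h (fst z) - h (snd z)) * K z \<partial>lborel) =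
    lam * (\<integral>x. a x * \<bar>v x\<bar> powr (m x - 2) * v x * h x \<partial>lborel)"
proof -
  define L where "L h = (\<integral>z. A (v (fst z) - v (snd z)) * (h (fst z) - h (snd z)) * K z \<partial>lborel) -
    lam * (\<integral>x. a x * \<bar>v x\<bar> powr (m x - 2) * v x * h x \<partial>lborel)" for h
  have L: "0 \<le> L h" if h: "adm h" for h
  proof -
    let ?t = "\<lambda>n. 1 / real (Suc n)"
    have "(\<lambda>n. (energy (\<lambda>x. v x + ?t n * h x) - energy v) / ?t n -
        lam * ((pot (\<lambda>x. v x + ?t n * h x) - pot v) / ?t n)) \<longlonglongrightarrow> L h"
      unfolding L_def by (intro tendsto_diff tendsto_mult tendsto_const energy_variation(2) pot_variation(2) v h)
    moreover have "0 \<le> (energy (\<lambda>x. v x + ?t n * h x) - energy v) / ?t n -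
        lam * ((pot (\<lambda>x. v x + ?t n * h x) - pot v) / ?t n)" for n
    proof -
      have "J lam v \<le> J lam (\<lambda>x. v x + ?t n * h x)"
        using adm_lincomb[OF v h, of 1 "?t n"] by (intro min) simp
      then have "0 \<le> (J lam (\<lambda>x. v x + ?t n * h x) - J lam v) / ?t n"
        by (intro divide_nonneg_nonneg) auto
      then show ?thesis by (simp add: J_def diff_divide_distrib algebra_simps)
    qed
    ultimately show ?thesis by (intro LIMSEQ_le_const) auto
  qed
  have "adm (\<lambda>x. - h x)" using adm_lincomb[OF h h, of "- 1" 0] by simp
  then have "0 \<le> L (\<lambda>x. - h x)" by (rule L)
  moreover have "L (\<lambda>x. - h x) = - L h"
  proof -
    have *: "A (v (fst z) - v (snd z)) * (- h (fst z) - - h (snd z)) * K z =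
        - (A (v (fst z) - v (snd z)) * (h (fst z) - h (snd z)) * K z)" for z
      by (simp add: algebra_simps)
    show ?thesis unfolding L_def * by simp
  qed
  ultimately have "L h = 0" using L[OF h] by simp
  then show ?thesis by (simp add: L_def)
qed

text \<open>If v were 0 almost everywhere, the minimum would be nonnegative. Comparison with t h,
  whose energy is at most t^P E and whose potential is at least t^m1 \<open>pot h\<close>, gives lam
  * pot h <= t^(P - m1) E for 0 < t <= 1; letting t tend to 0 contradicts \<open>pot h\<close> >
  0.\<close>

lemma minimiser_nontrivial:
  assumes h: "adm h" "\<And>x. h x \<noteq> 0 \<Longrightarrow> 0 \<le> a x" "0 < pot h" and lam: "0 < lam"
    and v: "adm v" and min: "\<And>u. adm u \<Longrightarrow> J lam v \<le> J lam u"
  shows "\<not> (AE x in lborel. v x = 0)"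
proof
  assume ae: "AE x in lborel. v x = 0"
  note [measurable] = adm_measurable[OF v] adm_measurable[OF h(1)]
  have "pot v = (\<integral>x. (0::real) \<partial>(lborel :: (real^'n) measure))"
    unfolding pot_def by (rule integral_cong_AE) (use ae in auto)
  moreover have "0 \<le> energy v" unfolding energy_def by (intro Bochner_Integration.integral_nonneg mult_nonneg_nonneg \<Phi>_nonneg K_nonneg)
  ultimately have J0: "0 \<le> J lam v" by (simp add: J_def)
  define E where "E = C1 * b1 * gag h"
  have E: "0 \<le> E" using consts_pos gag_nonneg by (simp add: E_def)
  have key: "lam * pot h \<le> t powr (P - m1) * E" if t: "0 < t" "t \<le> 1" for t
  proof -
    have th: "adm (\<lambda>x. t * h x)" using adm_lincomb[OF h(1) h(1), of t 0] by simp
    have "energy (\<lambda>x. t * h x) \<le> C1 * b1 * gag (\<lambda>x. t * h x)" by (rule energy_bounds[OF th])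
    also have "gag (\<lambda>x. t * h x) = t powr P * gag h"
    proof -
      have "gag (\<lambda>x. t * h x) = (\<integral>z. \<bar>t * h (fst z) - t * h (snd z)\<bar> powr P * \<kappa> z \<partial>lborel)"
        using powr_kernel_integrable(2)[OF th] by simp
      also have "\<dots> = (\<integral>z. t powr P * (\<bar>h (fst z) - h (snd z)\<bar> powr P * \<kappa> z) \<partial>lborel)"
        using t by (simp add: right_diff_distrib[symmetric] abs_mult powr_mult mult.assoc)
      also have "\<dots> = t powr P * gag h"
        by (simp only: integral_mult_right_zero powr_kernel_integrable(2)[OF h(1)])
      finally show ?thesis .
    qed
    finally have en: "energy (\<lambda>x. t * h x) \<le> t powr P * E" by (simp add: E_def mult_ac)
    have "t powr m1 * pot h = (\<integral>x. t powr m1 * (a x * (\<bar>h x\<bar> powr m x / m x)) \<partial>lborel)"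
      unfolding pot_def by (rule integral_mult_right_zero[symmetric])
    also have "\<dots> \<le> pot (\<lambda>x. t * h x)"
      unfolding pot_def
    proof (intro integral_mono integrable_mult_right adm_pot_integrable th h)
      fix x
      \<comment> \<open>For t <= 1 the largest exponent gives the smallest power. It may replace
        t^(m x) under the integral because a is nonnegative wherever h does not vanish.\<close>
      have "t powr m1 \<le> t powr m x" using t m_bounds(2)[of x] by (intro powr_mono') auto
      moreover have "0 \<le> a x * (\<bar>h x\<bar> powr m x / m x)"
        using h(2)[of x] m_bounds(1)[of x] by (cases "h x = 0") auto
      ultimately have "t powr m1 * (a x * (\<bar>h x\<bar> powr m x / m x)) \<le> t powr m x * (a x * (\<bar>h x\<bar> powr m x / m x))"
        by (intro mult_right_mono) auto
      then show "t powr m1 * (a x * (\<bar>h x\<bar> powr m x / m x)) \<le> a x * (\<bar>t * h x\<bar> powr m x / m x)"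
        using t by (simp add: abs_mult powr_mult mult_ac)
    qed
    finally have "lam * (t powr m1 * pot h) \<le> lam * pot (\<lambda>x. t * h x)"
      using lam by (intro mult_left_mono) auto
    then have "lam * (t powr m1 * pot h) \<le> t powr P * E"
      using min[OF th] J0 en by (simp add: J_def)
    then have "lam * (t powr m1 * pot h) / t powr m1 \<le> t powr P * E / t powr m1"
      by (intro divide_right_mono) auto
    then show ?thesis using t by (simp add: powr_diff)
  qed
  have "(\<lambda>n. (1 / real (Suc n)) powr (P - m1) * E) \<longlonglongrightarrow> 0 * E"
    using m_bounds(3) LIMSEQ_inverse_real_of_nat
    by (intro tendsto_mult tendsto_const tendsto_zero_powrI[where b = "P - m1"]) (auto simp: inverse_eq_divide)
  then have "lam * pot h \<le> 0 * E"
    by (rule LIMSEQ_le_const) (auto intro!: key)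
  then show False using lam h(3) by (simp add: mult_le_0_iff)
qed

end

section \<open>Finite energy of a tent function\<close>

text \<open>The majorant of the energy kernel for bounded Lipschitz functions: min 1 |z| combines
  the Lipschitz bound at short range with the sup bound at long range.\<close>

definition truncated_kernel :: "real \<Rightarrow> real \<Rightarrow> real^'n \<Rightarrow> real" where
  "truncated_kernel s P z = min 1 (norm z) powr P / norm z powr (real CARD('n) + s * P)"

lemma borel_measurable_truncated_kernel [measurable]: "truncated_kernel s P \<in> borel_measurable borel"
  unfolding truncated_kernel_def[abs_def] by measurable

lemma suminf_ennreal_geometric_finite:
  assumes "0 \<le> c" "0 < q" "q < 1"
  shows "(\<Sum>j. ennreal (c * q ^ j)) < \<infinity>"
proof -
  have "(\<Sum>j. ennreal (c * q ^ j) * 1) = ennreal (c / (1 - q)) * 1"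
    using assms by (intro suminf_cmult_geometric_ennreal) auto
  then have "(\<Sum>j. ennreal (c * q ^ j)) = ennreal (c / (1 - q))" by (simp only: mult_1_right)
  then show ?thesis by (simp only: ennreal_less_top infinity_ennreal_def)
qed

text \<open>Dyadic balls are used on both sides of the unit sphere. The contributions form geometric
  series with ratios 2^(-P(1-s)) towards the origin and 2^(-sP) towards infinity.\<close>

lemma nn_integral_truncated_kernel_finite:
  assumes s: "0 < s" "s < 1" and P: "1 < P"
  shows "(\<integral>\<^sup>+ z. ennreal (truncated_kernel s P (z::real^'n)) \<partial>lborel) < \<infinity>"
proof -
  let ?N = "real CARD('n)"
  define b where "b = ?N + s * P"
  have b: "0 < b" using s P by (simp add: b_def add_pos_pos)
  define V where "V = unit_ball_vol ?N"
  have V: "0 \<le> V" by (simp add: V_def)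
  have ball: "emeasure lborel (cball (0::real^'n) (2 powr t)) = ennreal (V * 2 powr (t * ?N))" for t
  proof -
    have "(2 powr t) ^ CARD('n) = (2::real) powr (t * ?N)"
      by (simp only: powr_powr[symmetric] powr_realpow powr_gt_zero)
    then show ?thesis by (simp only: emeasure_cball powr_ge_zero V_def DIM_cart DIM_real mult_1_right)
  qed
  \<comment> \<open>For 2^(-j-1) < |z| <= 2^(-j) the numerator is at most 2^(-jP) and the reciprocal
    of the denominator at most 2^((j+1)b), whence the extra 2^b. The full ball replaces the shell at
    the cost of a constant.\<close>
  define f where "f j z = ennreal (2 powr (b + real j * (b - P))) * indicator (cball 0 (2 powr (- real j))) z" for j and z :: "real^'n"
  define g where "g j z = ennreal (2 powr (- real j * b)) * indicator (cball 0 (2 powr (real j + 1))) z" for j and z :: "real^'n"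
  have [measurable]: "f j \<in> borel_measurable lborel" "g j \<in> borel_measurable lborel" for j
    unfolding f_def g_def by (intro borel_measurable_times_ennreal borel_measurable_const borel_measurable_indicator; simp)+
  have pt: "ennreal (truncated_kernel s P z) \<le> (\<Sum>j. f j z) + (\<Sum>j. g j z)" for z :: "real^'n"
  proof (cases "z = 0")
    case True
    then show ?thesis by (simp add: truncated_kernel_def)
  next
    case False
    define r where "r = norm z"
    have r: "0 < r" using False by (simp add: r_def)
    define y where "y = log 2 r"
    have ry: "r = 2 powr y" using r by (simp add: y_def)
    show ?thesis
    proof (cases "r \<le> 1")
      case True
      then have y0: "y \<le> 0" using r by (simp add: y_def)
      define j where "j = nat \<lfloor>- y\<rfloor>"
      have j: "real j \<le> - y" "- y < real j + 1" using y0 by (auto simp: j_def)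
      have "truncated_kernel s P z = r powr P / r powr b"
        using True by (simp add: truncated_kernel_def b_def r_def)
      also have "\<dots> = 2 powr (y * P - y * b)"
        unfolding ry by (simp add: powr_powr powr_diff)
      also have "\<dots> \<le> 2 powr (b + real j * (b - P))"
      proof (rule powr_mono)
        have "y * P \<le> - real j * P" using j P by (intro mult_right_mono) auto
        moreover have "- y * b \<le> (real j + 1) * b" using j b by (intro mult_right_mono) auto
        ultimately show "y * P - y * b \<le> b + real j * (b - P)" by (simp add: algebra_simps)
      qed simp
      finally have "ennreal (truncated_kernel s P z) \<le> ennreal (2 powr (b + real j * (b - P)))"
        by (rule ennreal_leI)
      moreover have "z \<in> cball 0 (2 powr (- real j))"
        using j ry by (simp add: r_def)
      ultimately have "ennreal (truncated_kernel s P z) \<le> f j z" by (simp add: f_def)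
      also have "\<dots> \<le> (\<Sum>j. f j z)" using sum_le_suminf[OF summableI, of "{j}" "\<lambda>j. f j z"] by simp
      finally show ?thesis by (rule order_trans) simp
    next
      case False
      then have y0: "0 \<le> y" using r by (simp add: y_def)
      define j where "j = nat \<lfloor>y\<rfloor>"
      have j: "real j \<le> y" "y < real j + 1" using y0 by (auto simp: j_def)
      have "truncated_kernel s P z = 1 / r powr b"
        using False by (simp add: truncated_kernel_def b_def r_def)
      also have "\<dots> = 2 powr (- y * b)"
        unfolding ry by (simp add: powr_powr powr_minus_divide)
      also have "\<dots> \<le> 2 powr (- real j * b)"
        using j b by (intro powr_mono mult_right_mono) auto
      finally have "ennreal (truncated_kernel s P z) \<le> ennreal (2 powr (- real j * b))"
        by (rule ennreal_leI)
      moreover have "z \<in> cball 0 (2 powr (real j + 1))"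
        using j ry by (simp add: r_def)
      ultimately have "ennreal (truncated_kernel s P z) \<le> g j z" by (simp add: g_def)
      also have "\<dots> \<le> (\<Sum>j. g j z)" using sum_le_suminf[OF summableI, of "{j}" "\<lambda>j. g j z"] by simp
      finally show ?thesis by (rule order_trans) simp
    qed
  qed
  have "(\<integral>\<^sup>+ z. ennreal (truncated_kernel s P (z::real^'n)) \<partial>lborel) \<le> (\<integral>\<^sup>+ z. (\<Sum>j. f j z) + (\<Sum>j. g j z) \<partial>lborel)"
    by (intro nn_integral_mono pt)
  also have "\<dots> = (\<Sum>j. \<integral>\<^sup>+ z. f j z \<partial>lborel) + (\<Sum>j. \<integral>\<^sup>+ z. g j z \<partial>lborel)"
    by (simp add: nn_integral_add nn_integral_suminf)
  also have "(\<lambda>j. \<integral>\<^sup>+ z. f j z \<partial>lborel) = (\<lambda>j. ennreal (2 powr b * V * (2 powr (- (P * (1 - s)))) ^ j))"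
  proof
    fix j
    have "(\<integral>\<^sup>+ z. f j z \<partial>lborel) = ennreal (2 powr (b + real j * (b - P)) * (V * 2 powr (- real j * ?N)))"
      unfolding f_def using V by (subst nn_integral_cmult_indicator) (auto simp: ball ennreal_mult)
    also have "2 powr (b + real j * (b - P)) * (V * 2 powr (- real j * ?N)) = 2 powr b * V * 2 powr (- (P * (1 - s)) * real j)"
    proof -
      have "2 powr (b + real j * (b - P)) * 2 powr (- real j * ?N) = (2::real) powr b * 2 powr (- (P * (1 - s)) * real j)"
        unfolding powr_add[symmetric] by (rule arg_cong[where f = "\<lambda>t. 2 powr t"]) (simp add: b_def algebra_simps)
      then show ?thesis by (simp add: mult_ac)
    qed
    also have "2 powr (- (P * (1 - s)) * real j) = (2 powr (- (P * (1 - s)))) ^ j"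
      by (simp only: powr_powr[symmetric] powr_realpow powr_gt_zero)
    finally show "(\<integral>\<^sup>+ z. f j z \<partial>lborel) = ennreal (2 powr b * V * (2 powr (- (P * (1 - s)))) ^ j)" .
  qed
  also have "(\<lambda>j. \<integral>\<^sup>+ z. g j z \<partial>lborel) = (\<lambda>j. ennreal (2 powr ?N * V * (2 powr (- (s * P))) ^ j))"
  proof
    fix j
    have "(\<integral>\<^sup>+ z. g j z \<partial>lborel) = ennreal (2 powr (- real j * b) * (V * 2 powr ((real j + 1) * ?N)))"
      unfolding g_def using V by (subst nn_integral_cmult_indicator) (auto simp: ball ennreal_mult)
    also have "2 powr (- real j * b) * (V * 2 powr ((real j + 1) * ?N)) = 2 powr ?N * V * 2 powr (- (s * P) * real j)"
    proof -
      have "2 powr (- real j * b) * 2 powr ((real j + 1) * ?N) = (2::real) powr ?N * 2 powr (- (s * P) * real j)"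
        unfolding powr_add[symmetric] by (rule arg_cong[where f = "\<lambda>t. 2 powr t"]) (simp add: b_def algebra_simps)
      then show ?thesis by (simp add: mult_ac)
    qed
    also have "2 powr (- (s * P) * real j) = (2 powr (- (s * P))) ^ j"
      by (simp only: powr_powr[symmetric] powr_realpow powr_gt_zero)
    finally show "(\<integral>\<^sup>+ z. g j z \<partial>lborel) = ennreal (2 powr ?N * V * (2 powr (- (s * P))) ^ j)" .
  qed
  also have "(\<Sum>j. ennreal (2 powr b * V * (2 powr (- (P * (1 - s)))) ^ j)) + (\<Sum>j. ennreal (2 powr ?N * V * (2 powr (- (s * P))) ^ j)) < \<infinity>"
  proof -
    \<comment> \<open>The ratio at the origin is below 1 because s < 1, the one at infinity because
      s > 0.\<close>
    have "2 powr (- (P * (1 - s))) < (1::real)" "2 powr (- (s * P)) < (1::real)"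
      using s P powr_less_mono[of "- (P * (1 - s))" 0 2] powr_less_mono[of "- (s * P)" 0 2] by auto
    then have "(\<Sum>j. ennreal (2 powr b * V * (2 powr (- (P * (1 - s)))) ^ j)) < \<infinity>"
      "(\<Sum>j. ennreal (2 powr ?N * V * (2 powr (- (s * P))) ^ j)) < \<infinity>"
      using V by (auto intro!: suminf_ennreal_geometric_finite simp del: infinity_ennreal_def)
    then show ?thesis by simp
  qed
  finally show ?thesis .
qed

definition tent :: "real^'n \<Rightarrow> real \<Rightarrow> real^'n \<Rightarrow> real" where
  "tent x0 r x = max 0 (r - dist x0 x)"

lemma borel_measurable_tent [measurable]: "tent x0 r \<in> borel_measurable borel"
  unfolding tent_def[abs_def] by measurable

lemma tent_eq_0: "x \<notin> ball x0 r \<Longrightarrow> tent x0 r x = 0"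
  by (simp add: tent_def)

lemma tent_pos: "x \<in> ball x0 r \<Longrightarrow> 0 < tent x0 r x"
  by (simp add: tent_def)

text \<open>The tent is 1-Lipschitz with values in [0, r], so its differences are at most (1 + r)
  min 1 |x - y|. Pairs with both points outside the ball contribute nothing; for the others one
  variable ranges over B and the other integrates the truncated kernel by translation
  invariance.\<close>

lemma gagliardo_tent_finite:
  fixes x0 :: "real^'n"
  assumes s: "0 < s" "s < 1" and P: "1 < P" and r: "0 < r"
  shows "gagliardo s P (tent x0 r) < \<infinity>"
proof -
  define B where "B = ball x0 r"
  have [measurable]: "B \<in> sets borel" by (simp add: B_def)
  let ?u = "tent x0 r" and ?k = "truncated_kernel s P :: real^'n \<Rightarrow> real"
  define T where "T = (\<integral>\<^sup>+ z. ennreal (?k z) \<partial>lborel)"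
  have T: "T < \<infinity>" unfolding T_def by (rule nn_integral_truncated_kernel_finite[OF s P])
  have trans: "(\<integral>\<^sup>+ y. ennreal (?k (x - y)) \<partial>lborel) = T" for x
  proof -
    have "T = (\<integral>\<^sup>+ z. ennreal (?k z) \<partial>distr lborel borel ((+) (- x)))"
      unfolding T_def by (simp add: lborel_distr_plus)
    also have "\<dots> = (\<integral>\<^sup>+ y. ennreal (?k (- x + y)) \<partial>lborel)"
      by (subst nn_integral_distr) auto
    also have "\<dots> = (\<integral>\<^sup>+ y. ennreal (?k (x - y)) \<partial>lborel)"
      by (simp add: truncated_kernel_def norm_minus_commute)
    finally show ?thesis ..
  qed
  have pt: "ennreal (\<bar>?u x - ?u y\<bar> powr P / norm (x - y) powr (real CARD('n) + s * P)) \<le>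
      ennreal ((1 + r) powr P) * (indicator B x * ennreal (?k (x - y)) + indicator B y * ennreal (?k (y - x)))" for x y
  proof (cases "x \<in> B \<or> y \<in> B")
    case True
    have "\<bar>?u x - ?u y\<bar> \<le> norm (x - y)"
      using dist_triangle[of x0 x y] dist_triangle[of x0 y x] by (auto simp: tent_def dist_norm norm_minus_commute max_def)
    moreover have "\<bar>?u x - ?u y\<bar> \<le> r" using r zero_le_dist[of x0 x] zero_le_dist[of x0 y] unfolding tent_def by linarith
    ultimately have "\<bar>?u x - ?u y\<bar> \<le> (1 + r) * min 1 (norm (x - y))"
      using r by (auto simp: min_def algebra_simps add_increasing2)
    then have "\<bar>?u x - ?u y\<bar> powr P \<le> ((1 + r) * min 1 (norm (x - y))) powr P"
      using P by (intro powr_mono2) auto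
    also have "\<dots> = (1 + r) powr P * min 1 (norm (x - y)) powr P"
      using r by (simp add: powr_mult)
    finally have "\<bar>?u x - ?u y\<bar> powr P / norm (x - y) powr (real CARD('n) + s * P) \<le> (1 + r) powr P * ?k (x - y)"
      unfolding truncated_kernel_def times_divide_eq_right by (intro divide_right_mono) auto
    then have "ennreal (\<bar>?u x - ?u y\<bar> powr P / norm (x - y) powr (real CARD('n) + s * P)) \<le> ennreal ((1 + r) powr P) * ennreal (?k (x - y))"
      by (simp add: ennreal_mult'[symmetric] ennreal_leI)
    also have "ennreal (?k (x - y)) \<le> indicator B x * ennreal (?k (x - y)) + indicator B y * ennreal (?k (y - x))"
      using True by (auto simp: truncated_kernel_def norm_minus_commute indicator_def)
    finally show ?thesis by (simp add: mult_left_mono)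
  next
    case False
    then show ?thesis using P by (simp add: tent_eq_0 B_def)
  qed
  have "gagliardo s P ?u \<le> (\<integral>\<^sup>+ x. \<integral>\<^sup>+ y. ennreal ((1 + r) powr P) *
      (indicator B x * ennreal (?k (x - y)) + indicator B y * ennreal (?k (y - x))) \<partial>lborel \<partial>lborel)"
    unfolding gagliardo_def by (intro nn_integral_mono pt)
  also have "\<dots> = ennreal ((1 + r) powr P) * ((\<integral>\<^sup>+ x. \<integral>\<^sup>+ y. indicator B x * ennreal (?k (x - y)) \<partial>lborel \<partial>lborel) +
      (\<integral>\<^sup>+ x. \<integral>\<^sup>+ y. indicator B y * ennreal (?k (y - x)) \<partial>lborel \<partial>lborel))"
    by (simp add: nn_integral_cmult nn_integral_add)
  also have "(\<integral>\<^sup>+ x. \<integral>\<^sup>+ y. indicator B y * ennreal (?k (y - x)) \<partial>lborel \<partial>lborel) =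
      (\<integral>\<^sup>+ y. \<integral>\<^sup>+ x. indicator B y * ennreal (?k (y - x)) \<partial>lborel \<partial>lborel)"
    by (intro lborel_pair.Fubini'[symmetric]) measurable
  also have "(\<integral>\<^sup>+ x. \<integral>\<^sup>+ y. indicator B x * ennreal (?k (x - y)) \<partial>lborel \<partial>lborel) = emeasure lborel B * T"
    by (simp add: nn_integral_cmult trans nn_integral_multc)
  also have "ennreal ((1 + r) powr P) * (emeasure lborel B * T + emeasure lborel B * T) < \<infinity>"
    using T emeasure_lborel_ball_finite[of x0 r] by (simp add: B_def ennreal_mult_less_top)
  finally show ?thesis .
qed

section \<open>Reduction to Borel representatives and constant exponent\<close>

lemma exponent_le_of_powr_growth:
  fixes c C \<alpha> \<beta> :: real
  assumes c: "0 < c" "0 < C" and le: "\<And>t. 1 \<le> t \<Longrightarrow> c * t powr \<alpha> \<le> C * t powr \<beta>"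
  shows "\<alpha> \<le> \<beta>"
proof (rule ccontr)
  assume "\<not> \<alpha> \<le> \<beta>"
  then have d: "0 < \<alpha> - \<beta>" by simp
  \<comment> \<open>The witness satisfies t^(\<alpha> - \<beta>) = 1 + C / c, so the growth
    inequality would read c + C <= C.\<close>
  define t where "t = (1 + C / c) powr (1 / (\<alpha> - \<beta>))"
  have t1: "1 \<le> t" unfolding t_def using c d by (intro ge_one_powr_ge_zero) auto
  have "c * (t powr \<alpha> / t powr \<beta>) \<le> C"
    using le[OF t1] t1 by (simp add: field_simps)
  moreover have "t powr \<alpha> / t powr \<beta> = 1 + C / c"
  proof -
    have "t powr \<alpha> / t powr \<beta> = t powr (\<alpha> - \<beta>)" by (rule powr_diff[symmetric])
    also have "\<dots> = (1 + C / c) powr (1 / (\<alpha> - \<beta>) * (\<alpha> - \<beta>))"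
      unfolding t_def powr_powr ..
    also have "1 / (\<alpha> - \<beta>) * (\<alpha> - \<beta>) = 1" using d by simp
    finally show ?thesis using c by (simp add: add_pos_pos)
  qed
  moreover have "c * (1 + C / c) = c + C" using c by (simp add: field_simps)
  ultimately show False using c by simp
qed

text \<open>The modulus in the upper limit hides differentiability at 0. Since A is odd, its
  primitive G based at -c is even, so near t the function agrees with the smooth expression G - G
  0.\<close>

lemma primitive_abs_has_real_derivative:
  assumes cont: "continuous_on UNIV A" and odd: "\<And>t. A (- t) = - A t"
  shows "(primitive_abs A has_real_derivative A t) (at t)"
proof -
  define c where "c = \<bar>t\<bar> + 1"
  define G where "G x = integral {- c..x} A" for x
  have c: "0 < c" "t \<in> {- c<..<c}" by (auto simp: c_def)
  have contI: "continuous_on I A" for I using cont continuous_on_subset by blast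
  have G: "(G has_real_derivative A x) (at x)" if "x \<in> {- c<..<c}" for x
  proof -
    have "(G has_real_derivative A x) (at x within {- c..c})"
      unfolding G_def[abs_def] using that by (intro integral_has_real_derivative contI) auto
    then show ?thesis using that by (simp add: at_within_Icc_at)
  qed
  have even: "G (- x) = G x" if x: "x \<in> {- c<..<c}" for x
  proof -
    have "G x - G (- x) = G 0 - G (- 0)"
    proof (rule DERIV_isconst3[of "- c" c x 0 "\<lambda>x. G x - G (- x)"])
      fix y assume y: "y \<in> {- c<..<c}"
      have "((\<lambda>x. G (- x)) has_real_derivative A (- y) * (- 1)) (at y)"
        using y by (intro DERIV_chain2[where g = uminus, OF G]) (auto intro!: derivative_eq_intros)
      with G[OF y] show "((\<lambda>x. G x - G (- x)) has_real_derivative 0) (at y)"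
        using DERIV_diff[of G "A y" y UNIV "\<lambda>x. G (- x)" "A (- y) * (- 1)"] odd by simp
    qed (use c x in auto)
    then show ?thesis by simp
  qed
  have prim: "primitive_abs A x = G x - G 0" if x: "x \<in> {- c<..<c}" for x
  proof -
    have "integral {- c..0} A + integral {0..\<bar>x\<bar>} A = integral {- c..\<bar>x\<bar>} A"
      using x by (intro Henstock_Kurzweil_Integration.integral_combine integrable_continuous_interval contI) auto
    then have "primitive_abs A x = G \<bar>x\<bar> - G 0" by (simp add: primitive_abs_def G_def)
    also have "G \<bar>x\<bar> = G x" using even[OF x] by (simp add: abs_if)
    finally show ?thesis .
  qed
  have "((\<lambda>x. G x - G 0) has_real_derivative A t) (at t)"
    using DERIV_diff[OF G[OF c(2)] DERIV_const[of "G 0"]] by simp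
  moreover have "\<forall>\<^sub>F x in nhds t. primitive_abs A x = G x - G 0"
    by (rule eventually_mono[OF eventually_nhds_in_open[of "{- c<..<c}" t]]) (use prim c in auto)
  ultimately show ?thesis by (subst DERIV_cong_ev[OF refl _ refl]) auto
qed

lemma primitive_abs_le:
  assumes cont: "continuous_on UNIV A" and odd: "\<And>t. A (- t) = - A t"
    and bound: "\<And>t. \<bar>A t\<bar> \<le> C * \<bar>t\<bar> powr (P - 1)" and C: "0 \<le> C" and P: "1 \<le> P"
  shows "primitive_abs A t \<le> C * \<bar>t\<bar> powr P"
proof (cases "t = 0")
  case False
  have even: "primitive_abs A t = primitive_abs A \<bar>t\<bar>" by (simp add: primitive_abs_def)
  have 0: "primitive_abs A 0 = 0" by (simp add: primitive_abs_def)
  obtain z where z: "0 < z" "z < \<bar>t\<bar>" "primitive_abs A \<bar>t\<bar> - primitive_abs A 0 = (\<bar>t\<bar> - 0) * A z"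
    using MVT2[of 0 "\<bar>t\<bar>" "primitive_abs A" A] primitive_abs_has_real_derivative[OF cont odd] False by auto
  have "A z \<le> C * \<bar>z\<bar> powr (P - 1)" using bound[of z] by simp
  also have "\<dots> \<le> C * \<bar>t\<bar> powr (P - 1)"
    using z P C by (intro mult_left_mono powr_mono2) auto
  finally have "\<bar>t\<bar> * A z \<le> \<bar>t\<bar> * (C * \<bar>t\<bar> powr (P - 1))" by (intro mult_left_mono) auto
  also have "\<dots> = C * \<bar>t\<bar> powr P"
    using powr_mult_base[of "\<bar>t\<bar>" "P - 1"] by (simp add: mult_ac)
  finally show ?thesis using z(3) 0 even by simp
qed (simp add: primitive_abs_def)

lemma lebesgue_borel_representative:
  fixes f :: "'a::euclidean_space \<Rightarrow> real"
  assumes "f \<in> borel_measurable lebesgue"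
  obtains g where "g \<in> borel_measurable borel" "AE x in lborel. f x = g x"
  using completion_ex_borel_measurable_real[OF assms] by auto

section \<open>Passage between admissible functions and the given function space\<close>

context weighted_domain
begin

lemma adm_imp_fractional_sobolev_zero:
  assumes u: "adm u"
  shows "u \<in> fractional_sobolev_zero \<Omega> s (\<lambda>x y. P)"
proof -
  have [measurable]: "u \<in> borel_measurable borel" using u by (simp add: adm_def)
  have "u \<in> Lvar UNIV (\<lambda>x. P)"
    unfolding Lvar_def lebesgue_on_UNIV_eq
    using adm_Lp[OF u] by (auto simp: nn_integral_completion measurable_completion intro!: exI[of _ 1])
  moreover have "(\<integral>\<^sup>+ (x, y). ennreal (\<bar>u x - u y\<bar> powr P /
      (1 powr P * norm (x - y) powr (real CARD('n) + s * P))) \<partial>lebesgue) < \<infinity>"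
    using u gagliardo_pair[of u s P] by (simp add: adm_def nn_integral_completion case_prod_unfold)
  then have "\<exists>\<zeta>>0. (\<integral>\<^sup>+ (x, y). ennreal (\<bar>u x - u y\<bar> powr P /
      (\<zeta> powr P * norm (x - y) powr (real CARD('n) + s * P))) \<partial>lebesgue) < \<infinity>"
    by (intro exI[of _ 1]) auto
  moreover have "AE x in lebesgue. x \<notin> \<Omega> \<longrightarrow> u x = 0"
    using u by (intro AE_I2) (auto simp: adm_def)
  ultimately show ?thesis
    by (simp add: fractional_sobolev_zero_def fractional_sobolev_def)
qed

text \<open>A Borel representative is cut off outside \<Omega>, which changes it only on a null set.
  For a constant exponent the scaling \<zeta> is a factor \<zeta>^P, so finiteness for some \<zeta>
  is finiteness of the unscaled energy.\<close>

lemma fractional_sobolev_zero_representative: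
  assumes u: "u \<in> fractional_sobolev_zero \<Omega> s (\<lambda>x y. P)"
  obtains h where "adm h" "AE x in lborel. u x = h x"
proof -
  have "u \<in> borel_measurable lebesgue"
    using u by (simp add: fractional_sobolev_zero_def fractional_sobolev_def Lvar_def lebesgue_on_UNIV_eq)
  then obtain g where [measurable]: "g \<in> borel_measurable borel" and g: "AE x in lborel. u x = g x"
    by (rule lebesgue_borel_representative)
  define h where "h x = (if x \<in> \<Omega> then g x else 0)" for x
  have [measurable]: "h \<in> borel_measurable borel" unfolding h_def[abs_def] by measurable
  have "AE x in lborel. x \<notin> \<Omega> \<longrightarrow> u x = 0"
    using u by (simp add: fractional_sobolev_zero_def AE_completion_iff)
  with g have ae: "AE x in lborel. u x = h x"
    by eventually_elim (auto simp: h_def)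
  let ?n = "\<lambda>z::(real^'n) \<times> (real^'n). norm (fst z - snd z) powr (real CARD('n) + s * P)"
  obtain \<zeta> where \<zeta>: "0 < \<zeta>" and fin: "(\<integral>\<^sup>+ z. ennreal (\<bar>u (fst z) - u (snd z)\<bar> powr P / (\<zeta> powr P * ?n z)) \<partial>lborel) < \<infinity>"
    using u by (auto simp: fractional_sobolev_zero_def fractional_sobolev_def nn_integral_completion case_prod_unfold)
  have "gagliardo s P h = (\<integral>\<^sup>+ z. ennreal (\<zeta> powr P) * ennreal (\<bar>h (fst z) - h (snd z)\<bar> powr P / (\<zeta> powr P * ?n z)) \<partial>lborel)"
    using \<zeta> by (simp add: gagliardo_pair ennreal_mult'[symmetric])
  also have "\<dots> = ennreal (\<zeta> powr P) * (\<integral>\<^sup>+ z. ennreal (\<bar>h (fst z) - h (snd z)\<bar> powr P / (\<zeta> powr P * ?n z)) \<partial>lborel)"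
    by (intro nn_integral_cmult) measurable
  also have "(\<integral>\<^sup>+ z. ennreal (\<bar>h (fst z) - h (snd z)\<bar> powr P / (\<zeta> powr P * ?n z)) \<partial>lborel) =
      (\<integral>\<^sup>+ z. ennreal (\<bar>u (fst z) - u (snd z)\<bar> powr P / (\<zeta> powr P * ?n z)) \<partial>lborel)"
    by (rule nn_integral_cong_AE, rule eventually_mono[OF AE_lborel_fst_snd[OF ae]]) simp
  finally have "gagliardo s P h < \<infinity>" using fin by (simp add: ennreal_mult_less_top)
  then have "adm h" by (simp add: adm_def h_def)
  then show thesis using ae that by blast
qed

end

text \<open>The mass on a cell is bounded by Hoelder's inequality in its Young form: |a| is at most
  \<zeta> (T + T^(1-Q) b^Q) with Q = N / s, where T is chosen per level so that the volume term and
  the L^Q term have the same order.\<close>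

lemma weight_from_Lvar:
  fixes \<Omega> :: "(real^'n) set"
  assumes \<Omega>: "open \<Omega>" "bounded \<Omega>" and s: "0 < s" "s < 1"
    and a: "a \<in> Lvar \<Omega> q" and q: "\<And>x. x \<in> \<Omega> \<Longrightarrow> real CARD('n) / s \<le> q x"
  obtains a' M where "a' \<in> borel_measurable borel" "\<And>x. x \<notin> \<Omega> \<Longrightarrow> a' x = 0"
    "AE x in lborel. x \<in> \<Omega> \<longrightarrow> a' x = a x" "0 < (M::real)"
    "\<And>k x. (\<integral>\<^sup>+ y. indicator (cell k x) y * (indicator \<Omega> y * ennreal (1 + \<bar>a' y\<bar>)) \<partial>lborel)
      \<le> ennreal (M * 2 powr (- (real k * (real CARD('n) - s))))"
    "(\<integral>\<^sup>+ y. indicator \<Omega> y * ennreal (1 + \<bar>a' y\<bar>) \<partial>lborel) < \<infinity>"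
proof -
  let ?N = "real CARD('n)"
  define Q where "Q = ?N / s"
  have "1 \<le> CARD('n)" by (simp add: Suc_leI)
  then have "1 \<le> ?N" by simp
  then have "s \<le> ?N" using s by linarith
  then have Q: "1 \<le> Q" using s by (simp add: Q_def le_divide_eq)
  have [measurable]: "\<Omega> \<in> sets borel" using \<Omega> by simp
  have "(\<lambda>x. indicator \<Omega> x *\<^sub>R a x) \<in> borel_measurable lebesgue"
    using a \<Omega> by (subst borel_measurable_restrict_space_iff[symmetric]) (auto simp: Lvar_def)
  then obtain g where [measurable]: "g \<in> borel_measurable borel" and g: "AE x in lborel. indicator \<Omega> x *\<^sub>R a x = g x"
    by (rule lebesgue_borel_representative)
  define a' where "a' x = indicator \<Omega> x * g x" for x
  have a'm [measurable]: "a' \<in> borel_measurable borel" unfolding a'_def[abs_def] by measurable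
  have ae: "AE x in lborel. x \<in> \<Omega> \<longrightarrow> a' x = a x"
    using g by eventually_elim (auto simp: a'_def)
  obtain \<zeta> where \<zeta>: "0 < \<zeta>" and fin: "(\<integral>\<^sup>+ x. ennreal (\<bar>a x / \<zeta>\<bar> powr q x) \<partial>lebesgue_on \<Omega>) < \<infinity>"
    using a by (auto simp: Lvar_def)
  have fin': "(\<integral>\<^sup>+ x. ennreal (\<bar>a x / \<zeta>\<bar> powr q x) * indicator \<Omega> x \<partial>lborel) < \<infinity>"
    using fin \<Omega> by (subst (asm) nn_integral_restrict_space) (auto simp: nn_integral_completion)
  \<comment> \<open>The target is integrability of b^Q on \<Omega>: it is at most 1 where b <= 1 and
    at most b^(q x) where b > 1, because Q <= q x. Bounded volume takes care of the first
    part.\<close>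
  define b where "b x = \<bar>a' x / \<zeta>\<bar>" for x
  have b0: "0 \<le> b x" for x by (simp add: b_def)
  have [measurable]: "b \<in> borel_measurable borel" unfolding b_def[abs_def] by measurable
  have \<Omega>fin: "emeasure lborel \<Omega> < \<infinity>" using \<Omega> by (intro emeasure_bounded_finite)
  have "(\<integral>\<^sup>+ x. indicator \<Omega> x * ennreal (b x powr Q) \<partial>lborel) \<le>
      (\<integral>\<^sup>+ x. indicator \<Omega> x * ennreal 1 + indicator \<Omega> x * (if 1 < b x then ennreal (b x powr Q) else 0) \<partial>lborel)"
  proof (rule nn_integral_mono)
    fix x
    show "indicator \<Omega> x * ennreal (b x powr Q) \<le> indicator \<Omega> x * ennreal 1 + indicator \<Omega> x * (if 1 < b x then ennreal (b x powr Q) else 0)"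
      using b0[of x] Q powr_mono2[of Q "b x" 1] by (auto simp: indicator_def)
  qed
  also have "\<dots> = emeasure lborel \<Omega> + (\<integral>\<^sup>+ x. indicator \<Omega> x * (if 1 < b x then ennreal (b x powr Q) else 0) \<partial>lborel)"
    by (simp add: nn_integral_add)
  finally have step1: "(\<integral>\<^sup>+ x. indicator \<Omega> x * ennreal (b x powr Q) \<partial>lborel) \<le>
      emeasure lborel \<Omega> + (\<integral>\<^sup>+ x. indicator \<Omega> x * (if 1 < b x then ennreal (b x powr Q) else 0) \<partial>lborel)" .
  have step2: "(\<integral>\<^sup>+ x. indicator \<Omega> x * (if 1 < b x then ennreal (b x powr Q) else 0) \<partial>lborel) \<le>
      (\<integral>\<^sup>+ x. ennreal (\<bar>a x / \<zeta>\<bar> powr q x) * indicator \<Omega> x \<partial>lborel)"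
  proof (rule nn_integral_mono_AE)
    show "AE x in lborel. indicator \<Omega> x * (if 1 < b x then ennreal (b x powr Q) else 0) \<le> ennreal (\<bar>a x / \<zeta>\<bar> powr q x) * indicator \<Omega> x"
      using ae
    proof eventually_elim
      case (elim x)
      then show ?case using q[of x] by (auto simp: indicator_def b_def Q_def intro!: ennreal_leI powr_mono)
    qed
  qed
  have "(\<integral>\<^sup>+ x. indicator \<Omega> x * ennreal (b x powr Q) \<partial>lborel) < \<infinity>"
    by (rule le_less_trans[OF order_trans[OF step1 add_left_mono[OF step2]]]) (use \<Omega>fin fin' in simp)
  moreover define I where "I = enn2real (\<integral>\<^sup>+ x. indicator \<Omega> x * ennreal (b x powr Q) \<partial>lborel)"
  ultimately have I: "0 \<le> I" "(\<integral>\<^sup>+ x. indicator \<Omega> x * ennreal (b x powr Q) \<partial>lborel) = ennreal I"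
    by simp_all
  have young: "ennreal (1 + \<bar>a' y\<bar>) \<le> ennreal (1 + \<zeta> * T) + ennreal (\<zeta> * T powr (1 - Q)) * ennreal (b y powr Q)" if T: "0 < T" for T y
  proof -
    have "\<bar>a' y\<bar> = \<zeta> * b y" using \<zeta> by (simp add: b_def)
    also have "\<dots> \<le> \<zeta> * (T + T powr (1 - Q) * b y powr Q)"
      using \<zeta> T Q b0[of y] by (intro mult_left_mono le_Young) auto
    finally have "1 + \<bar>a' y\<bar> \<le> (1 + \<zeta> * T) + \<zeta> * T powr (1 - Q) * b y powr Q" by (simp add: algebra_simps)
    then show ?thesis
      using \<zeta> T by (simp add: ennreal_mult'[symmetric] ennreal_plus[symmetric] ennreal_leI del: ennreal_plus)
  qed
  have key: "(\<integral>\<^sup>+ y. indicator C y * (indicator \<Omega> y * ennreal (1 + \<bar>a' y\<bar>)) \<partial>lborel) \<le>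
      ennreal (1 + \<zeta> * T) * emeasure lborel C + ennreal (\<zeta> * T powr (1 - Q)) * ennreal I"
    if T: "0 < T" and C [measurable]: "C \<in> sets borel" for T and C :: "(real^'n) set"
  proof -
    have "(\<integral>\<^sup>+ y. indicator C y * (indicator \<Omega> y * ennreal (1 + \<bar>a' y\<bar>)) \<partial>lborel) \<le>
      (\<integral>\<^sup>+ y. ennreal (1 + \<zeta> * T) * indicator C y + ennreal (\<zeta> * T powr (1 - Q)) * (indicator \<Omega> y * ennreal (b y powr Q)) \<partial>lborel)"
      using young[OF T] by (intro nn_integral_mono) (auto simp: indicator_def)
    also have "\<dots> = ennreal (1 + \<zeta> * T) * emeasure lborel C + ennreal (\<zeta> * T powr (1 - Q)) * ennreal I"
      by (simp add: nn_integral_add nn_integral_cmult I(2))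
    finally show ?thesis .
  qed
  define M where "M = 1 + \<zeta> * (1 + I)"
  have M: "0 < M" using \<zeta> I by (simp add: M_def add_pos_nonneg)
  have cell: "(\<integral>\<^sup>+ y. indicator (cell k x) y * (indicator \<Omega> y * ennreal (1 + \<bar>a' y\<bar>)) \<partial>lborel)
      \<le> ennreal (M * 2 powr (- (real k * (?N - s))))" for k x
  proof -
    \<comment> \<open>T = 2^(ks) balances the two terms: T times the cell volume 2^(-kN) and T^(1-Q)
      both equal 2^(-k(N-s)), because s Q = N. The summand 1 of M accounts for the constant part of
      the weight, \<zeta> and \<zeta> I for these two terms.\<close>
    define T where "T = (2::real) powr (real k * s)"
    have T: "0 < T" "1 \<le> T" using s by (auto simp: T_def ge_one_powr_ge_zero)
    have c: "1 / 2 ^ (k * CARD('n)) = (2::real) powr (- (real k * ?N))"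
    proof -
      have "(2::real) powr (real k * ?N) = 2 ^ (k * CARD('n))"
        by (subst powr_realpow[symmetric]) auto
      then show ?thesis by (simp add: powr_minus_divide)
    qed
    have e1: "T * 2 powr (- (real k * ?N)) = 2 powr (- (real k * (?N - s)))"
      unfolding T_def powr_add[symmetric] by (simp add: algebra_simps)
    have e2: "T powr (1 - Q) = 2 powr (- (real k * (?N - s)))"
    proof -
      have "s * Q = ?N" using s by (simp add: Q_def)
      then have "real k * s * (1 - Q) = - (real k * (?N - s))"
        by (metis (no_types, opaque_lifting) minus_diff_eq mult.assoc mult.right_neutral mult_minus_right right_diff_distrib)
      then show ?thesis by (simp only: T_def powr_powr)
    qed
    have "(\<integral>\<^sup>+ y. indicator (cell k x) y * (indicator \<Omega> y * ennreal (1 + \<bar>a' y\<bar>)) \<partial>lborel) \<le>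
      ennreal (1 + \<zeta> * T) * emeasure lborel (cell k x) + ennreal (\<zeta> * T powr (1 - Q)) * ennreal I"
      by (intro key T) measurable
    also have "\<dots> = ennreal ((1 + \<zeta> * T) * 2 powr (- (real k * ?N)) + \<zeta> * T powr (1 - Q) * I)"
      unfolding emeasure_cell c using \<zeta> T I by (simp add: ennreal_mult[symmetric] ennreal_plus[symmetric] del: ennreal_plus)
    also have "\<dots> \<le> ennreal (M * 2 powr (- (real k * (?N - s))))"
    proof (rule ennreal_leI)
      have "1 * 2 powr (- (real k * ?N)) \<le> T * 2 powr (- (real k * ?N))"
        using T by (intro mult_right_mono) auto
      then show "(1 + \<zeta> * T) * 2 powr (- (real k * ?N)) + \<zeta> * T powr (1 - Q) * I \<le> M * 2 powr (- (real k * (?N - s)))"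
        unfolding e2 by (simp add: M_def distrib_right distrib_left mult.assoc e1)
    qed
    finally show ?thesis .
  qed
  have "(\<integral>\<^sup>+ y. indicator \<Omega> y * ennreal (1 + \<bar>a' y\<bar>) \<partial>lborel) =
      (\<integral>\<^sup>+ y. indicator \<Omega> y * (indicator \<Omega> y * ennreal (1 + \<bar>a' y\<bar>)) \<partial>lborel)"
    by (intro nn_integral_cong) (auto simp: indicator_def)
  also have "\<dots> \<le> ennreal (1 + \<zeta> * 1) * emeasure lborel \<Omega> + ennreal (\<zeta> * 1 powr (1 - Q)) * ennreal I"
    by (intro key) auto
  also have "\<dots> < \<infinity>" using \<Omega>fin by (simp add: ennreal_mult_less_top)
  finally have "(\<integral>\<^sup>+ y. indicator \<Omega> y * ennreal (1 + \<bar>a' y\<bar>) \<partial>lborel) < \<infinity>" .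
  then show thesis
    by (intro that[of a' M] a'm ae M cell) (auto simp: a'_def)
qed

section \<open>Reduction of the given data and transfer of the minimiser\<close>

theorem theorem1p4:
  fixes \<Omega> \<Omega>0 :: "(real^'n) set"
    and s cA CA b0 b1 p_minus p_plus :: real
    and p K :: "real^'n \<Rightarrow> real^'n \<Rightarrow> real"
    and A :: "real \<Rightarrow> real"
    and m1 q a :: "real^'n \<Rightarrow> real"
  defines "p_minus \<equiv> Inf (range (\<lambda>(x, y). p x y))"
    and "p_plus \<equiv> Sup (range (\<lambda>(x, y). p x y))"
  assumes N: "CARD('n) \<ge> 2"
    and dom: "smooth_bounded_domain \<Omega>"
    and s: "0 < s" "s < 1"
    and p_cont: "continuous_on UNIV (\<lambda>(x, y). p x y)"
    and p_sym: "\<And>x y. p x y = p y x"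
    and p_bdd: "bdd_below (range (\<lambda>(x, y). p x y))" "bdd_above (range (\<lambda>(x, y). p x y))"
    and p_bounds: "1 < p_minus" "p_minus \<le> p_plus" "p_plus < real CARD('n) / s"
    and A_cont: "continuous_on UNIV A"
    and A_odd: "\<And>t. A (- t) = - A t"
    and A_convex: "strictly_convex_on UNIV (primitive_abs A)"
    and A_consts: "cA > 0" "CA > 0"
    and A_lower: "\<And>t x y. A t * t \<ge> cA * \<bar>t\<bar> powr p x y"
    and A_upper: "\<And>t x y. \<bar>A t\<bar> \<le> CA * \<bar>t\<bar> powr (p x y - 1)"
    and A_primitive: "\<And>t. A t * t \<le> p_plus * primitive_abs A t"
    and K_nonneg: "\<And>x y. K x y \<ge> 0"
    and K_meas: "(\<lambda>(x, y). K x y) \<in> borel_measurable lebesgue"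
    and K_consts: "0 < b0" "b0 \<le> b1"
    and K_bounds: "\<And>x y. x \<noteq> y \<Longrightarrow>
          b0 \<le> K x y * norm (x - y) powr (real CARD('n) + s * p x y) \<and>
          K x y * norm (x - y) powr (real CARD('n) + s * p x y) \<le> b1"
    and m1: "m1 \<in> C_plus (closure \<Omega>)"
    and q: "q \<in> C_plus (closure \<Omega>)"
    and exponents:
          "(INF x\<in>closure \<Omega>. m1 x) \<le> (SUP x\<in>closure \<Omega>. m1 x)"
          "(SUP x\<in>closure \<Omega>. m1 x) < p_minus"
          "real CARD('n) / s < (INF x\<in>closure \<Omega>. q x)"
          "(INF x\<in>closure \<Omega>. q x) \<le> (SUP x\<in>closure \<Omega>. q x)"
    and a: "a \<in> Lvar \<Omega> q"
    and \<Omega>0: "\<Omega>0 \<subseteq> \<Omega>" "\<Omega>0 \<in> sets lebesgue" "interior \<Omega>0 \<noteq> {}" "emeasure lebesgue \<Omega>0 > 0"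
    and a_pos: "\<And>x. x \<in> closure \<Omega>0 \<Longrightarrow> a x > 0"
  shows "\<exists>lam_star>0. \<forall>lam\<in>{0<..<lam_star}. is_eigenvalue \<Omega> s p A K a m1 lam"
proof -
  let ?N = "real CARD('n)"
  define P where "P = p 0 0"
  have p_le: "p x y \<le> p x' y'" for x y x' y'
  proof (rule exponent_le_of_powr_growth[OF A_consts])
    fix t :: real assume t: "1 \<le> t"
    have "cA * t powr p x y \<le> A t * t" using A_lower[of t x y] t by simp
    also have "\<dots> \<le> \<bar>A t\<bar> * t" using t by (intro mult_right_mono) auto
    also have "\<dots> \<le> CA * t powr (p x' y' - 1) * t"
      using A_upper[of t x' y'] t by (intro mult_right_mono) auto
    also have "\<dots> = CA * t powr p x' y'"
      using powr_mult_base[of t "p x' y' - 1"] t by (simp add: mult_ac)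
    finally show "cA * t powr p x y \<le> CA * t powr p x' y'" .
  qed
  have pP: "p = (\<lambda>x y. P)"
    unfolding P_def by (intro ext antisym p_le)
  have range_p: "range (\<lambda>(x, y). p x y) = {P}"
    unfolding pP by auto
  have p_minus: "p_minus = P" and p_plus: "p_plus = P"
    unfolding p_minus_def p_plus_def range_p by simp_all
  have P: "1 < P" using p_bounds p_minus by simp

  have \<Omega>: "open \<Omega>" "bounded \<Omega>" using dom by (auto simp: smooth_bounded_domain_def)
  have [measurable]: "\<Omega> \<in> sets borel" using \<Omega> by simp
  have compact: "compact (closure \<Omega>)" using \<Omega> by (simp add: compact_closure)
  have img: "compact (m1 ` closure \<Omega>)" "compact (q ` closure \<Omega>)"
    using m1 q compact by (auto simp: C_plus_def intro!: compact_continuous_image)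
  have q_ge: "?N / s \<le> q x" if "x \<in> \<Omega>" for x
  proof -
    have "(INF x\<in>closure \<Omega>. q x) \<le> q x"
      using that closure_subset img by (intro cINF_lower bounded_imp_bdd_below compact_imp_bounded) auto
    then show ?thesis using exponents(3) by simp
  qed
  define m1max where "m1max = (SUP x\<in>closure \<Omega>. m1 x)"
  have m1_le: "m1 x \<le> m1max" if "x \<in> closure \<Omega>" for x
    unfolding m1max_def using that img by (intro cSUP_upper bounded_imp_bdd_above compact_imp_bounded) auto
  have m1_gt: "1 < m1 x" if "x \<in> closure \<Omega>" for x using m1 that by (auto simp: C_plus_def)
  have "interior \<Omega>0 \<noteq> {}" by fact
  then obtain x0 where "x0 \<in> interior \<Omega>0" by blast
  then obtain r where r: "0 < r" "ball x0 r \<subseteq> \<Omega>0" by (auto simp: mem_interior)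
  have x0: "x0 \<in> \<Omega>" using r \<Omega>0(1) centre_in_ball[of x0 r] by blast
  then have x0c: "x0 \<in> closure \<Omega>" using closure_subset by blast
  \<comment> \<open>\<open>m1\<close> is controlled only on the closure of \<Omega>. Extending it by
    its value at one point makes the exponent bounds hold everywhere; the coefficient vanishes off
    \<Omega>, so the potential is unaffected.\<close>
  define m where "m x = (if x \<in> closure \<Omega> then m1 x else m1 x0)" for x
  have m_meas [measurable]: "m \<in> borel_measurable borel"
  proof -
    have "m1 \<in> borel_measurable (restrict_space borel (closure \<Omega>))"
      using m1 by (intro borel_measurable_continuous_on_restrict) (auto simp: C_plus_def)
    then show ?thesis unfolding m_def[abs_def]
      by (subst measurable_If_restrict_space_iff) auto
  qed
  have m_bounds: "1 < m x" "m x \<le> m1max" for x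
    using m1_le m1_gt x0c by (auto simp: m_def)

  obtain a0 M where a0 [measurable]: "a0 \<in> borel_measurable borel" and a0_zero: "\<And>x. x \<notin> \<Omega> \<Longrightarrow> a0 x = 0"
    and a0_ae: "AE x in lborel. x \<in> \<Omega> \<longrightarrow> a0 x = a x" and M: "0 < M"
    and cell: "\<And>k x. (\<integral>\<^sup>+ y. indicator (cell k x) y * (indicator \<Omega> y * ennreal (1 + \<bar>a0 y\<bar>)) \<partial>lborel)
      \<le> ennreal (M * 2 powr (- (real k * (?N - s))))"
    and fin: "(\<integral>\<^sup>+ y. indicator \<Omega> y * ennreal (1 + \<bar>a0 y\<bar>) \<partial>lborel) < \<infinity>"
    by (rule weight_from_Lvar[OF \<Omega> s a q_ge], assumption, rule that) simp_all
  \<comment> \<open>The sum 1 + |a0| serves two requirements at once: it is at least 1 on \<Omega>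
    and it dominates the coefficient.\<close>
  define w where "w y = indicator \<Omega> y * ennreal (1 + \<bar>a0 y\<bar>)" for y
  \<comment> \<open>\<open>a0\<close> equals \<open>a\<close>, and hence is positive on the ball, only almost everywhere.\<close>
  define a1 where "a1 x = (if x \<in> ball x0 r then \<bar>a0 x\<bar> else a0 x)" for x
  have a1_meas [measurable]: "a1 \<in> borel_measurable borel"
    unfolding a1_def[abs_def] by (intro measurable_If_set) auto
  have a1_ae: "AE x in lborel. x \<in> \<Omega> \<longrightarrow> a1 x = a x"
    using a0_ae
  proof eventually_elim
    case (elim x)
    have "x \<in> ball x0 r \<Longrightarrow> 0 < a x"
      using r(2) closure_subset by (intro a_pos) blast
    then show ?case using elim by (auto simp: a1_def)
  qed
  have a1_le: "ennreal \<bar>a1 x\<bar> \<le> w x" for x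
    using a0_zero[of x] by (cases "x \<in> \<Omega>") (auto simp: w_def a1_def intro: ennreal_leI)

  let ?\<kappa> = "\<lambda>z::(real^'n) \<times> (real^'n). norm (fst z - snd z) powr (?N + s * P)"
  obtain K0 where [measurable]: "K0 \<in> borel_measurable borel" and K0: "AE z in lborel. (\<lambda>(x, y). K x y) z = K0 z"
    using K_meas by (rule lebesgue_borel_representative)
  \<comment> \<open>Clipping makes the kernel bounds hold everywhere, also on the diagonal, where both bounds are \<open>0\<close> by \<open>1 / 0 = 0\<close>.\<close>
  define K1 where "K1 z = max (b0 / ?\<kappa> z) (min (b1 / ?\<kappa> z) (K0 z))" for z
  have K1_meas [measurable]: "K1 \<in> borel_measurable borel" unfolding K1_def[abs_def] by measurable
  have K1_bounds: "b0 / ?\<kappa> z \<le> K1 z" "K1 z \<le> b1 / ?\<kappa> z" for z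
    using K_consts by (auto simp: K1_def divide_right_mono)
  have K1_ae: "AE z in lborel. fst z \<noteq> snd z \<longrightarrow> K1 z = K (fst z) (snd z)"
    using K0
  proof eventually_elim
    case (elim z)
    show ?case
    proof
      assume z: "fst z \<noteq> snd z"
      then have "0 < ?\<kappa> z" by simp
      then have "b0 / ?\<kappa> z \<le> K (fst z) (snd z)" "K (fst z) (snd z) \<le> b1 / ?\<kappa> z"
        using K_bounds[OF z] unfolding pP by (simp_all add: pos_divide_le_eq pos_le_divide_eq)
      then show "K1 z = K (fst z) (snd z)" using elim by (simp add: K1_def case_prod_unfold)
    qed
  qed

  \<comment> \<open>The lower growth bound concerns A t * t; the inequality A t * t <= P * primitive
    transfers it to the primitive at the cost of the factor 1 / P.\<close>
  have prim_lower: "cA / P * \<bar>t\<bar> powr P \<le> primitive_abs A t" for t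
  proof -
    have "cA * \<bar>t\<bar> powr P \<le> P * primitive_abs A t"
      using A_lower[of t 0 0] A_primitive[of t] unfolding p_plus P_def[symmetric] by simp
    then show ?thesis using P by (simp add: field_simps)
  qed
  have A_up: "\<bar>A t\<bar> \<le> CA * \<bar>t\<bar> powr (P - 1)" for t
    using A_upper[of t 0 0] by (simp add: P_def)
  interpret variational s P M w \<Omega> A "primitive_abs A" "cA / P" CA b0 b1 m1max K1 a1 m
  proof
    show "w \<in> borel_measurable borel" unfolding w_def[abs_def] by measurable
    show "(\<integral>\<^sup>+ y. indicator (cell k x) y * w y \<partial>lborel) \<le> ennreal (M * 2 powr (- (real k * (?N - s))))" for k x
      unfolding w_def by (rule cell)
    show "(\<integral>\<^sup>+ y. w y \<partial>lborel) < \<infinity>" unfolding w_def by (rule fin)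
    show "1 \<le> w x" if "x \<in> \<Omega>" for x
      using that ennreal_leI[of 1 "1 + \<bar>a0 x\<bar>"] by (simp add: w_def)
    show "(primitive_abs A has_real_derivative A t) (at t)" for t
      by (rule primitive_abs_has_real_derivative[OF A_cont A_odd])
    show "A \<in> borel_measurable borel" by (rule borel_measurable_continuous_onI[OF A_cont])
    show "primitive_abs A t \<le> CA * \<bar>t\<bar> powr P" for t
      using A_consts P by (intro primitive_abs_le A_cont A_odd A_up) auto
    show "m1max < P" using exponents(2) by (simp add: m1max_def p_minus)
  qed (use s P M \<Omega> A_up prim_lower A_consts K_consts K1_meas K1_bounds a1_meas a1_le m_meas m_bounds in auto)

  have tent: "adm (tent x0 r)"
    unfolding adm_def using gagliardo_tent_finite[OF \<open>0 < s\<close> \<open>s < 1\<close> \<open>1 < P\<close> r(1)] r(2) \<Omega>0(1)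
    by (auto intro!: tent_eq_0)
  have tent_a1: "0 \<le> a1 x" if "tent x0 r x \<noteq> 0" for x
    using that tent_eq_0[of x x0 r] by (auto simp: a1_def)
  have "0 < pot (tent x0 r)"
  proof -
    let ?f = "\<lambda>x. a1 x * (\<bar>tent x0 r x\<bar> powr m x / m x)"
    have f0: "0 \<le> ?f x" for x
      using tent_a1[of x] m_bounds(1)[of x] by (cases "tent x0 r x = 0") auto
    have "pot (tent x0 r) \<noteq> 0"
    proof
      assume "pot (tent x0 r) = 0"
      then have "AE x in lborel. ?f x = 0"
        unfolding pot_def using adm_pot_integrable(1)[OF tent] f0
        by (subst (asm) integral_nonneg_eq_0_iff_AE) auto
      with a1_ae have "AE x in lborel. x \<notin> ball x0 r"
      proof eventually_elim
        case (elim x)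
        show ?case
        proof
          assume x: "x \<in> ball x0 r"
          then have "0 < a x" using r(2) closure_subset by (intro a_pos) blast
          moreover have "x \<in> \<Omega>" using x r(2) \<Omega>0(1) by blast
          ultimately have "0 < a1 x" using elim(1) by simp
          then show False using elim(2) tent_pos[OF x] m_bounds(1)[of x] by simp
        qed
      qed
      then have "emeasure lborel (ball x0 r) = 0"
        by (subst (asm) AE_iff_measurable[OF _ refl]) (auto simp: ball_def)
      then show False using content_ball_pos[OF r(1), of x0] by (simp add: measure_def)
    qed
    moreover have "0 \<le> pot (tent x0 r)"
      unfolding pot_def by (intro Bochner_Integration.integral_nonneg f0)
    ultimately show ?thesis by simp
  qed
  note tent = tent tent_a1 this

  have "is_eigenvalue \<Omega> s p A K a m1 lam" if lam: "0 < lam" "lam < lam_star" for lam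
  proof -
    obtain v where v: "adm v" and min: "\<And>u. adm u \<Longrightarrow> J lam v \<le> J lam u"
      by (rule J_minimiser[OF lam], rule that) simp_all
    have [measurable]: "v \<in> borel_measurable borel" by (rule adm_measurable[OF v])
    have "\<not> (AE x in lborel. v x = 0)"
      by (rule minimiser_nontrivial[OF tent lam(1) v min])
    then have nontriv: "\<not> (AE x in lebesgue. v x = 0)" by (simp add: AE_completion_iff)
    have eq: "integrable lebesgue (\<lambda>(x, y). A (v x - v y) * (u x - u y) * K x y) \<and>
          integrable (lebesgue_on \<Omega>) (\<lambda>x. a x * \<bar>v x\<bar> powr (m1 x - 2) * v x * u x) \<and>
          (\<integral>(x, y). A (v x - v y) * (u x - u y) * K x y \<partial>lebesgue) =
          lam * (\<integral>x. a x * \<bar>v x\<bar> powr (m1 x - 2) * v x * u x \<partial>(lebesgue_on \<Omega>))"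
      if u: "u \<in> fractional_sobolev_zero \<Omega> s (\<lambda>x y. P)" for u
    proof -
      obtain h where h: "adm h" and uh: "AE x in lborel. u x = h x"
        by (rule fractional_sobolev_zero_representative[OF u])
      have [measurable]: "h \<in> borel_measurable borel" by (rule adm_measurable[OF h])
      let ?F = "\<lambda>(x, y). A (v x - v y) * (u x - u y) * K x y"
        and ?G = "\<lambda>z. A (v (fst z) - v (snd z)) * (h (fst z) - h (snd z)) * K1 z"
      \<comment> \<open>On the diagonal the differences of v and of u vanish, so both integrands are
        0 there whatever the kernels are.\<close>
      have "AE z in lborel. ?G z = ?F z"
        using AE_lborel_fst_snd[OF uh] K1_ae
      proof eventually_elim
        case (elim z)
        then show ?case by (cases "fst z = snd z") (auto simp: case_prod_unfold)
      qed
      then have FG: "AE z in lebesgue. ?G z = ?F z" by (rule AE_completion)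
      have G: "integrable lebesgue ?G" "(\<integral>z. ?G z \<partial>lebesgue) = (\<integral>z. ?G z \<partial>lborel)"
        using energy_variation(1)[OF v h] by (auto simp: integrable_completion integral_completion)
      \<comment> \<open>u is only Lebesgue measurable. Measurability of its difference function on
        the product comes from a.e. equality with the Borel integrand, by completeness of the
        measure.\<close>
      have F_meas: "?F \<in> borel_measurable lebesgue"
        by (rule borel_measurable_AE[OF _ FG]) (use G(1) in auto)
      have F: "integrable lebesgue ?F" by (rule integrable_cong_AE_imp[OF G(1) F_meas FG])
      have F_int: "(\<integral>z. ?F z \<partial>lebesgue) = (\<integral>z. ?G z \<partial>lborel)"
        unfolding G(2)[symmetric] by (rule integral_cong_AE[OF F_meas]) (use G(1) FG in auto)
      let ?f = "\<lambda>x. a x * \<bar>v x\<bar> powr (m1 x - 2) * v x * u x"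
        and ?g = "\<lambda>x. a1 x * \<bar>v x\<bar> powr (m x - 2) * v x * h x"
      have "AE x in lborel. ?g x = indicator \<Omega> x *\<^sub>R ?f x"
        using uh a1_ae
      proof eventually_elim
        case (elim x)
        show ?case
        proof (cases "x \<in> \<Omega>")
          case True
          moreover have "x \<in> closure \<Omega>" using True closure_subset by blast
          ultimately show ?thesis using elim by (simp add: m_def)
        next
          case False
          \<comment> \<open>Since v vanishes at every point off \<Omega>, the integral over the
            whole space from the variational setting is already the integral over \<Omega>.\<close>
          then have "v x = 0" using v by (simp add: adm_def)
          then show ?thesis using False by simp
        qed
      qed
      then have fg: "AE x in lebesgue. ?g x = indicator \<Omega> x *\<^sub>R ?f x" by (rule AE_completion)
      have g: "integrable lebesgue ?g" "(\<integral>x. ?g x \<partial>lebesgue) = (\<integral>x. ?g x \<partial>lborel)"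
        using pot_variation(1)[OF v h] by (auto simp: integrable_completion integral_completion)
      have f_meas: "(\<lambda>x. indicator \<Omega> x *\<^sub>R ?f x) \<in> borel_measurable lebesgue"
        by (rule borel_measurable_AE[OF _ fg]) (use g(1) in auto)
      have f: "integrable lebesgue (\<lambda>x. indicator \<Omega> x *\<^sub>R ?f x)"
        by (rule integrable_cong_AE_imp[OF g(1) f_meas fg])
      have f_int: "(\<integral>x. indicator \<Omega> x *\<^sub>R ?f x \<partial>lebesgue) = (\<integral>x. ?g x \<partial>lborel)"
        unfolding g(2)[symmetric] by (rule integral_cong_AE[OF f_meas]) (use g(1) fg in auto)
      have \<Omega>_leb: "\<Omega> \<inter> space lebesgue \<in> sets lebesgue" using \<Omega> by auto
      have "integrable (lebesgue_on \<Omega>) ?f"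
        using f by (subst integrable_restrict_space[OF \<Omega>_leb])
      moreover have "(\<integral>x. ?f x \<partial>(lebesgue_on \<Omega>)) = (\<integral>x. ?g x \<partial>lborel)"
        using f_int by (subst integral_restrict_space[OF \<Omega>_leb])
      moreover have "(\<integral>z. ?G z \<partial>lborel) = lam * (\<integral>x. ?g x \<partial>lborel)"
        by (rule euler_lagrange[OF v min h])
      ultimately show ?thesis using F F_int by simp
    qed
    show ?thesis
      unfolding is_eigenvalue_def pP
      by (intro bexI[of _ v] conjI nontriv ballI eq[THEN conjunct1] eq[THEN conjunct2, THEN conjunct1]
          eq[THEN conjunct2, THEN conjunct2] adm_imp_fractional_sobolev_zero[OF v])
  qed
  then show ?thesis using lam_star by (intro exI[of _ lam_star]) auto
qed

end
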